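(* Let $\mathbf g$ be the Koiso-Cao soliton metric on $\mathbb{CP}^2\#\overline{\mathbb{CP}^2}$ (defined in the context), and let $S_{\mathbf g}$ be its scalar curvature, which is $U(2)$-invariant and hence a function of the orbit parameter $t\in[0,\beta]$. Then $S_{\mathbf g}$ is decreasing as a function of $t\in[0,\beta]$.
   Context: The manifold and the action. Let $X,Y,Z$ be the left-invariant frame on $S^3=SU(2)$ with $[X,Y]=2Z$, $[Y,Z]=2X$, $[Z,X]=2Y$, orthonormal for the round metric of the unit sphere $S^3$; the orbits of the flow of $X$ (closed, of period $2\pi$) are the fibers of the Hopf fibration $S^3\to S^2$. The group $U(2)\cong (SU(2)\times U(1))/\{\pm1\}$ acts on $S^3$, $SU(2)$ by left translations and $U(1)$ by the flow of $X$. $M=\mathbb{CP}^2\#\overline{\mathbb{CP}^2}$ is obtained from $S^3\times[0,\beta]$ by collapsing the Hopf fibers in each of the two ends $S^3\times\{0\}$ and $S^3\times\{\beta\}$. $U(2)$ acts on $M$ with principal orbits $S^3\times\{t\}$, $t\in(0,\beta)$, forming an open dense subset $S^3\times(0,\beta)$, and with two singular orbits diffeomorphic to $S^2$. A $U(2)$-invariant function on $M$ is a function of $t\in[0,\beta]$ alone. The Koiso-Cao soliton. For $c\in\mathbb{R}$ let $h_c$ be the solution of $$2hh''+4h'^2-4+h^2(1+c\,h'^2)=0,\qquad h(0)=\sqrt6,\quad h'(0)=0.$$ There is a unique constant $c_o$ (numerically $c_o\approx-0.5276195$) for which there is $\beta>0$ with $h_{c_o}>0$ on $[0,\beta]$,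 $h_{c_o}'<0$ on $(0,\beta)$, $h_{c_o}'(\beta)=0$ and $h_{c_o}(\beta)=\sqrt2$. Put $h=h_{c_o}$ and $f=-hh'$ on $[0,\beta]$. The Koiso-Cao soliton $\mathbf g$ is the smooth extension to $M$ of the metric $g$ on $S^3\times(0,\beta)$ for which $\partial_t,\ X/f,\ Y/h,\ Z/h$ is an orthonormal frame. It is a $U(2)$-invariant Kähler metric and a gradient shrinking Ricci soliton: $Ric(\mathbf g)+\nabla\nabla u-\mathbf g=0$ with $u=-\tfrac{c_o}{2}h^2$. *)

theory Defs
  imports "HOL-Analysis.Analysis"
begin

section \<open>Riemannian metrics on open subsets of a Euclidean space\<close>

text \<open>
  A metric is given by its coordinate expression \<open>g x u v\<close> (base point \<open>x\<close>, tangent vectors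
  \<open>u\<close>, \<open>v\<close>).  The curvature conventions are
  \<open>R(u,v)w = \<nabla>\<^sub>u\<nabla>\<^sub>vw - \<nabla>\<^sub>v\<nabla>\<^sub>uw - \<nabla>\<^bsub>[u,v]\<^esub>w\<close> and \<open>Ric(v,w) = tr (u \<mapsto> R(u,v)w)\<close>, so that
  round spheres have positive curvature.
\<close>

primrec times_cont_diff_on ::
  "nat \<Rightarrow> 'a set \<Rightarrow> ('a::real_normed_vector \<Rightarrow> 'b::real_normed_vector) \<Rightarrow> bool" where
  "times_cont_diff_on 0 U \<phi> \<longleftrightarrow> continuous_on U \<phi>"
| "times_cont_diff_on (Suc k) U \<phi> \<longleftrightarrow>
     (\<forall>x\<in>U. \<phi> differentiable (at x)) \<and>
     (\<forall>v. times_cont_diff_on k U (\<lambda>x. frechet_derivative \<phi> (at x) v))"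

definition smooth_on :: "'a set \<Rightarrow> ('a::real_normed_vector \<Rightarrow> 'b::real_normed_vector) \<Rightarrow> bool" where
  "smooth_on U \<phi> \<longleftrightarrow> (\<forall>k. times_cont_diff_on k U \<phi>)"

definition riemannian_metric_on :: "'a::euclidean_space set \<Rightarrow> ('a \<Rightarrow> 'a \<Rightarrow> 'a \<Rightarrow> real) \<Rightarrow> bool" where
  "riemannian_metric_on U g \<longleftrightarrow>
     (\<forall>x\<in>U. bilinear (g x) \<and> (\<forall>u v. g x u v = g x v u) \<and> (\<forall>u. u \<noteq> 0 \<longrightarrow> 0 < g x u u)) \<and>
     (\<forall>u v. smooth_on U (\<lambda>x. g x u v))"

text \<open>The vector that represents a linear form with respect to the metric (index raising).\<close>

definition metric_dual :: "('a::euclidean_space \<Rightarrow> 'a \<Rightarrow> 'a \<Rightarrow> real) \<Rightarrow> 'a \<Rightarrow> ('a \<Rightarrow> real) \<Rightarrow> 'a" where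
  "metric_dual g x \<phi> = (THE v. \<forall>w. g x v w = \<phi> w)"

text \<open>
  The Christoffel symbols as a bilinear map: \<open>christoffel g x u v\<close> is \<open>\<nabla>\<^sub>uv\<close> at \<open>x\<close> for the
  constant vector fields \<open>u\<close> and \<open>v\<close>.
\<close>

definition christoffel :: "('a::euclidean_space \<Rightarrow> 'a \<Rightarrow> 'a \<Rightarrow> real) \<Rightarrow> 'a \<Rightarrow> 'a \<Rightarrow> 'a \<Rightarrow> 'a" where
  "christoffel g x u v = metric_dual g x (\<lambda>w.
     (frechet_derivative (\<lambda>y. g y v w) (at x) u
      + frechet_derivative (\<lambda>y. g y u w) (at x) v
      - frechet_derivative (\<lambda>y. g y u v) (at x) w) / 2)"

definition riemann_curvature ::
  "('a::euclidean_space \<Rightarrow> 'a \<Rightarrow> 'a \<Rightarrow> real) \<Rightarrow> 'a \<Rightarrow> 'a \<Rightarrow> 'a \<Rightarrow> 'a \<Rightarrow> 'a" where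
  "riemann_curvature g x u v w =
     frechet_derivative (\<lambda>y. christoffel g y v w) (at x) u
     - frechet_derivative (\<lambda>y. christoffel g y u w) (at x) v
     + christoffel g x u (christoffel g x v w)
     - christoffel g x v (christoffel g x u w)"

definition ricci_curvature :: "('a::euclidean_space \<Rightarrow> 'a \<Rightarrow> 'a \<Rightarrow> real) \<Rightarrow> 'a \<Rightarrow> 'a \<Rightarrow> 'a \<Rightarrow> real" where
  "ricci_curvature g x v w = (\<Sum>b\<in>Basis. riemann_curvature g x b v w \<bullet> b)"

definition scalar_curvature :: "('a::euclidean_space \<Rightarrow> 'a \<Rightarrow> 'a \<Rightarrow> real) \<Rightarrow> 'a \<Rightarrow> real" where
  "scalar_curvature g x = (\<Sum>b\<in>Basis. metric_dual g x (ricci_curvature g x b) \<bullet> b)"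


section \<open>The three-sphere with its left-invariant frame\<close>

text \<open>
  \<open>SU(2)\<close> is identified with the unit sphere of \<open>\<complex>\<^sup>2\<close> by taking the first column of a matrix.
  Left translations then are the standard linear action on \<open>\<complex>\<^sup>2\<close>, and the three fields below
  are right multiplication by the quaternions \<open>i\<close>, \<open>j\<close>, \<open>k\<close>; the flow of \<open>X\<close> is
  multiplication by \<open>e\<^sup>i\<^sup>\<theta>\<close>.
\<close>

type_synonym complex2 = "complex \<times> complex"

definition S3 :: "complex2 set" where
  "S3 = {q. norm q = 1}"

definition cscale :: "complex \<Rightarrow> complex2 \<Rightarrow> complex2" where
  "cscale a q = (a * fst q, a * snd q)"

definition X_field :: "complex2 \<Rightarrow> complex2" where
  "X_field q = (\<i> * fst q, \<i> * snd q)"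

definition Y_field :: "complex2 \<Rightarrow> complex2" where
  "Y_field q = (- cnj (snd q), cnj (fst q))"

definition Z_field :: "complex2 \<Rightarrow> complex2" where
  "Z_field q = (\<i> * cnj (snd q), - \<i> * cnj (fst q))"

definition lie_bracket :: "('a::real_normed_vector \<Rightarrow> 'a) \<Rightarrow> ('a \<Rightarrow> 'a) \<Rightarrow> 'a \<Rightarrow> 'a" where
  "lie_bracket V W x = frechet_derivative W (at x) (V x) - frechet_derivative V (at x) (W x)"

lemma frame_linear: "bounded_linear X_field" "bounded_linear Y_field" "bounded_linear Z_field"
proof -
  have "linear X_field" "linear Y_field" "linear Z_field"
    by (auto intro!: linearI
        simp: X_field_def Y_field_def Z_field_def algebra_simps scaleR_conv_of_real)
  then show "bounded_linear X_field" "bounded_linear Y_field" "bounded_linear Z_field"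
    by (simp_all add: linear_conv_bounded_linear)
qed

lemma frame_brackets:
  "lie_bracket X_field Y_field q = 2 *\<^sub>R Z_field q"
  "lie_bracket Y_field Z_field q = 2 *\<^sub>R X_field q"
  "lie_bracket Z_field X_field q = 2 *\<^sub>R Y_field q"
  by (simp_all add: lie_bracket_def bounded_linear_imp_has_derivative frame_linear
      frechet_derivative_at[OF bounded_linear_imp_has_derivative, symmetric])
     (simp_all add: X_field_def Y_field_def Z_field_def prod_eq_iff complex_eq_iff)

lemma frame_orthonormal:
  assumes "q \<in> S3"
  shows "norm (X_field q) = 1" "norm (Y_field q) = 1" "norm (Z_field q) = 1"
    and "X_field q \<bullet> q = 0" "Y_field q \<bullet> q = 0" "Z_field q \<bullet> q = 0"
    and "X_field q \<bullet> Y_field q = 0" "Y_field q \<bullet> Z_field q = 0" "Z_field q \<bullet> X_field q = 0"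
  using assms
  by (simp_all add: S3_def X_field_def Y_field_def Z_field_def norm_Pair norm_mult inner_prod_def
      inner_complex_def norm_prod_def add.commute algebra_simps)


section \<open>The manifold\<close>

text \<open>
  Points of \<open>M = S\<^sup>3 \<times> [0,\<beta>] / \<sim>\<close> are equivalence classes, where \<open>\<sim>\<close> identifies the points of a
  Hopf fibre in each of the two ends.
\<close>

definition hopf_collapse :: "real \<Rightarrow> ((complex2 \<times> real) \<times> (complex2 \<times> real)) set" where
  "hopf_collapse \<beta> = {((q, t), (q', t')). q \<in> S3 \<and> q' \<in> S3 \<and> t \<in> {0..\<beta>} \<and> t' = t \<and>
     (q' = q \<or> t \<in> {0, \<beta>} \<and> (\<exists>\<theta>. q' = cscale (cis \<theta>) q))}"

definition M_manifold :: "real \<Rightarrow> (complex2 \<times> real) set set" where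
  "M_manifold \<beta> = (S3 \<times> {0..\<beta>}) // hopf_collapse \<beta>"

definition M_point :: "real \<Rightarrow> complex2 \<Rightarrow> real \<Rightarrow> (complex2 \<times> real) set" where
  "M_point \<beta> q t = hopf_collapse \<beta> `` {(q, t)}"

text \<open>
  The smooth structure of \<open>M\<close> is given by four inverse charts, all defined on
  \<open>{(v,w) \<in> \<complex>\<^sup>2. \<bar>v\<bar> < \<beta>}\<close>.  A neighbourhood of each singular orbit is a disc bundle over \<open>S\<^sup>2\<close>;
  \<open>w\<close> is an affine coordinate on the base \<open>S\<^sup>2 = \<complex>\<P>\<^sup>1\<close> (with two choices, according to the
  homogeneous coordinate that does not vanish), and \<open>v\<close> is the coordinate in the disc: its phase
  is the position in the Hopf fibre, its modulus is the distance in \<open>t\<close> to the singular orbit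
  \<open>v = 0\<close>.
\<close>

datatype chart_end = Lower_End | Upper_End
datatype base_chart = First_Nonzero | Second_Nonzero
type_synonym chart_index = "chart_end \<times> base_chart"

definition chart_dom :: "real \<Rightarrow> complex2 set" where
  "chart_dom \<beta> = {(v, w). norm v < \<beta>}"

fun hopf_section :: "base_chart \<Rightarrow> complex \<Rightarrow> complex2" where
  "hopf_section First_Nonzero w = (1, w) /\<^sub>R sqrt (1 + (norm w)\<^sup>2)"
| "hopf_section Second_Nonzero w = (w, 1) /\<^sub>R sqrt (1 + (norm w)\<^sup>2)"

fun orbit_param :: "real \<Rightarrow> chart_end \<Rightarrow> complex \<Rightarrow> real" where
  "orbit_param \<beta> Lower_End v = norm v"
| "orbit_param \<beta> Upper_End v = \<beta> - norm v"

text \<open>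
  For \<open>v = 0\<close> the phase is irrelevant, since the fibre is collapsed; it is set to 1.
\<close>

fun chart_lift :: "real \<Rightarrow> chart_index \<Rightarrow> complex2 \<Rightarrow> complex2 \<times> real" where
  "chart_lift \<beta> (e, k) (v, w) =
     (cscale (if v = 0 then 1 else sgn v) (hopf_section k w), orbit_param \<beta> e v)"

definition inv_chart :: "real \<Rightarrow> chart_index \<Rightarrow> complex2 \<Rightarrow> (complex2 \<times> real) set" where
  "inv_chart \<beta> \<kappa> x = (case chart_lift \<beta> \<kappa> x of (q, t) \<Rightarrow> M_point \<beta> q t)"

text \<open>The four charts cover \<open>M\<close>.\<close>

lemma inv_chart_cover:
  assumes "0 < \<beta>" "q \<in> S3" "t \<in> {0..\<beta>}"
  shows "\<exists>\<kappa>. \<exists>x\<in>chart_dom \<beta>. inv_chart \<beta> \<kappa> x = M_point \<beta> q t"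
proof -
  have norm_q: "(norm (fst q))\<^sup>2 + (norm (snd q))\<^sup>2 = 1"
    using assms(2) by (simp add: S3_def norm_prod_def)
  have sect: "\<exists>k w s. norm s = 1 \<and> cscale s (hopf_section k w) = q"
  proof (cases "fst q = 0")
    case False
    let ?a = "fst q" and ?b = "snd q"
    have "1 + (norm (?b / ?a))\<^sup>2 = (1 / norm ?a)\<^sup>2"
      using norm_q False by (simp add: norm_divide field_simps)
    then have "sqrt (1 + (norm (?b / ?a))\<^sup>2) = 1 / norm ?a"
      by simp
    then have "cscale (sgn ?a) (hopf_section First_Nonzero (?b / ?a)) = q"
      using False by (simp add: cscale_def prod_eq_iff sgn_div_norm scaleR_conv_of_real)
    then show ?thesis
      using False by (intro exI[of _ First_Nonzero] exI[of _ "?b / ?a"] exI[of _ "sgn ?a"]) (simp add: norm_sgn)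
  next
    case True
    then have "norm (snd q) = 1"
      using assms(2) True by (cases q) (simp add: S3_def)
    moreover have "cscale (snd q) (hopf_section Second_Nonzero 0) = q"
      using True by (simp add: cscale_def prod_eq_iff)
    ultimately show ?thesis
      by blast
  qed
  then obtain k w s where s: "norm s = 1" "cscale s (hopf_section k w) = q"
    by blast
  have end_point: "M_point \<beta> (cscale 1 (hopf_section k w)) t = M_point \<beta> q t" if "t \<in> {0, \<beta>}"
  proof -
    let ?p = "hopf_section k w"
    have S3_iff: "cscale z u \<in> S3 \<longleftrightarrow> u \<in> S3" if "norm z = 1" for z u
      using that by (simp add: S3_def cscale_def norm_prod_def norm_mult)
    have "s \<noteq> 0"
      using s(1) by auto
    have q: "q = cscale s ?p"
      using s(2) by simp
    have p: "?p = cscale (inverse s) q"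
      using \<open>s \<noteq> 0\<close> by (simp add: q cscale_def flip: mult.assoc)
    obtain \<theta> where \<theta>: "s = cis \<theta>"
      using rcis_cmod_Arg[of s] s(1) that[of "Arg s"] by (simp add: rcis_def)
    have mult: "cscale y (cscale z u) = cscale (y * z) u" for y z u
      by (simp add: cscale_def mult.assoc)
    have eqv: "(\<exists>\<phi>. r = cscale (cis \<phi>) ?p) \<longleftrightarrow> (\<exists>\<phi>. r = cscale (cis \<phi>) q)" for r
    proof
      assume "\<exists>\<phi>. r = cscale (cis \<phi>) ?p"
      then obtain \<phi> where "r = cscale (cis \<phi>) ?p" by blast
      then have "r = cscale (cis (\<phi> - \<theta>)) q"
        by (simp add: p \<theta> mult cis_mult cis_inverse)
      then show "\<exists>\<phi>. r = cscale (cis \<phi>) q" by blast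
    next
      assume "\<exists>\<phi>. r = cscale (cis \<phi>) q"
      then obtain \<phi> where "r = cscale (cis \<phi>) q" by blast
      then have "r = cscale (cis (\<phi> + \<theta>)) ?p"
        by (simp add: q \<theta> mult cis_mult)
      then show "\<exists>\<phi>. r = cscale (cis \<phi>) ?p" by blast
    qed
    have one: "cscale 1 u = u" for u
      by (simp add: cscale_def)
    have cls: "M_point \<beta> u t = {(r, t) |r. r \<in> S3 \<and> (\<exists>\<phi>. r = cscale (cis \<phi>) u)}"
      if "u \<in> S3" for u
    proof -
      have "\<exists>\<phi>. u = cscale (cis \<phi>) u"
        by (rule exI[of _ 0]) (simp add: one)
      then show ?thesis
        using that assms(3) \<open>t \<in> {0, \<beta>}\<close> by (auto simp: M_point_def hopf_collapse_def)
    qed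
    have "?p \<in> S3"
      using assms(2) s S3_iff[of s ?p] by simp
    then show ?thesis
      using assms(2) by (simp add: cls one eqv)
  qed
  consider "t = 0" | "t = \<beta>" | "0 < t" "t < \<beta>"
    using assms(3) by fastforce
  then show ?thesis
  proof cases
    case 1
    then have "inv_chart \<beta> (Lower_End, k) (0, w) = M_point \<beta> q t"
      using end_point by (simp add: inv_chart_def)
    then show ?thesis
      using assms(1) by (force simp: chart_dom_def)
  next
    case 2
    then have "inv_chart \<beta> (Upper_End, k) (0, w) = M_point \<beta> q t"
      using end_point by (simp add: inv_chart_def)
    then show ?thesis
      using assms(1) by (force simp: chart_dom_def)
  next
    case 3
    then have "inv_chart \<beta> (Lower_End, k) (t *\<^sub>R s, w) = M_point \<beta> q t"
      using s by (auto simp: inv_chart_def sgn_div_norm)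
    then show ?thesis
      using 3 s(1) by (force simp: chart_dom_def)
  qed
qed


section \<open>The Koiso-Cao soliton\<close>

text \<open>
  The metric on \<open>S\<^sup>3 \<times> (0,\<beta>)\<close> with orthonormal frame \<open>\<partial>\<^sub>t\<close>, \<open>X/f\<close>, \<open>Y/h\<close>, \<open>Z/h\<close>.  Tangent vectors
  of \<open>S\<^sup>3 \<times> \<real>\<close> at \<open>(q,t)\<close> are pairs \<open>(a,r)\<close> with \<open>a\<close> orthogonal to \<open>q\<close>; since \<open>X\<close>, \<open>Y\<close>, \<open>Z\<close> are
  orthonormal for the round metric, the components of \<open>a\<close> are the inner products with them.
\<close>

definition invariant_metric ::
  "(real \<Rightarrow> real) \<Rightarrow> (real \<Rightarrow> real) \<Rightarrow> complex2 \<times> real \<Rightarrow> complex2 \<times> real \<Rightarrow> complex2 \<times> real \<Rightarrow> real" where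
  "invariant_metric f h = (\<lambda>(q, t) (a, r) (b, s).
     r * s
     + (f t)\<^sup>2 * ((a \<bullet> X_field q) * (b \<bullet> X_field q))
     + (h t)\<^sup>2 * ((a \<bullet> Y_field q) * (b \<bullet> Y_field q) + (a \<bullet> Z_field q) * (b \<bullet> Z_field q)))"

lemma invariant_metric_frame:
  fixes f h :: "real \<Rightarrow> real"
  assumes "q \<in> S3" "f t \<noteq> 0" "h t \<noteq> 0"
  defines "E \<equiv> [(0, 1), (X_field q /\<^sub>R f t, 0), (Y_field q /\<^sub>R h t, 0), (Z_field q /\<^sub>R h t, 0)]"
  assumes "i < 4" "j < 4"
  shows "invariant_metric f h (q, t) (E ! i) (E ! j) = (if i = j then 1 else 0)"
proof -
  have "i \<in> {0, 1, 2, 3}" "j \<in> {0, 1, 2, 3}"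
    using assms(5,6) by auto
  then show ?thesis
    using frame_orthonormal[OF assms(1)] assms(2,3)
    by (auto simp: E_def invariant_metric_def norm_eq_1 power2_eq_square inner_commute
        numeral_2_eq_2 numeral_3_eq_3 field_simps)
qed

definition koiso_cao_ode :: "real \<Rightarrow> (real \<Rightarrow> real) \<Rightarrow> real set \<Rightarrow> bool" where
  "koiso_cao_ode c h I \<longleftrightarrow> (\<forall>t\<in>I.
     h differentiable (at t) \<and> deriv h differentiable (at t) \<and>
     2 * h t * deriv (deriv h) t + 4 * (deriv h t)\<^sup>2 - 4
       + (h t)\<^sup>2 * (1 + c * (deriv h t)\<^sup>2) = 0)"

definition koiso_cao_profile :: "real \<Rightarrow> real \<Rightarrow> (real \<Rightarrow> real) \<Rightarrow> bool" where
  "koiso_cao_profile c \<beta> h \<longleftrightarrow>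
     0 < \<beta> \<and>
     (\<exists>a b. a < 0 \<and> \<beta> < b \<and> koiso_cao_ode c h {a<..<b}) \<and>
     h 0 = sqrt 6 \<and> deriv h 0 = 0 \<and>
     (\<forall>t\<in>{0..\<beta>}. 0 < h t) \<and> (\<forall>t\<in>{0<..<\<beta>}. deriv h t < 0) \<and>
     deriv h \<beta> = 0 \<and> h \<beta> = sqrt 2"

text \<open>
  A metric on \<open>M\<close> is given by its expressions \<open>G \<kappa>\<close> in the four charts.  The last condition says
  that on the open dense subset \<open>S\<^sup>3 \<times> (0,\<beta>)\<close>, which is \<open>v \<noteq> 0\<close> in each chart, the metric is the
  one above; with smoothness this determines every \<open>G \<kappa>\<close> on \<open>chart_dom \<beta>\<close> and gives the
  compatibility of the \<open>G \<kappa>\<close> with each other.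
\<close>

definition koiso_cao_soliton ::
  "real \<Rightarrow> real \<Rightarrow> (real \<Rightarrow> real) \<Rightarrow> (chart_index \<Rightarrow> complex2 \<Rightarrow> complex2 \<Rightarrow> complex2 \<Rightarrow> real) \<Rightarrow> bool"
where
  "koiso_cao_soliton c \<beta> h G \<longleftrightarrow>
     koiso_cao_profile c \<beta> h \<and>
     (\<forall>\<kappa>. riemannian_metric_on (chart_dom \<beta>) (G \<kappa>) \<and>
        (\<forall>x\<in>chart_dom \<beta>. fst x \<noteq> 0 \<longrightarrow> (\<forall>a b.
           G \<kappa> x a b = invariant_metric (\<lambda>t. - h t * deriv h t) h (chart_lift \<beta> \<kappa> x)
             (frechet_derivative (chart_lift \<beta> \<kappa>) (at x) a)
             (frechet_derivative (chart_lift \<beta> \<kappa>) (at x) b))))"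

text \<open>The scalar curvature at a point of \<open>M\<close>, computed in any chart around that point.\<close>

definition M_scalar_curvature ::
  "real \<Rightarrow> (chart_index \<Rightarrow> complex2 \<Rightarrow> complex2 \<Rightarrow> complex2 \<Rightarrow> real) \<Rightarrow> (complex2 \<times> real) set \<Rightarrow> real"
where
  "M_scalar_curvature \<beta> G m =
     (let (\<kappa>, x) = (SOME (\<kappa>, x). x \<in> chart_dom \<beta> \<and> inv_chart \<beta> \<kappa> x = m)
      in scalar_curvature (G \<kappa>) x)"

end

theory Submission
  imports Defs
begin

text \<open>
  Let \<open>v\<close>, \<open>w\<close> be the coordinates of a chart, \<open>r = \<bar>v\<bar>\<close> and \<open>\<theta>\<close> the phase of \<open>v\<close>.  Away from
  \<open>v = 0\<close> the soliton reads
  \<open>dr\<^sup>2 + F(r)\<^sup>2 \<eta>\<^sup>2 + H(r)\<^sup>2 \<bar>dw\<bar>\<^sup>2 / (1 + \<bar>w\<bar>\<^sup>2)\<^sup>2\<close> with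
  \<open>\<eta> = d\<theta> + Im (cnj w dw) / (1 + \<bar>w\<bar>\<^sup>2)\<close>, in all four charts (\<open>invariant_metric_chart\<close>): the
  two affine coordinates on the base give the same expression, and at the upper end \<open>F\<close> and \<open>H\<close>
  are the profiles \<open>f = - h h'\<close> and \<open>h\<close> run backwards in \<open>t\<close>.

  The scalar curvature of any metric is a universal expression in the structure coefficients of an
  orthonormal frame and their first derivatives (\<open>scalar_curvature_frame\<close>).  For the metric above there is a frame whose
  brackets are elementary, and the result is
  \<open>- 2 F''/F - 4 H''/H - 2 H'\<^sup>2/H\<^sup>2 - 4 F'H'/(FH) + 8/H\<^sup>2 - 2 F\<^sup>2/H\<^sup>4\<close>
  (\<open>scalar_curvature_bundle_metric\<close>).  With \<open>F = - h h'\<close>, the differential equation eliminates the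
  second and third derivatives of \<open>h\<close> and leaves \<open>S = 4 + 4c - c h\<^sup>2 (1 + c h'\<^sup>2)\<close>
  (\<open>scalar_profile_geometric\<close>).  On the singular orbits \<open>v = 0\<close>, where that frame breaks down,
  the same value results from the continuity of the scalar curvature; this follows from the frame
  formula again, now for a frame that Gram-Schmidt orthogonalisation provides on the whole chart
  (\<open>scalar_curvature_continuous\<close>).

  It remains to see that \<open>S\<close> decreases.  Regard \<open>p = h'\<^sup>2\<close> as a function of \<open>x = h\<^sup>2\<close>, which falls
  from 6 to 2.  The differential equation becomes linear in \<open>p\<close>, namely
  \<open>d/dx (x\<^sup>2 e\<^bsup>cx/2\<^esup> p) = e\<^bsup>cx/2\<^esup> (2x - x\<^sup>2/2)\<close>.  As \<open>p\<close> vanishes at both ends, the right-hand side has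
  integral 0 over \<open>[2,6]\<close>, and comparing the weight \<open>e\<^bsup>cx/2\<^esup>\<close> with a constant and with a multiple of
  \<open>e\<^bsup>-x/2\<^esup>\<close>, for which the integral is explicit, yields \<open>-1 < c < 0\<close> (\<open>c_neg\<close>, \<open>c_gt\<close>).  Put
  \<open>y = x (1 + c p)\<close> and \<open>Q = dy/dx\<close>, so that \<open>S = 4 + 4c - c y\<close> and \<open>S\<close> increases with \<open>x\<close> where
  \<open>Q > 0\<close>.  The bounds on \<open>c\<close> make \<open>Q\<close> positive for \<open>x = 2\<close> and \<open>x = 6\<close>, and \<open>dQ/dx = y/x\<^sup>2\<close> holds at
  every zero of \<open>Q\<close>.  At the first zero above \<open>x = 2\<close> this is positive, because \<open>y\<close> has increased from
  the value 2 up to there, so \<open>Q\<close> cannot come down to 0 (\<open>slope_factor_pos\<close>).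
\<close>

section \<open>Calculus of continuously differentiable maps\<close>

lemma times_cont_diff_on_cong:
  assumes "open U" "\<And>x. x \<in> U \<Longrightarrow> \<phi> x = \<psi> x" "times_cont_diff_on k U \<phi>"
  shows "times_cont_diff_on k U \<psi>"
  using assms(2,3)
proof (induction k arbitrary: \<phi> \<psi>)
  case 0
  then show ?case
    by (simp cong: continuous_on_cong)
next
  case (Suc k)
  have diff: "\<phi> differentiable (at x)" if "x \<in> U" for x
    using Suc.prems(2) that by simp
  have eq: "frechet_derivative \<phi> (at x) = frechet_derivative \<psi> (at x)" if "x \<in> U" for x
    using diff[OF that] assms(1) that Suc.prems(1) by (rule frechet_derivative_transform_within_open)
  have "\<psi> differentiable (at x)" if "x \<in> U" for x
  proof -
    obtain D where "(\<phi> has_derivative D) (at x)"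
      using diff[OF \<open>x \<in> U\<close>] by (auto simp: differentiable_def)
    then have "(\<psi> has_derivative D) (at x)"
      using assms(1) \<open>x \<in> U\<close> Suc.prems(1) by (rule has_derivative_transform_within_open)
    then show ?thesis
      by (rule differentiableI)
  qed
  moreover have "times_cont_diff_on k U (\<lambda>x. frechet_derivative \<psi> (at x) v)" for v
  proof (rule Suc.IH)
    show "frechet_derivative \<phi> (at x) v = frechet_derivative \<psi> (at x) v" if "x \<in> U" for x
      by (simp only: eq[OF that])
    show "times_cont_diff_on k U (\<lambda>x. frechet_derivative \<phi> (at x) v)"
      using Suc.prems(2) unfolding times_cont_diff_on.simps by blast
  qed
  ultimately show ?case
    unfolding times_cont_diff_on.simps by blast
qed

lemma times_cont_diff_on_SucI:
  assumes "open U" "\<And>x. x \<in> U \<Longrightarrow> (\<phi> has_derivative \<phi>' x) (at x)"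
    "\<And>v. times_cont_diff_on k U (\<lambda>x. \<phi>' x v)"
  shows "times_cont_diff_on (Suc k) U \<phi>"
proof -
  have "times_cont_diff_on k U (\<lambda>x. frechet_derivative \<phi> (at x) v)" for v
    by (rule times_cont_diff_on_cong[OF assms(1) _ assms(3)[of v]])
      (use frechet_derivative_at[OF assms(2)] in simp)
  then show ?thesis
    using assms(2) by (auto simp: differentiable_def)
qed

lemma times_cont_diff_on_Suc_derivative:
  assumes "times_cont_diff_on (Suc k) U \<phi>" "x \<in> U"
  shows "(\<phi> has_derivative frechet_derivative \<phi> (at x)) (at x)"
  using assms frechet_derivative_works by auto

lemma times_cont_diff_on_Suc_directional:
  "times_cont_diff_on (Suc k) U \<phi> \<Longrightarrow>
    times_cont_diff_on k U (\<lambda>x. frechet_derivative \<phi> (at x) v)"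
  by simp

lemma times_cont_diff_on_SucD:
  "times_cont_diff_on (Suc k) U \<phi> \<Longrightarrow> times_cont_diff_on k U \<phi>"
proof (induction k arbitrary: \<phi>)
  case 0
  then show ?case
    by (auto simp: differentiable_imp_continuous_within continuous_at_imp_continuous_on)
qed auto

lemma times_cont_diff_on_subset:
  "times_cont_diff_on k U \<phi> \<Longrightarrow> V \<subseteq> U \<Longrightarrow> times_cont_diff_on k V \<phi>"
  by (induction k arbitrary: \<phi>) (auto intro: continuous_on_subset)

lemma times_cont_diff_on_const: "times_cont_diff_on k U (\<lambda>x. a)"
  by (induction k arbitrary: a) auto

lemma times_cont_diff_on_bounded_linear:
  assumes "bounded_linear L" "open U"
  shows "times_cont_diff_on k U L"
proof (cases k)
  case 0
  then show ?thesis
    using assms by (simp add: linear_continuous_on)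
next
  case (Suc j)
  then show ?thesis
    using times_cont_diff_on_SucI[OF assms(2) bounded_linear_imp_has_derivative[OF assms(1)]
        times_cont_diff_on_const] by simp
qed

lemma times_cont_diff_on_linear_compose:
  assumes "bounded_linear L" "open U" "times_cont_diff_on k U \<phi>"
  shows "times_cont_diff_on k U (\<lambda>x. L (\<phi> x))"
  using assms(3)
proof (induction k arbitrary: \<phi>)
  case 0
  then show ?case
    using assms(1) by (auto intro: bounded_linear.continuous_on)
next
  case (Suc k)
  show ?case
    by (rule times_cont_diff_on_SucI[OF assms(2) bounded_linear.has_derivative[OF assms(1)
            times_cont_diff_on_Suc_derivative[OF Suc.prems]]])
      (auto intro: Suc.IH[OF times_cont_diff_on_Suc_directional[OF Suc.prems]])
qed

lemma times_cont_diff_on_add: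
  assumes "open U"
  shows "times_cont_diff_on k U \<phi> \<Longrightarrow> times_cont_diff_on k U \<psi> \<Longrightarrow>
    times_cont_diff_on k U (\<lambda>x. \<phi> x + \<psi> x)"
proof (induction k arbitrary: \<phi> \<psi>)
  case 0
  then show ?case
    by (auto intro: continuous_intros)
next
  case (Suc k)
  show ?case
    by (rule times_cont_diff_on_SucI[OF assms has_derivative_add[OF
            times_cont_diff_on_Suc_derivative[OF Suc.prems(1)]
            times_cont_diff_on_Suc_derivative[OF Suc.prems(2)]]])
      (auto intro: Suc.IH times_cont_diff_on_Suc_directional[OF Suc.prems(1)]
        times_cont_diff_on_Suc_directional[OF Suc.prems(2)])
qed

lemma times_cont_diff_on_minus:
  "open U \<Longrightarrow> times_cont_diff_on k U \<phi> \<Longrightarrow> times_cont_diff_on k U (\<lambda>x. - \<phi> x)"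
  by (rule times_cont_diff_on_linear_compose[OF bounded_linear_minus[OF bounded_linear_ident]])

lemma times_cont_diff_on_diff:
  "open U \<Longrightarrow> times_cont_diff_on k U \<phi> \<Longrightarrow> times_cont_diff_on k U \<psi> \<Longrightarrow>
    times_cont_diff_on k U (\<lambda>x. \<phi> x - \<psi> x)"
  using times_cont_diff_on_add[of U k \<phi> "\<lambda>x. - \<psi> x"] times_cont_diff_on_minus[of U k \<psi>] by simp

lemma times_cont_diff_on_sum:
  assumes "open U" "\<And>i. i \<in> I \<Longrightarrow> times_cont_diff_on k U (\<phi> i)"
  shows "times_cont_diff_on k U (\<lambda>x. \<Sum>i\<in>I. \<phi> i x)"
  using assms(2)
  by (induction I rule: infinite_finite_induct)
    (auto intro: times_cont_diff_on_const times_cont_diff_on_add[OF assms(1)])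

lemma times_cont_diff_on_scaleR:
  assumes "open U"
  shows "times_cont_diff_on k U r \<Longrightarrow> times_cont_diff_on k U \<phi> \<Longrightarrow>
    times_cont_diff_on k U (\<lambda>x. r x *\<^sub>R \<phi> x)"
proof (induction k arbitrary: r \<phi>)
  case 0
  then show ?case
    by (auto intro: continuous_intros)
next
  case (Suc k)
  show ?case
    by (rule times_cont_diff_on_SucI[OF assms has_derivative_scaleR[OF
            times_cont_diff_on_Suc_derivative[OF Suc.prems(1)]
            times_cont_diff_on_Suc_derivative[OF Suc.prems(2)]]])
      (auto intro!: times_cont_diff_on_add[OF assms] Suc.IH
        times_cont_diff_on_Suc_directional[OF Suc.prems(1)] times_cont_diff_on_SucD[OF Suc.prems(1)]
        times_cont_diff_on_Suc_directional[OF Suc.prems(2)] times_cont_diff_on_SucD[OF Suc.prems(2)])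
qed

lemma times_cont_diff_on_mult:
  fixes \<phi> \<psi> :: "'a::real_normed_vector \<Rightarrow> real"
  shows "open U \<Longrightarrow> times_cont_diff_on k U \<phi> \<Longrightarrow> times_cont_diff_on k U \<psi> \<Longrightarrow>
    times_cont_diff_on k U (\<lambda>x. \<phi> x * \<psi> x)"
  using times_cont_diff_on_scaleR[of U k \<phi> \<psi>] by simp

lemma times_cont_diff_on_compose_real:
  fixes F :: "real \<Rightarrow> real" and \<phi> :: "'a::real_normed_vector \<Rightarrow> real"
  assumes "open U" "\<And>x. x \<in> U \<Longrightarrow> \<phi> x \<in> J"
  shows "times_cont_diff_on k J F \<Longrightarrow> times_cont_diff_on k U \<phi> \<Longrightarrow>
    times_cont_diff_on k U (\<lambda>x. F (\<phi> x))"
proof (induction k arbitrary: F)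
  case 0
  then show ?case
    using assms(2) by (auto intro: continuous_on_compose2)
next
  case (Suc k)
  let ?F' = "\<lambda>s. frechet_derivative F (at s) 1"
  have lin: "frechet_derivative F (at s) a = a * ?F' s" if "s \<in> J" for s a
    using linear_scale[OF has_derivative_linear[OF
          times_cont_diff_on_Suc_derivative[OF Suc.prems(1) that]], of a 1] by simp
  have der: "((\<lambda>x. F (\<phi> x)) has_derivative (\<lambda>v. frechet_derivative \<phi> (at x) v * ?F' (\<phi> x))) (at x)"
    if "x \<in> U" for x
    using has_derivative_compose[OF times_cont_diff_on_Suc_derivative[OF Suc.prems(2) that]
        times_cont_diff_on_Suc_derivative[OF Suc.prems(1) assms(2)[OF that]]]
    unfolding lin[OF assms(2)[OF that], of "frechet_derivative \<phi> (at x) _"] .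
  have "times_cont_diff_on k U (\<lambda>x. ?F' (\<phi> x))"
    by (rule Suc.IH[OF times_cont_diff_on_Suc_directional[OF Suc.prems(1)]
          times_cont_diff_on_SucD[OF Suc.prems(2)]])
  then have cont: "times_cont_diff_on k U (\<lambda>x. frechet_derivative \<phi> (at x) v * ?F' (\<phi> x))" for v
    by (rule times_cont_diff_on_mult[OF assms(1)
        times_cont_diff_on_Suc_directional[OF Suc.prems(2)]])
  show ?case
    by (rule times_cont_diff_on_SucI[OF assms(1) der cont])
qed

text \<open>
  For functions of one real variable the directional derivatives of the recursive definition are
  multiples of the ordinary derivative, so this rule allows differentiation with explicit formulas.
\<close>

lemma times_cont_diff_on_real_SucI:
  fixes F :: "real \<Rightarrow> real"
  assumes "open J" "\<And>s. s \<in> J \<Longrightarrow> (F has_real_derivative F' s) (at s)"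
    "times_cont_diff_on k J F'"
  shows "times_cont_diff_on (Suc k) J F"
  by (rule times_cont_diff_on_SucI[OF assms(1) assms(2)[unfolded has_field_derivative_def]])
    (auto intro: times_cont_diff_on_mult[OF assms(1,3)] times_cont_diff_on_const)

lemma times_cont_diff_on_inverse_ident: "times_cont_diff_on k {0<..} (inverse :: real \<Rightarrow> real)"
proof (induction k)
  case 0
  then show ?case
    by (auto intro!: continuous_intros)
next
  case (Suc k)
  have "times_cont_diff_on k {0<..} (\<lambda>s::real. - (inverse s * inverse s))"
    by (intro times_cont_diff_on_minus times_cont_diff_on_mult Suc.IH open_greaterThan)
  then show ?case
    by (intro times_cont_diff_on_real_SucI[where F' = "\<lambda>s. - (inverse s * inverse s)"])
      (auto intro!: derivative_eq_intros simp: power2_eq_square)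
qed

lemma times_cont_diff_on_inverse:
  assumes "open U" "\<And>x. x \<in> U \<Longrightarrow> 0 < \<phi> x" "times_cont_diff_on k U \<phi>"
  shows "times_cont_diff_on k U (\<lambda>x. inverse (\<phi> x :: real))"
  by (rule times_cont_diff_on_compose_real[OF assms(1) _ times_cont_diff_on_inverse_ident assms(3)])
    (simp add: assms(2))

lemma times_cont_diff_on_sqrt_ident: "times_cont_diff_on k {0<..} sqrt"
proof (induction k)
  case 0
  then show ?case
    by (auto intro!: continuous_intros)
next
  case (Suc k)
  have "times_cont_diff_on k {0<..} (\<lambda>s::real. (1 / 2) * inverse (sqrt s))"
    by (intro times_cont_diff_on_mult times_cont_diff_on_inverse times_cont_diff_on_const Suc.IH
        open_greaterThan) simp
  then show ?case
    by (intro times_cont_diff_on_real_SucI[where F' = "\<lambda>s. (1 / 2) * inverse (sqrt s)"])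
      (auto intro!: derivative_eq_intros simp: field_simps)
qed

lemma times_cont_diff_on_sqrt:
  assumes "open U" "\<And>x. x \<in> U \<Longrightarrow> 0 < \<phi> x" "times_cont_diff_on k U \<phi>"
  shows "times_cont_diff_on k U (\<lambda>x. sqrt (\<phi> x))"
  by (rule times_cont_diff_on_compose_real[OF assms(1) _ times_cont_diff_on_sqrt_ident assms(3)])
    (simp add: assms(2))

text \<open>
  Tensors occur below as maps \<open>L x v\<close> that are linear in \<open>v\<close>.  Expanding \<open>v\<close> in the standard basis
  reduces regularity in \<open>x\<close>, also when \<open>v\<close> depends on \<open>x\<close>, to that of the finitely many components.
\<close>

lemma linear_family_expand:
  fixes L :: "'a::euclidean_space \<Rightarrow> 'b::real_vector"
  assumes "linear L"
  shows "L v = (\<Sum>b\<in>Basis. (v \<bullet> b) *\<^sub>R L b)"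
proof -
  have "L v = L (\<Sum>b\<in>Basis. (v \<bullet> b) *\<^sub>R b)"
    by (simp add: euclidean_representation)
  also have "\<dots> = (\<Sum>b\<in>Basis. (v \<bullet> b) *\<^sub>R L b)"
    using assms by (simp add: linear_sum linear_scale)
  finally show ?thesis .
qed

lemma times_cont_diff_on_linear_family:
  fixes L :: "'c::real_normed_vector \<Rightarrow> 'a::euclidean_space \<Rightarrow> 'b::real_normed_vector"
  assumes "open U" "\<And>x. x \<in> U \<Longrightarrow> linear (L x)" "\<And>v. times_cont_diff_on k U (\<lambda>x. L x v)"
    "times_cont_diff_on k U V"
  shows "times_cont_diff_on k U (\<lambda>x. L x (V x))"
proof (rule times_cont_diff_on_cong[OF assms(1)])
  show "times_cont_diff_on k U (\<lambda>x. \<Sum>b\<in>Basis. (V x \<bullet> b) *\<^sub>R L x b)"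
    using assms
    by (intro times_cont_diff_on_sum times_cont_diff_on_scaleR
        times_cont_diff_on_linear_compose[of "\<lambda>x. x \<bullet> _"] bounded_linear_inner_left) auto
qed (use linear_family_expand[OF assms(2)] in simp)

text \<open>
  The product rule for a tensor evaluated on a vector field.
\<close>

lemma has_derivative_linear_family:
  fixes L :: "'c::real_normed_vector \<Rightarrow> 'a::euclidean_space \<Rightarrow> 'b::real_normed_vector"
  assumes "open U" "x \<in> U" "\<And>y. y \<in> U \<Longrightarrow> linear (L y)"
    "\<And>v. (\<lambda>y. L y v) differentiable (at x)" "V differentiable (at x)"
  shows "((\<lambda>y. L y (V y)) has_derivative
    (\<lambda>u. frechet_derivative (\<lambda>y. L y (V x)) (at x) u + L x (frechet_derivative V (at x) u))) (at x)"
proof -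
  have L: "((\<lambda>y. L y v) has_derivative frechet_derivative (\<lambda>y. L y v) (at x)) (at x)" for v
    using assms(4) frechet_derivative_works by blast
  have V: "(V has_derivative frechet_derivative V (at x)) (at x)"
    using assms(5) frechet_derivative_works by blast
  have expand: "L y v = (\<Sum>b\<in>Basis. (v \<bullet> b) *\<^sub>R L y b)" if "y \<in> U" for y v
    using linear_family_expand[OF assms(3)[OF that]] .
  have "((\<lambda>y. \<Sum>b\<in>Basis. (V y \<bullet> b) *\<^sub>R L y b) has_derivative
      (\<lambda>u. \<Sum>b\<in>Basis. (V x \<bullet> b) *\<^sub>R frechet_derivative (\<lambda>y. L y b) (at x) u
        + (frechet_derivative V (at x) u \<bullet> b) *\<^sub>R L x b)) (at x)"
    by (intro has_derivative_sum has_derivative_scaleR has_derivative_inner_left L V)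
  moreover have "((\<lambda>y. \<Sum>b\<in>Basis. (V x \<bullet> b) *\<^sub>R L y b) has_derivative
      (\<lambda>u. \<Sum>b\<in>Basis. (V x \<bullet> b) *\<^sub>R frechet_derivative (\<lambda>y. L y b) (at x) u)) (at x)"
    by (intro has_derivative_sum has_derivative_scaleR_right L)
  then have "((\<lambda>y. L y (V x)) has_derivative
      (\<lambda>u. \<Sum>b\<in>Basis. (V x \<bullet> b) *\<^sub>R frechet_derivative (\<lambda>y. L y b) (at x) u)) (at x)"
    by (rule has_derivative_transform_within_open[OF _ assms(1,2)]) (rule expand[symmetric])
  then have "frechet_derivative (\<lambda>y. L y (V x)) (at x) =
      (\<lambda>u. \<Sum>b\<in>Basis. (V x \<bullet> b) *\<^sub>R frechet_derivative (\<lambda>y. L y b) (at x) u)"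
    by (rule frechet_derivative_at[symmetric])
  ultimately have "((\<lambda>y. \<Sum>b\<in>Basis. (V y \<bullet> b) *\<^sub>R L y b) has_derivative
      (\<lambda>u. frechet_derivative (\<lambda>y. L y (V x)) (at x) u + L x (frechet_derivative V (at x) u))) (at x)"
    by (simp only: sum.distrib expand[OF assms(2), of "frechet_derivative V (at x) _"])
  then show ?thesis
    by (rule has_derivative_transform_within_open[OF _ assms(1,2)]) (rule expand[symmetric])
qed

text \<open>
  The mean value theorem, applied first in direction \<open>a\<close> and then in direction \<open>b\<close>.  The second
  difference is symmetric in \<open>a\<close> and \<open>b\<close>, which is what makes the mixed derivatives agree.
\<close>

lemma second_difference_mean_value:
  fixes \<phi> :: "'a::real_normed_vector \<Rightarrow> real"
  assumes "times_cont_diff_on 2 U \<phi>" "0 < s"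
    "\<And>p q. \<lbrakk>0 \<le> p; p \<le> s; 0 \<le> q; q \<le> s\<rbrakk> \<Longrightarrow> x + p *\<^sub>R a + q *\<^sub>R b \<in> U"
  obtains p q where "0 \<le> p" "p \<le> s" "0 \<le> q" "q \<le> s"
    "\<phi> (x + s *\<^sub>R a + s *\<^sub>R b) - \<phi> (x + s *\<^sub>R a) - \<phi> (x + s *\<^sub>R b) + \<phi> x =
     s * s * frechet_derivative (\<lambda>y. frechet_derivative \<phi> (at y) a) (at (x + p *\<^sub>R a + q *\<^sub>R b)) b"
proof -
  let ?D = "\<lambda>y. frechet_derivative \<phi> (at y) a"
  have C1: "times_cont_diff_on (Suc 1) U \<phi>" and C0: "times_cont_diff_on (Suc 0) U ?D"
    using assms(1) by (auto simp: numeral_2_eq_2)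
  have line: "((\<lambda>p. \<phi> (x + p *\<^sub>R a + q *\<^sub>R b)) has_real_derivative ?D (x + p *\<^sub>R a + q *\<^sub>R b)) (at p)"
    if "0 \<le> p" "p \<le> s" "0 \<le> q" "q \<le> s" for p q
  proof -
    note d = times_cont_diff_on_Suc_derivative[OF C1 assms(3)[OF that]]
    have "((\<lambda>p. x + p *\<^sub>R a + q *\<^sub>R b) has_derivative (\<lambda>r. r *\<^sub>R a)) (at p)"
      by (auto intro!: derivative_eq_intros)
    note has_derivative_compose[OF this d]
    moreover have "(\<lambda>r. frechet_derivative \<phi> (at (x + p *\<^sub>R a + q *\<^sub>R b)) (r *\<^sub>R a)) =
        (*) (?D (x + p *\<^sub>R a + q *\<^sub>R b))"
      using linear_scale[OF has_derivative_linear[OF d], of _ a] by (simp add: fun_eq_iff)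
    ultimately show ?thesis
      by (simp add: has_field_derivative_def)
  qed
  have "((\<lambda>p. \<phi> (x + p *\<^sub>R a + s *\<^sub>R b) - \<phi> (x + p *\<^sub>R a)) has_real_derivative
      ?D (x + p *\<^sub>R a + s *\<^sub>R b) - ?D (x + p *\<^sub>R a)) (at p)" if "0 \<le> p" "p \<le> s" for p
    using DERIV_diff[OF line[of p s] line[of p 0]] that assms(2) by simp
  from MVT2[OF assms(2) this] obtain p where p: "0 < p" "p < s"
    "\<phi> (x + s *\<^sub>R a + s *\<^sub>R b) - \<phi> (x + s *\<^sub>R a) - (\<phi> (x + s *\<^sub>R b) - \<phi> x) =
      s * (?D (x + p *\<^sub>R a + s *\<^sub>R b) - ?D (x + p *\<^sub>R a))"
    by auto
  have "((\<lambda>q. ?D (x + p *\<^sub>R a + q *\<^sub>R b)) has_real_derivative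
      frechet_derivative ?D (at (x + p *\<^sub>R a + q *\<^sub>R b)) b) (at q)" if "0 \<le> q" "q \<le> s" for q
  proof -
    have "x + p *\<^sub>R a + q *\<^sub>R b \<in> U"
      using p that by (intro assms(3)) auto
    note d = times_cont_diff_on_Suc_derivative[OF C0 this]
    have "((\<lambda>q. x + p *\<^sub>R a + q *\<^sub>R b) has_derivative (\<lambda>r. r *\<^sub>R b)) (at q)"
      by (auto intro!: derivative_eq_intros)
    note has_derivative_compose[OF this d]
    moreover have "(\<lambda>r. frechet_derivative ?D (at (x + p *\<^sub>R a + q *\<^sub>R b)) (r *\<^sub>R b)) =
        (*) (frechet_derivative ?D (at (x + p *\<^sub>R a + q *\<^sub>R b)) b)"
      using linear_scale[OF has_derivative_linear[OF d], of _ b] by (simp add: fun_eq_iff)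
    ultimately show ?thesis
      by (simp add: has_field_derivative_def)
  qed
  from MVT2[OF assms(2) this] obtain q where "0 < q" "q < s"
    "?D (x + p *\<^sub>R a + s *\<^sub>R b) - ?D (x + p *\<^sub>R a) =
      s * frechet_derivative ?D (at (x + p *\<^sub>R a + q *\<^sub>R b)) b"
    by auto
  with p show ?thesis
    by (intro that[of p q]) (auto simp: algebra_simps)
qed

lemma second_derivative_symmetric_real:
  fixes \<phi> :: "'a::real_normed_vector \<Rightarrow> real"
  assumes "open U" "x \<in> U" "times_cont_diff_on 2 U \<phi>"
  shows "frechet_derivative (\<lambda>y. frechet_derivative \<phi> (at y) a) (at x) b =
    frechet_derivative (\<lambda>y. frechet_derivative \<phi> (at y) b) (at x) a"
proof (rule ccontr)
  define A where "A = (\<lambda>y. frechet_derivative (\<lambda>y. frechet_derivative \<phi> (at y) a) (at y) b)"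
  define B where "B = (\<lambda>y. frechet_derivative (\<lambda>y. frechet_derivative \<phi> (at y) b) (at y) a)"
  assume "\<not> ?thesis"
  then have e: "\<bar>A x - B x\<bar> / 2 > 0" (is "?e > 0")
    by (simp add: A_def B_def)
  have "continuous_on U A" "continuous_on U B"
    using assms(3) by (auto simp: A_def B_def numeral_2_eq_2)
  then have "isCont A x" "isCont B x"
    using assms by (auto simp: continuous_on_eq_continuous_at)
  then have "\<forall>\<^sub>F y in nhds x. dist (A y) (A x) < ?e" "\<forall>\<^sub>F y in nhds x. dist (B y) (B x) < ?e"
    using tendstoD[OF _ e] unfolding isCont_def tendsto_at_iff_tendsto_nhds by blast+
  moreover have "\<forall>\<^sub>F y in nhds x. y \<in> U"
    using assms(1,2) by (rule eventually_nhds_in_open)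
  ultimately have "\<forall>\<^sub>F y in nhds x. dist (A y) (A x) < ?e \<and> dist (B y) (B x) < ?e \<and> y \<in> U"
    by eventually_elim auto
  then obtain d where d: "d > 0"
    "\<And>y. dist y x < d \<Longrightarrow> dist (A y) (A x) < ?e \<and> dist (B y) (B x) < ?e \<and> y \<in> U"
    unfolding eventually_nhds_metric by blast
  define s where "s = d / (norm a + norm b + 1)"
  have s: "s > 0" "s * (norm a + norm b) < d"
    using d(1) by (auto simp: s_def field_simps add_pos_nonneg add_nonneg_pos)
  have near: "dist (x + p *\<^sub>R a + q *\<^sub>R b) x < d" if "0 \<le> p" "p \<le> s" "0 \<le> q" "q \<le> s" for p q
  proof -
    have "norm (p *\<^sub>R a + q *\<^sub>R b) \<le> p * norm a + q * norm b"
      using norm_triangle_ineq[of "p *\<^sub>R a" "q *\<^sub>R b"] that by simp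
    also have "\<dots> \<le> s * norm a + s * norm b"
      using that by (intro add_mono mult_right_mono) auto
    also have "\<dots> < d"
      using s by (simp add: algebra_simps)
    finally show ?thesis
      by (simp add: dist_norm add.assoc)
  qed
  have inU: "x + p *\<^sub>R a + q *\<^sub>R b \<in> U" if "0 \<le> p" "p \<le> s" "0 \<le> q" "q \<le> s" for p q
    using d(2) near[OF that] by blast
  have inU': "x + p *\<^sub>R b + q *\<^sub>R a \<in> U" if "0 \<le> p" "p \<le> s" "0 \<le> q" "q \<le> s" for p q
    using inU[of q p] that by (simp add: add.commute add.left_commute)
  let ?\<Delta> = "\<phi> (x + s *\<^sub>R a + s *\<^sub>R b) - \<phi> (x + s *\<^sub>R a) - \<phi> (x + s *\<^sub>R b) + \<phi> x"
  obtain p q where pq: "0 \<le> p" "p \<le> s" "0 \<le> q" "q \<le> s" "?\<Delta> = s * s * A (x + p *\<^sub>R a + q *\<^sub>R b)"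
    unfolding A_def
    by (rule second_difference_mean_value[OF assms(3) s(1) inU]) auto
  obtain p' q' where pq': "0 \<le> p'" "p' \<le> s" "0 \<le> q'" "q' \<le> s"
    "\<phi> (x + s *\<^sub>R b + s *\<^sub>R a) - \<phi> (x + s *\<^sub>R b) - \<phi> (x + s *\<^sub>R a) + \<phi> x
      = s * s * B (x + p' *\<^sub>R b + q' *\<^sub>R a)"
    unfolding B_def
    by (rule second_difference_mean_value[OF assms(3) s(1) inU']) auto
  \<comment> \<open>The two mixed derivatives take the same value at two points close to \<open>x\<close>.\<close>
  have "?\<Delta> = s * s * B (x + q' *\<^sub>R a + p' *\<^sub>R b)"
    using pq'(5) by (simp add: add.commute add.left_commute add.assoc)
  then have "A (x + p *\<^sub>R a + q *\<^sub>R b) = B (x + q' *\<^sub>R a + p' *\<^sub>R b)"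
    using pq(5) s(1) by simp
  moreover have "dist (A (x + p *\<^sub>R a + q *\<^sub>R b)) (A x) < ?e"
    "dist (B (x + q' *\<^sub>R a + p' *\<^sub>R b)) (B x) < ?e"
    using d(2) near pq pq' by blast+
  ultimately show False
    by (simp add: dist_real_def) (smt (verit) field_sum_of_halves)
qed

lemma second_derivative_symmetric:
  fixes \<phi> :: "'a::real_normed_vector \<Rightarrow> 'b::euclidean_space"
  assumes "open U" "x \<in> U" "times_cont_diff_on 2 U \<phi>"
  shows "frechet_derivative (\<lambda>y. frechet_derivative \<phi> (at y) a) (at x) b =
    frechet_derivative (\<lambda>y. frechet_derivative \<phi> (at y) b) (at x) a"
proof (rule euclidean_eqI)
  fix e :: 'b
  have C1: "times_cont_diff_on (Suc 1) U \<phi>"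
    using assms(3) by (simp add: numeral_2_eq_2)
  have component: "frechet_derivative (\<lambda>y. frechet_derivative \<phi> (at y) u) (at x) v \<bullet> e =
      frechet_derivative (\<lambda>y. frechet_derivative (\<lambda>y. \<phi> y \<bullet> e) (at y) u) (at x) v" for u v
  proof -
    have "frechet_derivative (\<lambda>y. \<phi> y \<bullet> e) (at y) u = frechet_derivative \<phi> (at y) u \<bullet> e" if "y \<in> U" for y
      using frechet_derivative_at[OF has_derivative_inner_left[OF
            times_cont_diff_on_Suc_derivative[OF C1 that], of e]] by metis
    moreover have "times_cont_diff_on (Suc 0) U (\<lambda>y. frechet_derivative \<phi> (at y) u)"
      using C1 by simp
    from has_derivative_inner_left[OF times_cont_diff_on_Suc_derivative[OF this assms(2)], of e]
    have "((\<lambda>y. frechet_derivative \<phi> (at y) u \<bullet> e) has_derivative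
        (\<lambda>v. frechet_derivative (\<lambda>y. frechet_derivative \<phi> (at y) u) (at x) v \<bullet> e)) (at x)" .
    ultimately have "((\<lambda>y. frechet_derivative (\<lambda>y. \<phi> y \<bullet> e) (at y) u) has_derivative
        (\<lambda>v. frechet_derivative (\<lambda>y. frechet_derivative \<phi> (at y) u) (at x) v \<bullet> e)) (at x)"
      by (elim has_derivative_transform_within_open[OF _ assms(1,2)]) simp
    then show ?thesis
      using frechet_derivative_at by metis
  qed
  have "times_cont_diff_on 2 U (\<lambda>y. \<phi> y \<bullet> e)"
    by (rule times_cont_diff_on_linear_compose[OF bounded_linear_inner_left assms(1,3)])
  from second_derivative_symmetric_real[OF assms(1,2) this, of a b]
  show "frechet_derivative (\<lambda>y. frechet_derivative \<phi> (at y) a) (at x) b \<bullet> e =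
    frechet_derivative (\<lambda>y. frechet_derivative \<phi> (at y) b) (at x) a \<bullet> e"
    by (simp add: component)
qed

section \<open>Scalar curvature in an orthonormal frame\<close>

abbreviation dd :: "('a::real_normed_vector \<Rightarrow> 'b::real_normed_vector) \<Rightarrow> 'a \<Rightarrow> 'a \<Rightarrow> 'b" where
  "dd \<phi> x \<equiv> frechet_derivative \<phi> (at x)"

lemma times_cont_diff_on_differentiable:
  "times_cont_diff_on k U \<phi> \<Longrightarrow> 0 < k \<Longrightarrow> x \<in> U \<Longrightarrow> \<phi> differentiable (at x)"
  by (cases k) auto

lemma dd_eq: "(\<phi> has_derivative \<phi>') (at x) \<Longrightarrow> dd \<phi> x v = \<phi>' v"
  using frechet_derivative_at by metis

lemma dd_cong:
  assumes "open U" "x \<in> U" "\<And>y. y \<in> U \<Longrightarrow> \<phi> y = \<psi> y" "\<phi> differentiable (at x)"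
  shows "dd \<phi> x v = dd \<psi> x v"
  using frechet_derivative_transform_within_open[OF assms(4,1,2,3)] by simp

lemma dd_linear: "\<phi> differentiable (at x) \<Longrightarrow> linear (dd \<phi> x)"
  by (rule linear_frechet_derivative)

lemma dd_family_linear:
  fixes L :: "'c::real_normed_vector \<Rightarrow> 'a::real_vector \<Rightarrow> 'b::real_normed_vector"
  assumes "open U" "x \<in> U" "\<And>y. y \<in> U \<Longrightarrow> linear (L y)" "\<And>v. (\<lambda>y. L y v) differentiable (at x)"
  shows "linear (\<lambda>v. dd (\<lambda>y. L y v) x u)"
proof -
  have d: "((\<lambda>y. L y v) has_derivative dd (\<lambda>y. L y v) x) (at x)" for v
    using assms(4) frechet_derivative_works by blast
  show ?thesis
  proof (rule linearI)
    show "dd (\<lambda>y. L y (v + v')) x u = dd (\<lambda>y. L y v) x u + dd (\<lambda>y. L y v') x u" for v v'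
      by (rule dd_eq, rule has_derivative_transform_within_open[OF has_derivative_add[OF d d] assms(1,2)])
        (simp add: linear_add[OF assms(3)])
    show "dd (\<lambda>y. L y (r *\<^sub>R v)) x u = r *\<^sub>R dd (\<lambda>y. L y v) x u" for r v
      by (rule dd_eq, rule has_derivative_transform_within_open[OF
            has_derivative_scaleR_right[OF d] assms(1,2)])
        (simp add: linear_scale[OF assms(3)])
  qed
qed

text \<open>
  Lets the three index positions of a sum over structure coefficients be rotated.
\<close>

lemma sum3_cyclic:
  fixes \<phi> :: "'i \<Rightarrow> 'i \<Rightarrow> 'i \<Rightarrow> 'b::comm_monoid_add"
  shows "(\<Sum>i\<in>I. \<Sum>j\<in>I. \<Sum>k\<in>I. \<phi> j k i) = (\<Sum>i\<in>I. \<Sum>j\<in>I. \<Sum>k\<in>I. \<phi> i j k)"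
proof -
  have "(\<Sum>i\<in>I. \<Sum>j\<in>I. \<Sum>k\<in>I. \<phi> j k i) = (\<Sum>j\<in>I. \<Sum>i\<in>I. \<Sum>k\<in>I. \<phi> j k i)"
    by (rule sum.swap)
  also have "\<dots> = (\<Sum>j\<in>I. \<Sum>k\<in>I. \<Sum>i\<in>I. \<phi> j k i)"
    by (intro sum.cong refl sum.swap)
  finally show ?thesis .
qed

locale riemannian_metric =
  fixes U :: "'a::euclidean_space set" and g :: "'a \<Rightarrow> 'a \<Rightarrow> 'a \<Rightarrow> real"
  assumes open_U: "open U"
    and metric: "riemannian_metric_on U g"
begin

lemma g_bilinear: "x \<in> U \<Longrightarrow> bilinear (g x)"
  and g_sym: "x \<in> U \<Longrightarrow> g x u v = g x v u"
  and g_pos: "x \<in> U \<Longrightarrow> u \<noteq> 0 \<Longrightarrow> 0 < g x u u"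
  and g_smooth: "times_cont_diff_on k U (\<lambda>x. g x u v)"
  using metric by (auto simp: riemannian_metric_on_def smooth_on_def)

lemma g_linear_left: "x \<in> U \<Longrightarrow> linear (\<lambda>u. g x u v)"
  and g_linear_right: "x \<in> U \<Longrightarrow> linear (g x u)"
  using g_bilinear by (auto simp: bilinear_def)

lemmas g_simps =
  linear_add[OF g_linear_left] linear_add[OF g_linear_right]
  linear_diff[OF g_linear_left] linear_diff[OF g_linear_right]
  linear_scale[OF g_linear_left] linear_scale[OF g_linear_right]
  linear_sum[OF g_linear_left] linear_sum[OF g_linear_right]

lemma g_eqI:
  assumes "x \<in> U" "\<And>w. g x u w = g x v w"
  shows "u = v"
  using assms(2)[of "u - v"] g_pos[OF assms(1), of "u - v"] by (force simp: g_simps assms(1))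

lemma g_differentiable: "x \<in> U \<Longrightarrow> (\<lambda>y. g y u v) differentiable (at x)"
  using times_cont_diff_on_differentiable[OF g_smooth[of 1]] by simp

lemma metric_times_cont_diff_on:
  assumes "times_cont_diff_on k U V" "times_cont_diff_on k U W"
  shows "times_cont_diff_on k U (\<lambda>x. g x (V x) (W x))"
proof -
  have "times_cont_diff_on k U (\<lambda>x. g x (V x) w)" for w
    by (rule times_cont_diff_on_linear_family[OF open_U _ _ assms(1), of "\<lambda>x v. g x v w"])
      (rule g_linear_left g_smooth; assumption)+
  then show ?thesis
    by (intro times_cont_diff_on_linear_family[OF open_U _ _ assms(2), of "\<lambda>x w. g x (V x) w"]
        g_linear_right)
qed

end

locale orthonormal_frame = riemannian_metric U g
  for U :: "'a::euclidean_space set" and g +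
  fixes E :: "'a \<Rightarrow> 'a \<Rightarrow> 'a"
  assumes frame_C2: "\<And>i. i \<in> Basis \<Longrightarrow> times_cont_diff_on 2 U (E i)"
    and orthonormal: "\<And>x i j. \<lbrakk>x \<in> U; i \<in> Basis; j \<in> Basis\<rbrakk> \<Longrightarrow>
      g x (E i x) (E j x) = (if i = j then 1 else 0)"
begin

lemma frame_C1: "i \<in> Basis \<Longrightarrow> times_cont_diff_on 1 U (E i)"
  using times_cont_diff_on_SucD frame_C2 unfolding numeral_2_eq_2 One_nat_def by blast

lemma frame_differentiable: "x \<in> U \<Longrightarrow> i \<in> Basis \<Longrightarrow> E i differentiable (at x)"
  using times_cont_diff_on_differentiable[OF frame_C2] by simp

text \<open>
  Orthonormal vectors are independent, and the frame is indexed by \<open>Basis\<close>, so it has as many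
  members as the dimension.
\<close>

lemma frame_spans:
  assumes x: "x \<in> U"
  obtains a where "u = (\<Sum>i\<in>Basis. a i *\<^sub>R E i x)"
proof -
  let ?L = "\<lambda>u. \<Sum>i\<in>Basis. (u \<bullet> i) *\<^sub>R E i x"
  have lin: "linear ?L"
    by (intro linearI) (simp_all add: inner_add_left scaleR_add_left sum.distrib scaleR_sum_right)
  have "u = 0" if "?L u = 0" for u
  proof (rule euclidean_eqI)
    fix j :: 'a assume j: "j \<in> Basis"
    have "g x (?L u) (E j x) = (\<Sum>i\<in>Basis. (u \<bullet> i) * (if i = j then 1 else 0))"
      using x j orthonormal[OF x _ j] by (simp add: g_simps)
    also have "\<dots> = u \<bullet> j"
      using j by (simp add: if_distrib cong: if_cong)
    finally show "u \<bullet> j = 0 \<bullet> j"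
      using that linear_0[OF g_linear_left[OF x]] by simp
  qed
  then have "inj ?L"
    using linear_injective_0[OF lin] by blast
  then have "surj ?L"
    using lin linear_injective_imp_surjective by blast
  from surjD[OF this, of u] obtain w where "u = ?L w"
    by blast
  then show ?thesis
    by (rule that)
qed

lemma frame_expand:
  assumes x: "x \<in> U"
  shows "u = (\<Sum>i\<in>Basis. g x u (E i x) *\<^sub>R E i x)"
proof -
  obtain a where a: "u = (\<Sum>i\<in>Basis. a i *\<^sub>R E i x)"
    using frame_spans[OF x] by blast
  have "g x u (E j x) = a j" if "j \<in> Basis" for j
  proof -
    have "g x u (E j x) = (\<Sum>i\<in>Basis. a i * (if i = j then 1 else 0))"
      unfolding a using x orthonormal[OF x _ that] by (simp add: g_simps)
    then show ?thesis
      using that by (simp add: if_distrib cong: if_cong)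
  qed
  then have "(\<Sum>i\<in>Basis. g x u (E i x) *\<^sub>R E i x) = (\<Sum>i\<in>Basis. a i *\<^sub>R E i x)"
    by (intro sum.cong) auto
  with a show ?thesis
    by (rule trans[OF _ sym])
qed

lemma g_expand:
  assumes x: "x \<in> U"
  shows "g x u v = (\<Sum>i\<in>Basis. g x u (E i x) * g x v (E i x))"
proof -
  have "g x u v = g x u (\<Sum>i\<in>Basis. g x v (E i x) *\<^sub>R E i x)"
    by (simp only: frame_expand[OF x, of v, symmetric])
  then show ?thesis
    by (simp add: g_simps x mult.commute)
qed

text \<open>
  The curvature definitions take traces in the standard basis, which is not orthonormal for \<open>g\<close>;
  a trace does not depend on the basis, so it may be taken in the frame.
\<close>

lemma trace_in_frame:
  assumes x: "x \<in> U" and L: "linear L"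
  shows "(\<Sum>b\<in>Basis. L b \<bullet> b) = (\<Sum>i\<in>Basis. g x (L (E i x)) (E i x))"
proof -
  have "(\<Sum>b\<in>Basis. L b \<bullet> b) =
      (\<Sum>b\<in>Basis. L (\<Sum>i\<in>Basis. g x b (E i x) *\<^sub>R E i x) \<bullet> b)"
    by (simp only: frame_expand[OF x, symmetric])
  also have "\<dots> = (\<Sum>b\<in>Basis. \<Sum>i\<in>Basis. g x b (E i x) * (L (E i x) \<bullet> b))"
    by (simp add: linear_sum[OF L] linear_scale[OF L] inner_sum_left)
  also have "\<dots> = (\<Sum>i\<in>Basis. \<Sum>b\<in>Basis. (L (E i x) \<bullet> b) * g x b (E i x))"
    by (subst sum.swap) (simp add: mult.commute)
  also have "\<dots> = (\<Sum>i\<in>Basis. g x (\<Sum>b\<in>Basis. (L (E i x) \<bullet> b) *\<^sub>R b) (E i x))"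
    by (simp add: g_simps x)
  finally show ?thesis
    by (simp add: euclidean_representation)
qed

lemma metric_dual:
  assumes x: "x \<in> U" and \<phi>: "linear \<phi>"
  shows "metric_dual g x \<phi> = (\<Sum>i\<in>Basis. \<phi> (E i x) *\<^sub>R E i x)"
    and "g x (metric_dual g x \<phi>) w = \<phi> w"
proof -
  let ?v = "\<Sum>i\<in>Basis. \<phi> (E i x) *\<^sub>R E i x"
  have v: "g x ?v w = \<phi> w" for w
  proof -
    have "g x ?v w = (\<Sum>i\<in>Basis. \<phi> (E i x) * g x w (E i x))"
      using g_sym[OF x] by (simp add: g_simps x)
    also have "\<dots> = \<phi> (\<Sum>i\<in>Basis. g x w (E i x) *\<^sub>R E i x)"
      by (simp add: linear_sum[OF \<phi>] linear_scale[OF \<phi>] mult.commute)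
    finally show ?thesis
      by (simp only: frame_expand[OF x, of w, symmetric])
  qed
  then show 1: "metric_dual g x \<phi> = ?v"
    unfolding metric_dual_def by (intro the_equality) (auto intro: g_eqI[OF x])
  show "g x (metric_dual g x \<phi>) w = \<phi> w"
    unfolding 1 by (rule v)
qed

text \<open>
  The right-hand side of the Koszul formula for constant fields; \<open>christoffel\<close> raises its last index.
\<close>

definition koszul :: "'a \<Rightarrow> 'a \<Rightarrow> 'a \<Rightarrow> 'a \<Rightarrow> real" where
  "koszul x u v w = (dd (\<lambda>y. g y v w) x u + dd (\<lambda>y. g y u w) x v - dd (\<lambda>y. g y u v) x w) / 2"

lemma dd_g_linear:
  assumes x: "x \<in> U"
  shows "linear (\<lambda>u. dd (\<lambda>y. g y v w) x u)" "linear (\<lambda>v. dd (\<lambda>y. g y v w) x u)"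
    "linear (\<lambda>w. dd (\<lambda>y. g y v w) x u)"
  using dd_linear[OF g_differentiable[OF x]]
    dd_family_linear[OF open_U x g_linear_left g_differentiable[OF x]]
    dd_family_linear[OF open_U x g_linear_right g_differentiable[OF x]]
  by blast+

lemma dd_g_sym: "x \<in> U \<Longrightarrow> dd (\<lambda>y. g y v w) x u = dd (\<lambda>y. g y w v) x u"
  using g_sym by (intro dd_cong[OF open_U _ _ g_differentiable])

lemmas dd_g_simps =
  linear_add[OF dd_g_linear(1)] linear_add[OF dd_g_linear(2)] linear_add[OF dd_g_linear(3)]
  linear_scale[OF dd_g_linear(1)] linear_scale[OF dd_g_linear(2)] linear_scale[OF dd_g_linear(3)]

lemma koszul_linear:
  assumes x: "x \<in> U"
  shows "linear (\<lambda>v. koszul x u v w)" "linear (\<lambda>w. koszul x u v w)"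
  by (intro linearI; simp add: koszul_def dd_g_simps x field_simps)+

lemma christoffel_metric:
  assumes x: "x \<in> U"
  shows "g x (christoffel g x u v) w = koszul x u v w"
  using metric_dual(2)[OF x koszul_linear(2)[OF x]] by (simp add: christoffel_def koszul_def[abs_def])

lemma christoffel_frame:
  assumes x: "x \<in> U"
  shows "christoffel g x u v = (\<Sum>i\<in>Basis. koszul x u v (E i x) *\<^sub>R E i x)"
  using metric_dual(1)[OF x koszul_linear(2)[OF x]] by (simp add: christoffel_def koszul_def[abs_def])

lemma christoffel_sym: "x \<in> U \<Longrightarrow> christoffel g x u v = christoffel g x v u"
  by (rule g_eqI, assumption) (simp add: christoffel_metric koszul_def dd_g_sym[of x u v])

lemma christoffel_linear_right: "x \<in> U \<Longrightarrow> linear (christoffel g x u)"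
  by (rule linearI; rule g_eqI, assumption;
      simp add: christoffel_metric g_simps linear_add[OF koszul_linear(1)] linear_scale[OF koszul_linear(1)])

lemma christoffel_linear_left:
  assumes x: "x \<in> U"
  shows "linear (\<lambda>u. christoffel g x u v)"
proof -
  have "(\<lambda>u. christoffel g x u v) = christoffel g x v"
    using christoffel_sym[OF x] by (rule ext)
  then show ?thesis
    using christoffel_linear_right[OF x] by simp
qed

lemma christoffel_C1: "times_cont_diff_on 1 U (\<lambda>x. christoffel g x u v)"
proof (rule times_cont_diff_on_cong[OF open_U])
  have "times_cont_diff_on 1 U (\<lambda>x. dd (\<lambda>y. g y v w) x u)" for u v w
    using times_cont_diff_on_Suc_directional[OF g_smooth] by simp
  then have "times_cont_diff_on 1 U (\<lambda>x. (1 / 2) * (dd (\<lambda>y. g y v w) x u + dd (\<lambda>y. g y u w) x v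
      - dd (\<lambda>y. g y u v) x w))" for u v w
    by (intro times_cont_diff_on_mult times_cont_diff_on_add times_cont_diff_on_diff open_U
        times_cont_diff_on_const)
  then have "times_cont_diff_on 1 U (\<lambda>x. koszul x u v w)" for u v w
    by (simp add: koszul_def)
  note koszul_C1 = this
  have "times_cont_diff_on 1 U (\<lambda>x. koszul x u v (E i x))" if "i \<in> Basis" for i
    by (rule times_cont_diff_on_linear_family[OF open_U _ _ frame_C1[OF that]])
      (rule koszul_linear(2) koszul_C1; assumption?)+
  then show "times_cont_diff_on 1 U (\<lambda>x. \<Sum>i\<in>Basis. koszul x u v (E i x) *\<^sub>R E i x)"
    by (intro times_cont_diff_on_sum times_cont_diff_on_scaleR open_U frame_C1)
qed (simp add: christoffel_frame)

lemma christoffel_differentiable: "x \<in> U \<Longrightarrow> (\<lambda>y. christoffel g y u v) differentiable (at x)"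
  using times_cont_diff_on_differentiable[OF christoffel_C1] by simp

definition nabla :: "'a \<Rightarrow> 'a \<Rightarrow> ('a \<Rightarrow> 'a) \<Rightarrow> 'a" where
  "nabla x u V = dd V x u + christoffel g x u (V x)"

lemma nabla_linear: "x \<in> U \<Longrightarrow> V differentiable (at x) \<Longrightarrow> linear (\<lambda>u. nabla x u V)"
  unfolding nabla_def by (intro linear_compose_add dd_linear christoffel_linear_left)

lemma nabla_torsion_free:
  "x \<in> U \<Longrightarrow> nabla x (V x) W - nabla x (W x) V = lie_bracket V W x"
  by (simp add: nabla_def lie_bracket_def christoffel_sym[of x "V x"])

lemma has_derivative_g:
  assumes x: "x \<in> U" and V: "V differentiable (at x)" and W: "W differentiable (at x)"
  shows "((\<lambda>y. g y (V y) (W y)) has_derivative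
    (\<lambda>u. dd (\<lambda>y. g y (V x) (W x)) x u + g x (dd V x u) (W x) + g x (V x) (dd W x u))) (at x)"
proof -
  have 1: "((\<lambda>y. g y (V y) w) has_derivative
      (\<lambda>u. dd (\<lambda>y. g y (V x) w) x u + g x (dd V x u) w)) (at x)" for w
    using has_derivative_linear_family[OF open_U x _ _ V, of "\<lambda>y v. g y v w"]
    by (simp add: g_linear_left g_differentiable x)
  then have "(\<lambda>y. g y (V y) w) differentiable (at x)" for w
    by (rule differentiableI)
  then have "((\<lambda>y. g y (V y) (W y)) has_derivative
      (\<lambda>u. dd (\<lambda>y. g y (V y) (W x)) x u + g x (V x) (dd W x u))) (at x)"
    using has_derivative_linear_family[OF open_U x _ _ W, of "\<lambda>y w. g y (V y) w"]
    by (simp add: g_linear_right)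
  then show ?thesis
    by (simp add: dd_eq[OF 1])
qed

lemma nabla_metric:
  assumes x: "x \<in> U" and V: "V differentiable (at x)" and W: "W differentiable (at x)"
  shows "dd (\<lambda>y. g y (V y) (W y)) x u = g x (nabla x u V) (W x) + g x (V x) (nabla x u W)"
proof -
  have "dd (\<lambda>y. g y v w) x u = g x (christoffel g x u v) w + g x v (christoffel g x u w)" for v w
    using x g_sym[OF x, of v] dd_g_sym[OF x, of v]
    by (simp add: christoffel_metric koszul_def field_simps)
  then show ?thesis
    unfolding dd_eq[OF has_derivative_g[OF assms]] by (simp add: nabla_def g_simps x)
qed


lemma has_derivative_christoffel:
  assumes x: "x \<in> U" and V: "V differentiable (at x)" and W: "W differentiable (at x)"
  shows "((\<lambda>y. christoffel g y (V y) (W y)) has_derivative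
    (\<lambda>u. dd (\<lambda>y. christoffel g y (V x) (W x)) x u + christoffel g x (dd V x u) (W x)
      + christoffel g x (V x) (dd W x u))) (at x)"
proof -
  have 1: "((\<lambda>y. christoffel g y (V y) w) has_derivative
      (\<lambda>u. dd (\<lambda>y. christoffel g y (V x) w) x u + christoffel g x (dd V x u) w)) (at x)" for w
    using has_derivative_linear_family[OF open_U x _ _ V, of "\<lambda>y v. christoffel g y v w"]
    by (simp add: christoffel_linear_left christoffel_differentiable x)
  then have "(\<lambda>y. christoffel g y (V y) w) differentiable (at x)" for w
    by (rule differentiableI)
  then have "((\<lambda>y. christoffel g y (V y) (W y)) has_derivative
      (\<lambda>u. dd (\<lambda>y. christoffel g y (V y) (W x)) x u + christoffel g x (V x) (dd W x u))) (at x)"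
    using has_derivative_linear_family[OF open_U x _ _ W, of "\<lambda>y w. christoffel g y (V y) w"]
    by (simp add: christoffel_linear_right)
  then show ?thesis
    by (simp add: dd_eq[OF 1])
qed

lemma has_derivative_nabla:
  assumes x: "x \<in> U" and B: "B differentiable (at x)" and W: "times_cont_diff_on 2 U W"
  shows "((\<lambda>y. nabla y (B y) W) has_derivative
    (\<lambda>u. dd (\<lambda>y. dd W y (B x)) x u + dd W x (dd B x u)
      + (dd (\<lambda>y. christoffel g y (B x) (W x)) x u + christoffel g x (dd B x u) (W x)
        + christoffel g x (B x) (dd W x u)))) (at x)"
proof -
  have W1: "W differentiable (at y)" if "y \<in> U" for y
    using times_cont_diff_on_differentiable[OF W] that by simp
  have "times_cont_diff_on (Suc 0) U (\<lambda>y. dd W y v)" for v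
    using W times_cont_diff_on_Suc_directional unfolding numeral_2_eq_2 by blast
  then have "(\<lambda>y. dd W y v) differentiable (at x)" for v
    using times_cont_diff_on_differentiable x by blast
  then show ?thesis
    unfolding nabla_def
    by (intro has_derivative_add has_derivative_christoffel x B W1
        has_derivative_linear_family[OF open_U x dd_linear[OF W1]])
qed

text \<open>
  \<open>R(A,B)W = \<nabla>\<^sub>A\<nabla>\<^sub>BW - \<nabla>\<^sub>B\<nabla>\<^sub>AW - \<nabla>\<^bsub>[A,B]\<^esub>W\<close>.  The definition of \<open>riemann_curvature\<close> differentiates along
  constant fields only; the extra terms that variable fields produce cancel because second
  derivatives of \<open>W\<close> are symmetric and Christoffel symbols are symmetric.
\<close>

lemma riemann_nabla:
  assumes x: "x \<in> U" and A: "A differentiable (at x)" and B: "B differentiable (at x)"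
    and W: "times_cont_diff_on 2 U W"
  shows "riemann_curvature g x (A x) (B x) (W x) =
    nabla x (A x) (\<lambda>y. nabla y (B y) W) - nabla x (B x) (\<lambda>y. nabla y (A y) W)
    - nabla x (lie_bracket A B x) W"
proof -
  have W1: "W differentiable (at x)"
    using times_cont_diff_on_differentiable[OF W] x by simp
  have "dd (\<lambda>y. dd W y (B x)) x (A x) = dd (\<lambda>y. dd W y (A x)) x (B x)"
    by (rule second_derivative_symmetric[OF open_U x W])
  then show ?thesis
    unfolding nabla_def[of x _ "\<lambda>y. nabla y (_ y) W"] dd_eq[OF has_derivative_nabla[OF x A W]]
      dd_eq[OF has_derivative_nabla[OF x B W]]
    by (simp add: nabla_def riemann_curvature_def lie_bracket_def
        linear_add[OF christoffel_linear_right[OF x]] linear_diff[OF christoffel_linear_left[OF x]]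
        linear_diff[OF dd_linear[OF W1]] algebra_simps)
qed

definition structure_coeff :: "'a \<Rightarrow> 'a \<Rightarrow> 'a \<Rightarrow> 'a \<Rightarrow> real" where
  "structure_coeff x i j k = g x (lie_bracket (E i) (E j) x) (E k x)"

definition connection_coeff :: "'a \<Rightarrow> 'a \<Rightarrow> 'a \<Rightarrow> 'a \<Rightarrow> real" where
  "connection_coeff x i j k = g x (nabla x (E i x) (E j)) (E k x)"

lemma structure_coeff_antisym: "x \<in> U \<Longrightarrow> structure_coeff x i j k = - structure_coeff x j i k"
  unfolding structure_coeff_def lie_bracket_def by (simp add: g_simps)

lemma structure_coeff_connection:
  "x \<in> U \<Longrightarrow> structure_coeff x i j k = connection_coeff x i j k - connection_coeff x j i k"
  unfolding structure_coeff_def connection_coeff_def nabla_torsion_free[symmetric]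
  by (simp add: g_simps)

lemma connection_coeff_antisym:
  assumes x: "x \<in> U" and ijk: "i \<in> Basis" "j \<in> Basis" "k \<in> Basis"
  shows "connection_coeff x i j k = - connection_coeff x i k j"
proof -
  have "((\<lambda>y. g y (E j y) (E k y)) has_derivative (\<lambda>u. 0)) (at x)"
    by (rule has_derivative_transform_within_open[OF has_derivative_const[of "if j = k then 1 else 0"] open_U x])
      (simp add: orthonormal ijk)
  then have "dd (\<lambda>y. g y (E j y) (E k y)) x (E i x) = 0"
    by (rule dd_eq)
  then show ?thesis
    using nabla_metric[OF x frame_differentiable[OF x ijk(2)] frame_differentiable[OF x ijk(3)], of "E i x"]
      g_sym[OF x]
    by (simp add: connection_coeff_def)
qed

text \<open>
  The Koszul formula in an orthonormal frame: the three equations that express torsion freeness for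
  the cyclic permutations of \<open>i\<close>, \<open>j\<close>, \<open>k\<close>, solved with the help of antisymmetry in the last two
  indices.
\<close>

lemma connection_coeff_structure:
  assumes x: "x \<in> U" and ijk: "i \<in> Basis" "j \<in> Basis" "k \<in> Basis"
  shows "connection_coeff x i j k =
    (structure_coeff x i j k - structure_coeff x j k i + structure_coeff x k i j) / 2"
  using connection_coeff_antisym[OF x, of j i k] connection_coeff_antisym[OF x, of i j k]
    connection_coeff_antisym[OF x, of k i j] ijk
  by (simp add: structure_coeff_connection[OF x])

lemma structure_coeff_C1:
  assumes "i \<in> Basis" "j \<in> Basis" "k \<in> Basis"
  shows "times_cont_diff_on 1 U (\<lambda>x. structure_coeff x i j k)"
proof -
  have dd1: "times_cont_diff_on 1 U (\<lambda>x. dd (E j) x (E i x))" if "i \<in> Basis" "j \<in> Basis" for i j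
  proof (rule times_cont_diff_on_linear_family[OF open_U _ _ frame_C1[OF that(1)]])
    show "linear (dd (E j) x)" if "x \<in> U" for x
      by (rule dd_linear[OF frame_differentiable[OF that \<open>j \<in> Basis\<close>]])
    show "times_cont_diff_on 1 U (\<lambda>x. dd (E j) x v)" for v
      using frame_C2[OF that(2)] times_cont_diff_on_Suc_directional unfolding numeral_2_eq_2 One_nat_def by blast
  qed
  show ?thesis
    unfolding structure_coeff_def lie_bracket_def
    by (intro metric_times_cont_diff_on times_cont_diff_on_diff open_U dd1 frame_C1 assms)
qed

text \<open>
  Metric compatibility, used for the derivative of \<open>g(\<nabla>\<^bsub>E j\<^esub>E k, E l)\<close>, moves the outer covariant
  derivative to \<open>E l\<close> and avoids differentiating the expansion of \<open>\<nabla>\<^bsub>E j\<^esub>E k\<close> in the frame.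
\<close>

lemma nabla_nabla_frame:
  assumes x: "x \<in> U" and "i \<in> Basis" "j \<in> Basis" "k \<in> Basis" "l \<in> Basis"
  shows "g x (nabla x (E i x) (\<lambda>y. nabla y (E j y) (E k))) (E l x) =
    dd (\<lambda>y. connection_coeff y j k l) x (E i x)
    - (\<Sum>m\<in>Basis. connection_coeff x j k m * connection_coeff x i l m)"
proof -
  have "(\<lambda>y. nabla y (E j y) (E k)) differentiable (at x)"
    using has_derivative_nabla[OF x frame_differentiable frame_C2] assms
    by (blast intro: differentiableI)
  from nabla_metric[OF x this frame_differentiable[OF x \<open>l \<in> Basis\<close>], of "E i x"]
  show ?thesis
    using g_expand[OF x, of "nabla x (E j x) (E k)" "nabla x (E i x) (E l)"]
    by (simp add: connection_coeff_def)
qed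

lemma riemann_frame:
  assumes x: "x \<in> U" and ijkl: "i \<in> Basis" "j \<in> Basis" "k \<in> Basis" "l \<in> Basis"
  shows "g x (riemann_curvature g x (E i x) (E j x) (E k x)) (E l x) =
    dd (\<lambda>y. connection_coeff y j k l) x (E i x) - dd (\<lambda>y. connection_coeff y i k l) x (E j x)
    - (\<Sum>m\<in>Basis. connection_coeff x j k m * connection_coeff x i l m)
    + (\<Sum>m\<in>Basis. connection_coeff x i k m * connection_coeff x j l m)
    - (\<Sum>m\<in>Basis. structure_coeff x i j m * connection_coeff x m k l)"
proof -
  have lin: "linear (\<lambda>u. nabla x u (E k))"
    by (rule nabla_linear[OF x frame_differentiable[OF x ijkl(3)]])
  have "nabla x (lie_bracket (E i) (E j) x) (E k) =
      nabla x (\<Sum>m\<in>Basis. structure_coeff x i j m *\<^sub>R E m x) (E k)"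
    unfolding structure_coeff_def by (simp only: frame_expand[OF x, symmetric])
  also have "\<dots> = (\<Sum>m\<in>Basis. structure_coeff x i j m *\<^sub>R nabla x (E m x) (E k))"
    by (simp add: linear_sum[OF lin] linear_scale[OF lin])
  finally have "g x (nabla x (lie_bracket (E i) (E j) x) (E k)) (E l x) =
      (\<Sum>m\<in>Basis. structure_coeff x i j m * connection_coeff x m k l)"
    by (simp add: g_simps x connection_coeff_def)
  then show ?thesis
    using ijkl nabla_nabla_frame[OF x]
    by (simp add: riemann_nabla[OF x frame_differentiable[OF x] frame_differentiable[OF x] frame_C2]
        g_simps x)
qed

lemma riemann_linear:
  assumes x: "x \<in> U"
  shows "linear (\<lambda>u. riemann_curvature g x u v w)" "linear (\<lambda>v. riemann_curvature g x u v w)"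
    "linear (\<lambda>w. riemann_curvature g x u v w)"
proof -
  note d = christoffel_differentiable[OF x]
  note lins = dd_linear[OF d] dd_family_linear[OF open_U x christoffel_linear_left d]
    dd_family_linear[OF open_U x christoffel_linear_right d]
    christoffel_linear_left[OF x] christoffel_linear_right[OF x]
  show "linear (\<lambda>u. riemann_curvature g x u v w)" "linear (\<lambda>v. riemann_curvature g x u v w)"
    "linear (\<lambda>w. riemann_curvature g x u v w)"
    by (intro linearI; simp add: riemann_curvature_def lins[THEN linear_add] lins[THEN linear_scale]
        algebra_simps)+
qed

lemma ricci_linear:
  assumes x: "x \<in> U"
  shows "linear (\<lambda>v. ricci_curvature g x v w)" "linear (ricci_curvature g x v)"
  by (intro linearI; simp add: ricci_curvature_def riemann_linear[OF x, THEN linear_add]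
      riemann_linear[OF x, THEN linear_scale] inner_add_left sum.distrib sum_distrib_left)+

lemma ricci_frame:
  assumes x: "x \<in> U"
  shows "ricci_curvature g x v w = (\<Sum>i\<in>Basis. g x (riemann_curvature g x (E i x) v w) (E i x))"
  unfolding ricci_curvature_def by (rule trace_in_frame[OF x riemann_linear(1)[OF x]])

lemma scalar_curvature_ricci:
  assumes x: "x \<in> U"
  shows "scalar_curvature g x = (\<Sum>j\<in>Basis. ricci_curvature g x (E j x) (E j x))"
proof -
  have "linear (\<lambda>b. metric_dual g x (ricci_curvature g x b))"
    by (intro linearI; simp add: metric_dual(1)[OF x ricci_linear(2)[OF x]] sum.distrib
        ricci_linear(1)[OF x, THEN linear_add] ricci_linear(1)[OF x, THEN linear_scale]
        scaleR_add_left scaleR_sum_right)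
  then show ?thesis
    unfolding scalar_curvature_def trace_in_frame[OF x] by (simp add: trace_in_frame[OF x] metric_dual(2)[OF x ricci_linear(2)[OF x]])
qed

definition structure_trace :: "'a \<Rightarrow> 'a \<Rightarrow> real" where
  "structure_trace x i = (\<Sum>j\<in>Basis. structure_coeff x i j j)"

lemma connection_coeff_diagonal:
  assumes x: "x \<in> U" and "i \<in> Basis" "j \<in> Basis"
  shows "connection_coeff x j j i = structure_coeff x i j j"
    "connection_coeff x j i j = - structure_coeff x i j j"
  using assms structure_coeff_antisym[OF x, of i j j] structure_coeff_antisym[OF x, of j j i]
  by (auto simp: connection_coeff_structure)

lemma structure_trace_C1: "i \<in> Basis \<Longrightarrow> times_cont_diff_on 1 U (\<lambda>x. structure_trace x i)"
  unfolding structure_trace_def by (intro times_cont_diff_on_sum open_U structure_coeff_C1)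

text \<open>
  The sum \<open>\<Sum> g(R(E i, E j) E j, E i)\<close> in terms of connection coefficients \<open>\<omega>\<close>.  Its derivative terms
  and the terms \<open>\<omega> j j m \<omega> i i m\<close> contain only the traces.  In the remaining quadratic terms \<open>\<omega>\<close> is
  replaced by structure coefficients \<open>c\<close>; each product that arises is, up to a rotation of the
  indices, a square of \<open>c i j k\<close> or \<open>c i j k c j k i\<close>.
\<close>

theorem scalar_curvature_frame:
  assumes x: "x \<in> U"
  shows "scalar_curvature g x =
    2 * (\<Sum>i\<in>Basis. dd (\<lambda>y. structure_trace y i) x (E i x))
    - (\<Sum>i\<in>Basis. (structure_trace x i)\<^sup>2)
    - (\<Sum>i\<in>Basis. \<Sum>j\<in>Basis. \<Sum>k\<in>Basis. (structure_coeff x i j k)\<^sup>2) / 4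
    - (\<Sum>i\<in>Basis. \<Sum>j\<in>Basis. \<Sum>k\<in>Basis. structure_coeff x i j k * structure_coeff x i k j) / 2"
proof -
  let ?c = "structure_coeff x" and ?\<omega> = "connection_coeff x"
  let ?D = "\<lambda>i j. dd (\<lambda>y. structure_coeff y i j j) x (E i x)"
  have D: "dd (\<lambda>y. connection_coeff y j j i) x (E i x) = ?D i j"
    "dd (\<lambda>y. connection_coeff y j i j) x (E i x) = - ?D i j" if "i \<in> Basis" "j \<in> Basis" for i j
  proof -
    have c: "(\<lambda>y. structure_coeff y i j j) differentiable (at x)"
      using times_cont_diff_on_differentiable[OF structure_coeff_C1 _ x] that by simp
    then have d: "((\<lambda>y. structure_coeff y i j j) has_derivative dd (\<lambda>y. structure_coeff y i j j) x) (at x)"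
      using frechet_derivative_works by blast
    show "dd (\<lambda>y. connection_coeff y j j i) x (E i x) = ?D i j"
      by (rule dd_eq, rule has_derivative_transform_within_open[OF d open_U x])
        (simp add: connection_coeff_diagonal that)
    show "dd (\<lambda>y. connection_coeff y j i j) x (E i x) = - ?D i j"
      by (rule dd_eq, rule has_derivative_transform_within_open[OF has_derivative_minus[OF d] open_U x])
        (simp add: connection_coeff_diagonal that)
  qed
  have trace: "dd (\<lambda>y. structure_trace y i) x (E i x) = (\<Sum>j\<in>Basis. ?D i j)" if "i \<in> Basis" for i
  proof (rule dd_eq)
    show "((\<lambda>y. structure_trace y i) has_derivative
        (\<lambda>u. \<Sum>j\<in>Basis. dd (\<lambda>y. structure_coeff y i j j) x u)) (at x)"
      unfolding structure_trace_def
      by (intro has_derivative_sum)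
        (simp only: times_cont_diff_on_differentiable[OF structure_coeff_C1 _ x] that
          frechet_derivative_works[symmetric] zero_less_one)
  qed
  have "scalar_curvature g x = (\<Sum>j\<in>Basis. \<Sum>i\<in>Basis.
      ?D i j + ?D j i - (\<Sum>m\<in>Basis. ?c m j j * ?c m i i)
      + (\<Sum>m\<in>Basis. ?\<omega> i j m * ?\<omega> j i m - ?c i j m * ?\<omega> m j i))"
    unfolding scalar_curvature_ricci[OF x] ricci_frame[OF x]
    by (intro sum.cong refl)
      (simp add: riemann_frame[OF x] D connection_coeff_diagonal x sum_subtractf)
  also have "\<dots> = 2 * (\<Sum>i\<in>Basis. \<Sum>j\<in>Basis. ?D i j)
      - (\<Sum>j\<in>Basis. \<Sum>i\<in>Basis. \<Sum>m\<in>Basis. ?c m j j * ?c m i i)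
      + (\<Sum>j\<in>Basis. \<Sum>i\<in>Basis. \<Sum>m\<in>Basis. ?\<omega> i j m * ?\<omega> j i m - ?c i j m * ?\<omega> m j i)"
    by (simp add: sum.distrib sum_subtractf sum.swap[of "\<lambda>i j. ?D i j"])
  also have "(\<Sum>i\<in>Basis. \<Sum>j\<in>Basis. ?D i j) = (\<Sum>i\<in>Basis. dd (\<lambda>y. structure_trace y i) x (E i x))"
    by (simp add: trace)
  also have "(\<Sum>j\<in>Basis. \<Sum>i\<in>Basis. \<Sum>m\<in>Basis. ?c m j j * ?c m i i) =
      (\<Sum>m\<in>Basis. (structure_trace x m)\<^sup>2)"
    unfolding structure_trace_def power2_eq_square sum_product
    by (rule sum3_cyclic[symmetric])
  also have "(\<Sum>j\<in>Basis. \<Sum>i\<in>Basis. \<Sum>m\<in>Basis. ?\<omega> i j m * ?\<omega> j i m - ?c i j m * ?\<omega> m j i) =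
      (\<Sum>i\<in>Basis. \<Sum>j\<in>Basis. \<Sum>m\<in>Basis. ?\<omega> i j m * ?\<omega> j i m - ?c i j m * ?\<omega> m j i)"
    by (rule sum.swap)
  also have "\<dots> = (\<Sum>i\<in>Basis. \<Sum>j\<in>Basis. \<Sum>m\<in>Basis.
      (?c m i j)\<^sup>2 / 4 + (?c j m i)\<^sup>2 / 4 - 3 * (?c i j m)\<^sup>2 / 4
      - ?c j m i * ?c m i j / 2 + ?c i j m * ?c j m i / 2 + ?c m i j * ?c i j m / 2)"
  proof (intro sum.cong refl)
    fix i j m :: 'a assume "i \<in> Basis" "j \<in> Basis" "m \<in> Basis"
    moreover have "?c j i m = - ?c i j m" "?c i m j = - ?c m i j" "?c m j i = - ?c j m i"
      using structure_coeff_antisym[OF x] by blast+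
    ultimately show "?\<omega> i j m * ?\<omega> j i m - ?c i j m * ?\<omega> m j i =
      (?c m i j)\<^sup>2 / 4 + (?c j m i)\<^sup>2 / 4 - 3 * (?c i j m)\<^sup>2 / 4
      - ?c j m i * ?c m i j / 2 + ?c i j m * ?c j m i / 2 + ?c m i j * ?c i j m / 2"
      by (simp add: connection_coeff_structure[OF x] power2_eq_square field_simps)
  qed
  also have "\<dots> = - (\<Sum>i\<in>Basis. \<Sum>j\<in>Basis. \<Sum>k\<in>Basis. (?c i j k)\<^sup>2) / 4
      + (\<Sum>i\<in>Basis. \<Sum>j\<in>Basis. \<Sum>k\<in>Basis. ?c i j k * ?c j k i) / 2"
  proof -
    let ?I = "Basis :: 'a set"
    have sq: "(\<Sum>i\<in>?I. \<Sum>j\<in>?I. \<Sum>k\<in>?I. (?c j k i)\<^sup>2) = (\<Sum>i\<in>?I. \<Sum>j\<in>?I. \<Sum>k\<in>?I. (?c i j k)\<^sup>2)"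
      "(\<Sum>i\<in>?I. \<Sum>j\<in>?I. \<Sum>k\<in>?I. (?c k i j)\<^sup>2) = (\<Sum>i\<in>?I. \<Sum>j\<in>?I. \<Sum>k\<in>?I. (?c i j k)\<^sup>2)"
      using sum3_cyclic[where I = ?I and \<phi> = "\<lambda>i j k. (?c i j k)\<^sup>2"]
        sum3_cyclic[where I = ?I and \<phi> = "\<lambda>i j k. (?c k i j)\<^sup>2"] by simp_all
    have pr: "(\<Sum>i\<in>?I. \<Sum>j\<in>?I. \<Sum>k\<in>?I. ?c j k i * ?c k i j) = (\<Sum>i\<in>?I. \<Sum>j\<in>?I. \<Sum>k\<in>?I. ?c i j k * ?c j k i)"
      "(\<Sum>i\<in>?I. \<Sum>j\<in>?I. \<Sum>k\<in>?I. ?c k i j * ?c i j k) = (\<Sum>i\<in>?I. \<Sum>j\<in>?I. \<Sum>k\<in>?I. ?c i j k * ?c j k i)"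
      using sum3_cyclic[where I = ?I and \<phi> = "\<lambda>i j k. ?c i j k * ?c j k i"]
        sum3_cyclic[where I = ?I and \<phi> = "\<lambda>i j k. ?c k i j * ?c i j k"] by simp_all
    show ?thesis
      by (simp add: sum.distrib sum_subtractf sq pr flip: sum_divide_distrib sum_distrib_left)
  qed
  also have "(\<Sum>i\<in>Basis. \<Sum>j\<in>Basis. \<Sum>k\<in>Basis. ?c i j k * ?c j k i) =
      - (\<Sum>i\<in>Basis. \<Sum>j\<in>Basis. \<Sum>k\<in>Basis. ?c j i k * ?c j k i)"
  proof -
    have "?c i j k * ?c j k i = - (?c j i k * ?c j k i)" for i j k
      using structure_coeff_antisym[OF x, of i j k] by simp
    then show ?thesis
      by (simp only: sum_negf)
  qed
  also have "(\<Sum>i\<in>Basis. \<Sum>j\<in>Basis. \<Sum>k\<in>Basis. ?c j i k * ?c j k i) =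
      (\<Sum>i\<in>Basis. \<Sum>j\<in>Basis. \<Sum>k\<in>Basis. ?c i j k * ?c i k j)"
    by (rule sum.swap)
  finally show ?thesis
    by simp
qed

end

section \<open>Continuity of the scalar curvature\<close>

context riemannian_metric
begin

text \<open>
  Gram-Schmidt orthogonalisation of the constant fields in \<open>B\<close>, at all points at once.  The claim on
  spans keeps the next vector, \<open>a\<close> minus its projection, from vanishing.
\<close>

lemma partial_frame_exists:
  assumes "finite B" "B \<subseteq> Basis"
  shows "\<exists>E. (\<forall>i\<in>B. times_cont_diff_on k U (E i)) \<and>
    (\<forall>x\<in>U. \<forall>i\<in>B. \<forall>j\<in>B. g x (E i x) (E j x) = (if i = j then 1 else 0)) \<and>
    (\<forall>x\<in>U. \<forall>i\<in>B. E i x \<in> span B)"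
  using assms
proof (induction B rule: finite_induct)
  case empty
  then show ?case
    by simp
next
  case (insert a B)
  have "B \<subseteq> Basis"
    using insert.prems by simp
  from insert.IH[OF this] obtain E where E: "\<forall>i\<in>B. times_cont_diff_on k U (E i)"
    "\<forall>x\<in>U. \<forall>i\<in>B. \<forall>j\<in>B. g x (E i x) (E j x) = (if i = j then 1 else 0)"
    "\<forall>x\<in>U. \<forall>i\<in>B. E i x \<in> span B"
    by (elim exE conjE)
  note C = E(1)[rule_format] and on = E(2)[rule_format] and sp = E(3)[rule_format]
  define F where "F = (\<lambda>x. a - (\<Sum>i\<in>B. g x a (E i x) *\<^sub>R E i x))"
  define n where "n = (\<lambda>x. g x (F x) (F x))"
  define e where "e = (\<lambda>x. inverse (sqrt (n x)) *\<^sub>R F x)"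
  have F_nz: "F x \<noteq> 0" if x: "x \<in> U" for x
  proof
    assume "F x = 0"
    then have "a = (\<Sum>i\<in>B. g x a (E i x) *\<^sub>R E i x)"
      by (simp add: F_def)
    moreover have "(\<Sum>i\<in>B. g x a (E i x) *\<^sub>R E i x) \<in> span B"
      by (intro span_sum span_scale sp x)
    ultimately have "a \<in> span B"
      by (rule ssubst)
    moreover have "orthogonal a b" if "b \<in> B" for b
      using that insert.prems insert.hyps(2) by (auto simp: orthogonal_def inner_Basis)
    ultimately have "orthogonal a a"
      using orthogonal_to_span by blast
    then show False
      using insert.prems by (auto simp: orthogonal_def inner_Basis)
  qed
  have F_orth: "g x (F x) (E j x) = 0" "g x (E j x) (F x) = 0" if x: "x \<in> U" "j \<in> B" for x j
  proof -
    have "g x (F x) (E j x) = g x a (E j x) - (\<Sum>i\<in>B. g x a (E i x) * (if i = j then 1 else 0))"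
      using x on by (simp add: F_def g_simps)
    then show "g x (F x) (E j x) = 0"
      using x insert.hyps(1) by (simp add: if_distrib cong: if_cong)
    then show "g x (E j x) (F x) = 0"
      using g_sym[OF x(1)] by simp
  qed
  have n_pos: "n x > 0" if "x \<in> U" for x
    using g_pos[OF that F_nz[OF that]] by (simp add: n_def)
  have F_C: "times_cont_diff_on k U F"
    unfolding F_def
    by (intro times_cont_diff_on_diff times_cont_diff_on_sum times_cont_diff_on_scaleR open_U
        times_cont_diff_on_const metric_times_cont_diff_on C)
  have e_C: "times_cont_diff_on k U e"
    unfolding e_def n_def
    by (intro times_cont_diff_on_scaleR times_cont_diff_on_inverse times_cont_diff_on_sqrt open_U
        metric_times_cont_diff_on F_C) (use n_pos in \<open>auto simp: n_def\<close>)
  have e_sp: "e x \<in> span (insert a B)" if "x \<in> U" for x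
    unfolding e_def F_def using sp[OF that] span_mono[of B "insert a B"]
    by (intro span_scale span_diff span_sum) (auto simp: span_base)
  have e_unit: "g x (e x) (e x) = 1" if "x \<in> U" for x
  proof -
    have "sqrt (n x) * sqrt (n x) = g x (F x) (F x)" "sqrt (n x) > 0"
      using n_pos[OF that] by (simp_all add: n_def)
    then show ?thesis
      by (simp add: e_def g_simps that field_simps)
  qed
  have e_orth: "g x (e x) (E j x) = 0" "g x (E j x) (e x) = 0" if "x \<in> U" "j \<in> B" for x j
    using F_orth[OF that] by (simp_all add: e_def g_simps that)
  show ?case
  proof (intro exI[of _ "E(a := e)"] conjI ballI)
    fix i assume "i \<in> insert a B"
    then show "times_cont_diff_on k U ((E(a := e)) i)"
      using C e_C by auto
  next
    fix x i assume "x \<in> U" "i \<in> insert a B"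
    then show "(E(a := e)) i x \<in> span (insert a B)"
      using e_sp sp span_mono[of B "insert a B"] by auto
  next
    fix x i j assume "x \<in> U" "i \<in> insert a B" "j \<in> insert a B"
    then show "g x ((E(a := e)) i x) ((E(a := e)) j x) = (if i = j then 1 else 0)"
      using e_unit e_orth on insert.hyps(2) by auto
  qed
qed

lemma orthonormal_frame_exists: "\<exists>E. orthonormal_frame U g E"
proof -
  obtain E :: "'a \<Rightarrow> 'a \<Rightarrow> 'a" where "\<forall>i\<in>Basis. times_cont_diff_on 2 U (E i)"
    "\<forall>x\<in>U. \<forall>i\<in>Basis. \<forall>j\<in>Basis. g x (E i x) (E j x) = (if i = j then 1 else 0)"
    "\<forall>x\<in>U. \<forall>i\<in>Basis. E i x \<in> span Basis"
    using partial_frame_exists[OF finite_Basis subset_refl, of 2] by (elim exE conjE)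
  then have "orthonormal_frame U g E"
    by unfold_locales blast+
  then show ?thesis
    by (intro exI[of _ E])
qed

end

text \<open>
  The structure coefficients of a twice continuously differentiable frame have continuous first
  derivatives, and the frame formula contains no derivatives of higher order.
\<close>

lemma (in orthonormal_frame) scalar_curvature_continuous_in_frame: "continuous_on U (scalar_curvature g)"
proof -
  have c: "continuous_on U (\<lambda>x. structure_coeff x i j k)"
    if "i \<in> Basis" "j \<in> Basis" "k \<in> Basis" for i j k
    using times_cont_diff_on_SucD[of 0] structure_coeff_C1[OF that] by simp
  have \<tau>: "continuous_on U (\<lambda>x. structure_trace x i)" if "i \<in> Basis" for i
    using times_cont_diff_on_SucD[of 0] structure_trace_C1[OF that] by simp
  have D: "continuous_on U (\<lambda>x. dd (\<lambda>y. structure_trace y i) x (E i x))" if i: "i \<in> Basis" for i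
  proof -
    have "times_cont_diff_on 0 U (\<lambda>x. dd (\<lambda>y. structure_trace y i) x (E i x))"
    proof (rule times_cont_diff_on_linear_family[OF open_U,
          where L = "dd (\<lambda>y. structure_trace y i)"])
      show "linear (dd (\<lambda>y. structure_trace y i) x)" if "x \<in> U" for x
        using times_cont_diff_on_differentiable[OF structure_trace_C1[OF i] _ that]
        by (intro dd_linear) simp
      show "times_cont_diff_on 0 U (\<lambda>x. dd (\<lambda>y. structure_trace y i) x v)" for v
        using structure_trace_C1[OF i] times_cont_diff_on_Suc_directional unfolding One_nat_def by blast
      show "times_cont_diff_on 0 U (E i)"
        using times_cont_diff_on_SucD frame_C1[OF i] unfolding One_nat_def by blast
    qed
    then show ?thesis
      by simp
  qed
  show ?thesis
    by (rule continuous_on_eq[OF _ scalar_curvature_frame[symmetric]])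
      (auto intro!: continuous_intros c \<tau> D)
qed

lemma (in riemannian_metric) scalar_curvature_continuous: "continuous_on U (scalar_curvature g)"
  using orthonormal_frame_exists orthonormal_frame.scalar_curvature_continuous_in_frame by blast

section \<open>Scalar curvature of the invariant metrics\<close>

text \<open>
  With \<open>r\<close> and \<open>\<theta>\<close> the polar coordinates of \<open>fst x\<close> and \<open>w = snd x\<close>, this is \<open>dr\<close>, and the next form is
  \<open>d\<theta> + Im (cnj w dw) / (1 + \<bar>w\<bar>\<^sup>2)\<close>, the connection form of the Hopf bundle, which sends the
  generator of the fibre rotation to 1.
\<close>

definition radial_part :: "complex2 \<Rightarrow> complex2 \<Rightarrow> real" where
  "radial_part x a = (fst x \<bullet> fst a) / norm (fst x)"

definition connection_form :: "complex2 \<Rightarrow> complex2 \<Rightarrow> real" where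
  "connection_form x a =
     Im (cnj (fst x) * fst a) / (norm (fst x))\<^sup>2 + Im (cnj (snd x) * snd a) / (1 + (norm (snd x))\<^sup>2)"

text \<open>
  The last summand is \<open>H\<^sup>2\<close> times the Fubini-Study metric of the base, a sphere of radius \<open>1/2\<close>.
\<close>

definition bundle_metric :: "(real \<Rightarrow> real) \<Rightarrow> (real \<Rightarrow> real) \<Rightarrow> complex2 \<Rightarrow> complex2 \<Rightarrow> complex2 \<Rightarrow> real" where
  "bundle_metric F H x a b =
     radial_part x a * radial_part x b
     + (F (norm (fst x)))\<^sup>2 * (connection_form x a * connection_form x b)
     + (H (norm (fst x)))\<^sup>2 * ((snd a \<bullet> snd b) / (1 + (norm (snd x))\<^sup>2)\<^sup>2)"

definition punctured_dom :: "real \<Rightarrow> complex2 set" where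
  "punctured_dom \<beta> = {x. fst x \<noteq> 0 \<and> norm (fst x) < \<beta>}"

lemma open_punctured_dom: "open (punctured_dom \<beta>)"
proof -
  have "punctured_dom \<beta> = fst -` (- {0} \<inter> {v. norm v < \<beta>})"
    by (auto simp: punctured_dom_def)
  moreover have "open (fst -` (- {0} \<inter> {v::complex. norm v < \<beta>}) :: complex2 set)"
    by (intro continuous_open_vimage continuous_intros open_Int open_Collect_less open_Compl closed_singleton)
  ultimately show ?thesis
    by simp
qed

lemma Basis_complex2: "(Basis :: complex2 set) = {(1, 0), (\<i>, 0), (0, 1), (0, \<i>)}"
  by (auto simp: Basis_prod_def Basis_complex_def)

lemma basis_distinct:
  "(1::complex, 0::complex) \<noteq> (\<i>, 0)" "(1::complex, 0::complex) \<noteq> (0, 1)" "(1::complex, 0::complex) \<noteq> (0, \<i>)"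
  "(\<i>, 0::complex) \<noteq> (0, 1)" "(\<i>, 0::complex) \<noteq> (0, \<i>)" "(0::complex, 1::complex) \<noteq> (0, \<i>)"
  by (auto simp: complex_eq_iff)

lemma sum_Basis_complex2:
  "(\<Sum>i\<in>(Basis :: complex2 set). \<phi> i) = \<phi> (1, 0) + \<phi> (\<i>, 0) + \<phi> (0, 1) + (\<phi> (0, \<i>) :: 'b::comm_monoid_add)"
  using basis_distinct by (simp add: Basis_complex2 add.assoc)

text \<open>
  The Euler field of \<open>v\<close>, the rotation of the fibre, and the horizontal lifts of the two coordinate
  fields of the base multiplied by \<open>1 + \<bar>w\<bar>\<^sup>2\<close>.  This choice makes all components polynomial.
  The lifts correspond to the fields \<open>Y\<close> and \<open>Z\<close> only up to a rotation that depends on the point; in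
  return, the phase of \<open>v\<close> does not enter their brackets.
\<close>

definition unscaled_frame :: "complex2 \<Rightarrow> complex2 \<Rightarrow> complex2" where
  "unscaled_frame i x =
    (if i = (1, 0) then (fst x, 0)
     else if i = (\<i>, 0) then (\<i> * fst x, 0)
     else if i = (0, 1) then (\<i> * fst x * Im (snd x), of_real (1 + (norm (snd x))\<^sup>2))
     else (- \<i> * fst x * Re (snd x), \<i> * of_real (1 + (norm (snd x))\<^sup>2)))"

lemma unscaled_frame_simps:
  "unscaled_frame (1, 0) x = (fst x, 0)"
  "unscaled_frame (\<i>, 0) x = (\<i> * fst x, 0)"
  "unscaled_frame (0, 1) x = (\<i> * fst x * Im (snd x), of_real (1 + (norm (snd x))\<^sup>2))"
  "unscaled_frame (0, \<i>) x = (- \<i> * fst x * Re (snd x), \<i> * of_real (1 + (norm (snd x))\<^sup>2))"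
  using basis_distinct basis_distinct[symmetric] by (simp_all add: unscaled_frame_def)

definition unscaled_frame_derivative :: "complex2 \<Rightarrow> complex2 \<Rightarrow> complex2 \<Rightarrow> complex2" where
  "unscaled_frame_derivative i x a =
    (if i = (1, 0) then (fst a, 0)
     else if i = (\<i>, 0) then (\<i> * fst a, 0)
     else if i = (0, 1) then
       (\<i> * (fst a * Im (snd x) + fst x * Im (snd a)), of_real (2 * (snd x \<bullet> snd a)))
     else (- \<i> * (fst a * Re (snd x) + fst x * Re (snd a)), \<i> * of_real (2 * (snd x \<bullet> snd a))))"

lemma unscaled_frame_derivative_simps:
  "unscaled_frame_derivative (1, 0) x a = (fst a, 0)"
  "unscaled_frame_derivative (\<i>, 0) x a = (\<i> * fst a, 0)"
  "unscaled_frame_derivative (0, 1) x a =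
    (\<i> * (fst a * Im (snd x) + fst x * Im (snd a)), of_real (2 * (snd x \<bullet> snd a)))"
  "unscaled_frame_derivative (0, \<i>) x a =
    (- \<i> * (fst a * Re (snd x) + fst x * Re (snd a)), \<i> * of_real (2 * (snd x \<bullet> snd a)))"
  using basis_distinct basis_distinct[symmetric] by (simp_all add: unscaled_frame_derivative_def)

lemma unscaled_frame_has_derivative:
  assumes "i \<in> Basis"
  shows "(unscaled_frame i has_derivative unscaled_frame_derivative i x) (at x)"
proof -
  have n: "((\<lambda>x::complex2. complex_of_real ((norm (snd x))\<^sup>2)) has_derivative
      (\<lambda>a. of_real (2 * (snd x \<bullet> snd a)))) (at x)"
    unfolding power2_norm_eq_inner
    by (auto intro!: derivative_eq_intros simp: inner_commute)
  have Re: "((\<lambda>x::complex2. complex_of_real (Re (snd x))) has_derivative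
      (\<lambda>a. of_real (Re (snd a)))) (at x)"
    and Im: "((\<lambda>x::complex2. complex_of_real (Im (snd x))) has_derivative
      (\<lambda>a. of_real (Im (snd a)))) (at x)"
    by (auto intro!: derivative_eq_intros)
  have 0: "((\<lambda>x::complex2. (fst x, 0::complex)) has_derivative (\<lambda>a. (fst a, 0))) (at x)"
    and 1: "((\<lambda>x::complex2. (\<i> * fst x, 0::complex)) has_derivative (\<lambda>a. (\<i> * fst a, 0))) (at x)"
    by (auto intro!: derivative_eq_intros)
  have 2: "((\<lambda>x. (\<i> * fst x * of_real (Im (snd x)), of_real (1 + (norm (snd x))\<^sup>2))) has_derivative
      (\<lambda>a. (\<i> * (fst a * of_real (Im (snd x)) + fst x * of_real (Im (snd a))),
        of_real (2 * (snd x \<bullet> snd a)) :: complex))) (at x)"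
  proof (intro has_derivative_Pair)
    show "((\<lambda>x. \<i> * fst x * complex_of_real (Im (snd x))) has_derivative
        (\<lambda>a. \<i> * (fst a * of_real (Im (snd x)) + fst x * of_real (Im (snd a))))) (at x)"
      by (auto intro!: derivative_eq_intros Im simp: algebra_simps)
    show "((\<lambda>x. complex_of_real (1 + (norm (snd x))\<^sup>2)) has_derivative
        (\<lambda>a. of_real (2 * (snd x \<bullet> snd a)))) (at x)"
      using has_derivative_add[OF has_derivative_const[of 1] n] by simp
  qed
  have 3: "((\<lambda>x. (- \<i> * fst x * of_real (Re (snd x)), \<i> * of_real (1 + (norm (snd x))\<^sup>2))) has_derivative
      (\<lambda>a. (- \<i> * (fst a * of_real (Re (snd x)) + fst x * of_real (Re (snd a))),
        \<i> * of_real (2 * (snd x \<bullet> snd a)) :: complex))) (at x)"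
  proof (intro has_derivative_Pair)
    show "((\<lambda>x. - \<i> * fst x * complex_of_real (Re (snd x))) has_derivative
        (\<lambda>a. - \<i> * (fst a * of_real (Re (snd x)) + fst x * of_real (Re (snd a))))) (at x)"
      by (auto intro!: derivative_eq_intros Re simp: algebra_simps)
    show "((\<lambda>x. \<i> * complex_of_real (1 + (norm (snd x))\<^sup>2)) has_derivative
        (\<lambda>a. \<i> * of_real (2 * (snd x \<bullet> snd a)))) (at x)"
      using has_derivative_mult_right[OF has_derivative_add[OF has_derivative_const[of 1] n], of \<i>]
      by simp
  qed
  show ?thesis
    using assms 0 1 2 3 unfolding Basis_complex2
    by (elim insertE emptyE) (simp_all only: unscaled_frame_simps[abs_def]
        unscaled_frame_derivative_simps[abs_def])
qed

lemma unscaled_frame_times_cont_diff_on: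
  assumes "open U" "i \<in> Basis"
  shows "times_cont_diff_on k U (unscaled_frame i)"
proof -
  have lin: "bounded_linear (\<lambda>x::complex2. Re (snd x))" "bounded_linear (\<lambda>x::complex2. Im (snd x))"
    "bounded_linear (\<lambda>x::complex2. (fst x, 0::complex))"
    "bounded_linear (\<lambda>x::complex2. (\<i> * fst x, 0::complex))"
    "bounded_linear (\<lambda>x::complex2. (- \<i> * fst x, 0::complex))"
    unfolding linear_conv_bounded_linear[symmetric]
    by (auto intro!: linearI simp: algebra_simps)
  note C = lin[THEN times_cont_diff_on_bounded_linear, OF assms(1)]
  have n: "times_cont_diff_on k U
      (\<lambda>x::complex2. 1 + (Re (snd x) * Re (snd x) + Im (snd x) * Im (snd x)))"
    by (intro times_cont_diff_on_add times_cont_diff_on_mult times_cont_diff_on_const C assms(1))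
  have P: "unscaled_frame (0, 1) = (\<lambda>x. Im (snd x) *\<^sub>R (\<i> * fst x, 0)
      + (1 + (Re (snd x) * Re (snd x) + Im (snd x) * Im (snd x))) *\<^sub>R (0, 1))"
    by (rule ext) (simp add: unscaled_frame_simps prod_eq_iff scaleR_conv_of_real cmod_power2
        flip: power2_eq_square)
  have Q: "unscaled_frame (0, \<i>) = (\<lambda>x. Re (snd x) *\<^sub>R (- \<i> * fst x, 0)
      + (1 + (Re (snd x) * Re (snd x) + Im (snd x) * Im (snd x))) *\<^sub>R (0, \<i>))"
    by (rule ext) (simp add: unscaled_frame_simps prod_eq_iff scaleR_conv_of_real cmod_power2
        mult.commute flip: power2_eq_square)
  have "times_cont_diff_on k U (unscaled_frame (1, 0))" "times_cont_diff_on k U (unscaled_frame (\<i>, 0))"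
    unfolding unscaled_frame_simps[abs_def] by (rule C)+
  moreover have "times_cont_diff_on k U (unscaled_frame (0, 1))"
    "times_cont_diff_on k U (unscaled_frame (0, \<i>))"
    unfolding P Q
    by (intro times_cont_diff_on_add times_cont_diff_on_scaleR times_cont_diff_on_const C n assms(1))+
  ultimately show ?thesis
    using assms(2) unfolding Basis_complex2 by blast
qed

lemma radial_function_has_derivative:
  assumes "fst x \<noteq> 0" "(\<psi> has_real_derivative \<psi>') (at (norm (fst x)))"
  shows "((\<lambda>y. \<psi> (norm (fst y))) has_derivative (\<lambda>a. radial_part x a * \<psi>')) (at x)"
proof -
  have "(norm has_derivative (\<lambda>u. u \<bullet> sgn (fst x))) (at (fst x))"
    using assms(1) by (rule has_derivative_norm)
  from has_derivative_compose[OF bounded_linear_imp_has_derivative[OF bounded_linear_fst] this]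
  have "((\<lambda>y. norm (fst y)) has_derivative radial_part x) (at x)"
    by (simp add: radial_part_def[abs_def] sgn_div_norm inner_commute divide_inverse_commute)
  from has_derivative_compose[OF this assms(2)[unfolded has_field_derivative_def]]
  show ?thesis
    by (simp add: mult.commute)
qed

text \<open>
  The derivatives of the profiles are parameters, so that the curvature formula can be stated with
  whatever closed forms are known for them.
\<close>

locale bundle_metric_profile =
  fixes \<beta> :: real and F F1 F2 H H1 H2 :: "real \<Rightarrow> real" and g
  assumes F_pos: "\<And>r. r \<in> {0<..<\<beta>} \<Longrightarrow> 0 < F r" and H_pos: "\<And>r. r \<in> {0<..<\<beta>} \<Longrightarrow> 0 < H r"
    and F1: "\<And>r. r \<in> {0<..<\<beta>} \<Longrightarrow> (F has_real_derivative F1 r) (at r)"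
    and F2: "\<And>r. r \<in> {0<..<\<beta>} \<Longrightarrow> (F1 has_real_derivative F2 r) (at r)"
    and H1: "\<And>r. r \<in> {0<..<\<beta>} \<Longrightarrow> (H has_real_derivative H1 r) (at r)"
    and H2: "\<And>r. r \<in> {0<..<\<beta>} \<Longrightarrow> (H1 has_real_derivative H2 r) (at r)"
    and F2_cont: "continuous_on {0<..<\<beta>} F2" and H2_cont: "continuous_on {0<..<\<beta>} H2"
    and metric_g: "riemannian_metric_on (punctured_dom \<beta>) g"
    and g_eq: "\<And>x a b. x \<in> punctured_dom \<beta> \<Longrightarrow> g x a b = bundle_metric F H x a b"
begin

definition scaling :: "complex2 \<Rightarrow> real \<Rightarrow> real" where
  "scaling i r = (if i = (1, 0) then inverse r else if i = (\<i>, 0) then inverse (F r) else inverse (H r))"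

definition scaling_derivative :: "complex2 \<Rightarrow> real \<Rightarrow> real" where
  "scaling_derivative i r = (if i = (1, 0) then - inverse (r\<^sup>2)
    else if i = (\<i>, 0) then - F1 r * inverse ((F r)\<^sup>2) else - H1 r * inverse ((H r)\<^sup>2))"

definition frame :: "complex2 \<Rightarrow> complex2 \<Rightarrow> complex2" where
  "frame i x = scaling i (norm (fst x)) *\<^sub>R unscaled_frame i x"

lemma scaling_simps [simp]:
  "scaling (1, 0) r = inverse r" "scaling (\<i>, 0) r = inverse (F r)"
  "scaling (0, 1) r = inverse (H r)" "scaling (0, \<i>) r = inverse (H r)"
  "scaling_derivative (1, 0) r = - inverse (r\<^sup>2)"
  "scaling_derivative (\<i>, 0) r = - F1 r * inverse ((F r)\<^sup>2)"
  "scaling_derivative (0, 1) r = - H1 r * inverse ((H r)\<^sup>2)"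
  "scaling_derivative (0, \<i>) r = - H1 r * inverse ((H r)\<^sup>2)"
  using basis_distinct basis_distinct[symmetric]
  by (simp_all add: scaling_def scaling_derivative_def)

lemma norm_fst_times_cont_diff_on: "times_cont_diff_on k (punctured_dom \<beta>) (\<lambda>x. norm (fst x))"
proof -
  have "times_cont_diff_on k (punctured_dom \<beta>)
      (\<lambda>x. sqrt (Re (fst x) * Re (fst x) + Im (fst x) * Im (fst x)))"
  proof (intro times_cont_diff_on_sqrt times_cont_diff_on_add times_cont_diff_on_mult
      times_cont_diff_on_bounded_linear open_punctured_dom bounded_linear_compose[OF bounded_linear_Re]
      bounded_linear_compose[OF bounded_linear_Im] bounded_linear_fst)
    show "0 < Re (fst x) * Re (fst x) + Im (fst x) * Im (fst x)" if "x \<in> punctured_dom \<beta>" for x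
      using that by (simp add: punctured_dom_def complex_eq_iff sum_squares_gt_zero_iff)
  qed
  then show ?thesis
    by (simp add: cmod_def power2_eq_square)
qed

lemma profile_C2: "times_cont_diff_on 2 {0<..<\<beta>} F" "times_cont_diff_on 2 {0<..<\<beta>} H"
  unfolding numeral_2_eq_2
  by (rule times_cont_diff_on_real_SucI[OF open_greaterThanLessThan F1]
      times_cont_diff_on_real_SucI[OF open_greaterThanLessThan F2]
      times_cont_diff_on_real_SucI[OF open_greaterThanLessThan H1]
      times_cont_diff_on_real_SucI[OF open_greaterThanLessThan H2] | assumption
      | simp add: F2_cont H2_cont)+

lemma scaling_C2: "times_cont_diff_on 2 {0<..<\<beta>} (scaling i)"
proof -
  have "times_cont_diff_on 2 {0<..<\<beta>} (inverse :: real \<Rightarrow> real)"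
    by (rule times_cont_diff_on_subset[OF times_cont_diff_on_inverse_ident]) auto
  moreover have "times_cont_diff_on 2 {0<..<\<beta>} (\<lambda>r. inverse (F r))"
    "times_cont_diff_on 2 {0<..<\<beta>} (\<lambda>r. inverse (H r))"
    by (intro times_cont_diff_on_inverse profile_C2 F_pos H_pos open_greaterThanLessThan; assumption)+
  ultimately show ?thesis
    unfolding scaling_def[abs_def]
    by (cases "i = (1, 0)"; cases "i = (\<i>, 0)") (simp_all del: times_cont_diff_on.simps)
qed

lemma frame_C2: "i \<in> Basis \<Longrightarrow> times_cont_diff_on 2 (punctured_dom \<beta>) (frame i)"
  unfolding frame_def
  by (intro times_cont_diff_on_scaleR open_punctured_dom unscaled_frame_times_cont_diff_on
      times_cont_diff_on_compose_real[OF _ _ scaling_C2] norm_fst_times_cont_diff_on) (auto simp: punctured_dom_def)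

lemma frame_parts:
  assumes "x \<in> punctured_dom \<beta>"
  shows "radial_part x (unscaled_frame (1, 0) x) = norm (fst x)"
    "connection_form x (unscaled_frame (1, 0) x) = 0"
    "radial_part x (unscaled_frame (\<i>, 0) x) = 0"
    "connection_form x (unscaled_frame (\<i>, 0) x) = 1"
    "radial_part x (unscaled_frame (0, 1) x) = 0"
    "connection_form x (unscaled_frame (0, 1) x) = 0"
    "radial_part x (unscaled_frame (0, \<i>) x) = 0"
    "connection_form x (unscaled_frame (0, \<i>) x) = 0"
proof -
  obtain a b c d where x: "x = (Complex a b, Complex c d)"
    by (metis complex.exhaust surj_pair)
  have nz: "a\<^sup>2 + b\<^sup>2 \<noteq> 0" and nz': "1 + (c\<^sup>2 + d\<^sup>2) \<noteq> 0"
    using assms by (auto simp: x punctured_dom_def complex_eq_iff sum_power2_eq_zero_iff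
        add_nonneg_eq_0_iff)
  have r: "sqrt (a\<^sup>2 + b\<^sup>2) * sqrt (a\<^sup>2 + b\<^sup>2) = a * a + b * b"
    by (simp add: power2_eq_square)
  show "radial_part x (unscaled_frame (1, 0) x) = norm (fst x)"
    "connection_form x (unscaled_frame (1, 0) x) = 0"
    "radial_part x (unscaled_frame (\<i>, 0) x) = 0"
    "connection_form x (unscaled_frame (\<i>, 0) x) = 1"
    "radial_part x (unscaled_frame (0, 1) x) = 0"
    "connection_form x (unscaled_frame (0, 1) x) = 0"
    "radial_part x (unscaled_frame (0, \<i>) x) = 0"
    "connection_form x (unscaled_frame (0, \<i>) x) = 0"
    using nz nz' r
    by (simp_all add: x unscaled_frame_simps radial_part_def connection_form_def inner_complex_def
        cmod_def power2_eq_square field_simps)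
qed

lemma frame_base_parts:
  "snd (unscaled_frame (1, 0) x) = 0" "snd (unscaled_frame (\<i>, 0) x) = 0"
  "snd (unscaled_frame (0, 1) x) \<bullet> snd (unscaled_frame (0, 1) x) = (1 + (norm (snd x))\<^sup>2)\<^sup>2"
  "snd (unscaled_frame (0, \<i>) x) \<bullet> snd (unscaled_frame (0, \<i>) x) = (1 + (norm (snd x))\<^sup>2)\<^sup>2"
  "snd (unscaled_frame (0, 1) x) \<bullet> snd (unscaled_frame (0, \<i>) x) = 0"
  "snd (unscaled_frame (0, \<i>) x) \<bullet> snd (unscaled_frame (0, 1) x) = 0"
  by (simp_all add: unscaled_frame_simps inner_complex_def power2_eq_square flip: of_real_power)

lemma bundle_frame_orthonormal:
  assumes x: "x \<in> punctured_dom \<beta>" and "i \<in> Basis" "j \<in> Basis"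
  shows "g x (frame i x) (frame j x) = (if i = j then 1 else 0)"
proof -
  have r: "norm (fst x) \<in> {0<..<\<beta>}"
    using x by (auto simp: punctured_dom_def)
  have pos: "0 < norm (fst x)" "0 < F (norm (fst x))" "0 < H (norm (fst x))"
    using r F_pos[OF r] H_pos[OF r] by auto
  have s: "1 + (norm (snd x))\<^sup>2 \<noteq> 0"
    using zero_le_power2[of "norm (snd x)"] by linarith
  have bil: "bilinear (g x)"
    using metric_g x by (simp add: riemannian_metric_on_def)
  have lin: "g x (p *\<^sub>R u) (q *\<^sub>R v) = p * q * g x u v" for p q u v
    by (simp add: bilinear_lmul[OF bil] bilinear_rmul[OF bil])
  have un: "g x (unscaled_frame i x) (unscaled_frame j x) =
      (if i = j then inverse ((scaling i (norm (fst x)))\<^sup>2) else 0)"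
    using assms(2,3) pos s basis_distinct basis_distinct[symmetric]
    unfolding Basis_complex2 g_eq[OF x] bundle_metric_def
    by (elim insertE emptyE)
      (simp_all only: frame_parts[OF x] frame_base_parts scaling_simps, simp_all add: power2_eq_square)
  show ?thesis
    using assms(2) pos unfolding frame_def lin un
    by (auto simp: Basis_complex2 power2_eq_square field_simps)
qed

sublocale orthonormal_frame "punctured_dom \<beta>" g frame
  by unfold_locales
    (rule open_punctured_dom metric_g frame_C2 bundle_frame_orthonormal; assumption)+


lemma frame_has_derivative:
  assumes x: "x \<in> punctured_dom \<beta>" and i: "i \<in> Basis"
  shows "(frame i has_derivative
    (\<lambda>a. scaling i (norm (fst x)) *\<^sub>R unscaled_frame_derivative i x a
      + (radial_part x a * scaling_derivative i (norm (fst x))) *\<^sub>R unscaled_frame i x)) (at x)"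
proof -
  let ?r = "norm (fst x)"
  have r: "?r \<in> {0<..<\<beta>}" and nz: "fst x \<noteq> 0"
    using x by (auto simp: punctured_dom_def)
  have s: "(scaling i has_real_derivative scaling_derivative i ?r) (at ?r)"
  proof -
    have "(inverse has_real_derivative - inverse (?r\<^sup>2)) (at ?r)"
      using nz by (auto intro!: derivative_eq_intros simp: power2_eq_square)
    moreover have "((\<lambda>r. inverse (F r)) has_real_derivative - F1 ?r * inverse ((F ?r)\<^sup>2)) (at ?r)"
      using F_pos[OF r] by (auto intro!: derivative_eq_intros F1[OF r] simp: power2_eq_square)
    moreover have "((\<lambda>r. inverse (H r)) has_real_derivative - H1 ?r * inverse ((H ?r)\<^sup>2)) (at ?r)"
      using H_pos[OF r] by (auto intro!: derivative_eq_intros H1[OF r] simp: power2_eq_square)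
    ultimately show ?thesis
      unfolding scaling_def[abs_def] scaling_derivative_def
      by (cases "i = (1, 0)"; cases "i = (\<i>, 0)") simp_all
  qed
  from has_derivative_scaleR[OF radial_function_has_derivative[OF nz s]
      unscaled_frame_has_derivative[OF i]]
 show ?thesis
    by (simp add: frame_def[abs_def])
qed

lemma frame_bracket:
  assumes x: "x \<in> punctured_dom \<beta>" and i: "i \<in> Basis" and j: "j \<in> Basis"
  defines "r \<equiv> norm (fst x)"
  shows "lie_bracket (frame i) (frame j) x =
    (scaling i r * scaling j r) *\<^sub>R (unscaled_frame_derivative j x (unscaled_frame i x)
       - unscaled_frame_derivative i x (unscaled_frame j x))
    + (scaling i r * radial_part x (unscaled_frame i x) * scaling_derivative j r) *\<^sub>R unscaled_frame j x
    - (scaling j r * radial_part x (unscaled_frame j x) * scaling_derivative i r) *\<^sub>R unscaled_frame i x"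
proof -
  have lin: "unscaled_frame_derivative k x (p *\<^sub>R a) = p *\<^sub>R unscaled_frame_derivative k x a"
    if "k \<in> Basis" for k p a
    using has_derivative_linear[OF unscaled_frame_has_derivative[OF that]] by (rule linear_scale)
  have rad: "radial_part x (p *\<^sub>R a) = p * radial_part x a" for p a
    by (simp add: radial_part_def)
  show ?thesis
    unfolding lie_bracket_def dd_eq[OF frame_has_derivative[OF x i]]
      dd_eq[OF frame_has_derivative[OF x j]]
    by (simp add: frame_def lin i j rad r_def algebra_simps)
qed

text \<open>
  Only the bracket of the two horizontal fields is not read off from homogeneity and invariance: its
  vertical part is the curvature of the Hopf bundle, and its horizontal part comes from the factor
  \<open>1 + \<bar>w\<bar>\<^sup>2\<close>.
\<close>

lemma frame_brackets:
  assumes x: "x \<in> punctured_dom \<beta>"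
  defines "r \<equiv> norm (fst x)" and "c \<equiv> Re (snd x)" and "d \<equiv> Im (snd x)"
  shows "lie_bracket (frame (1, 0)) (frame (\<i>, 0)) x = (- F1 r / F r) *\<^sub>R frame (\<i>, 0) x"
    "lie_bracket (frame (1, 0)) (frame (0, 1)) x = (- H1 r / H r) *\<^sub>R frame (0, 1) x"
    "lie_bracket (frame (1, 0)) (frame (0, \<i>)) x = (- H1 r / H r) *\<^sub>R frame (0, \<i>) x"
    "lie_bracket (frame (\<i>, 0)) (frame (0, 1)) x = 0"
    "lie_bracket (frame (\<i>, 0)) (frame (0, \<i>)) x = 0"
    "lie_bracket (frame (0, 1)) (frame (0, \<i>)) x = (- 2 * d / H r) *\<^sub>R frame (0, 1) x
      + (2 * c / H r) *\<^sub>R frame (0, \<i>) x - (2 * F r / (H r)\<^sup>2) *\<^sub>R frame (\<i>, 0) x"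
proof -
  have B: "(1, 0) \<in> (Basis :: complex2 set)" "(\<i>, 0) \<in> (Basis :: complex2 set)"
    "(0, 1) \<in> (Basis :: complex2 set)" "(0, \<i>) \<in> (Basis :: complex2 set)"
    by (simp_all add: Basis_complex2)
  have r: "r \<in> {0<..<\<beta>}"
    using x by (auto simp: r_def punctured_dom_def)
  then have pos: "r > 0" "F r > 0" "H r > 0"
    using F_pos[OF r] H_pos[OF r] by auto
  have "radial_part x (fst x, z) = r" for z
    using pos(1) by (simp add: radial_part_def r_def dot_square_norm power2_eq_square)
  moreover have "radial_part x (\<i> * fst x, z) = 0"
    "radial_part x (\<i> * (fst x * of_real t), z) = 0"
    "radial_part x (- (\<i> * (fst x * of_real t)), z) = 0"
    "radial_part x (\<i> * fst x * of_real t, z) = 0"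
    "radial_part x (- (\<i> * fst x * of_real t), z) = 0" for z t
    by (simp_all add: radial_part_def inner_complex_def algebra_simps)
  ultimately have radial: "radial_part x (fst x, z) = r" "radial_part x (\<i> * fst x, z) = 0"
    "radial_part x (\<i> * (fst x * of_real t), z) = 0"
    "radial_part x (- (\<i> * (fst x * of_real t)), z) = 0"
    "radial_part x (\<i> * fst x * of_real t, z) = 0"
    "radial_part x (- (\<i> * fst x * of_real t), z) = 0" for z t
    by blast+
  note bracket = frame_bracket[OF x, folded r_def] radial unscaled_frame_derivative_simps
  show "lie_bracket (frame (1, 0)) (frame (\<i>, 0)) x = (- F1 r / F r) *\<^sub>R frame (\<i>, 0) x"
    using pos by (simp add: bracket B frame_def unscaled_frame_simps power2_eq_square field_simps
        flip: r_def)
  show "lie_bracket (frame (1, 0)) (frame (0, 1)) x = (- H1 r / H r) *\<^sub>R frame (0, 1) x"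
    "lie_bracket (frame (1, 0)) (frame (0, \<i>)) x = (- H1 r / H r) *\<^sub>R frame (0, \<i>) x"
    using pos by (simp_all add: bracket B frame_def unscaled_frame_simps power2_eq_square field_simps
        flip: r_def)
  show "lie_bracket (frame (\<i>, 0)) (frame (0, 1)) x = 0"
    "lie_bracket (frame (\<i>, 0)) (frame (0, \<i>)) x = 0"
    by (simp_all add: bracket B frame_def unscaled_frame_simps)
  have n: "norm (snd x) * norm (snd x) = c * c + d * d"
    using cmod_power2[of "snd x"] by (simp add: c_def d_def power2_eq_square)
  have base: "unscaled_frame_derivative (0, \<i>) x (unscaled_frame (0, 1) x)
      - unscaled_frame_derivative (0, 1) x (unscaled_frame (0, \<i>) x) =
      (- 2 * d) *\<^sub>R unscaled_frame (0, 1) x + (2 * c) *\<^sub>R unscaled_frame (0, \<i>) x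
        - 2 *\<^sub>R unscaled_frame (\<i>, 0) x"
    by (simp add: unscaled_frame_simps unscaled_frame_derivative_simps prod_eq_iff complex_eq_iff
        inner_complex_def power2_eq_square n flip: c_def d_def)
      (simp add: algebra_simps)
  show "lie_bracket (frame (0, 1)) (frame (0, \<i>)) x = (- 2 * d / H r) *\<^sub>R frame (0, 1) x
      + (2 * c / H r) *\<^sub>R frame (0, \<i>) x - (2 * F r / (H r)\<^sup>2) *\<^sub>R frame (\<i>, 0) x"
    unfolding frame_bracket[OF x B(3,4), folded r_def] frame_parts[OF x, folded r_def] base
    using pos by (simp add: frame_def power2_eq_square field_simps flip: r_def)
qed


lemma frame_structure_coeffs:
  assumes x: "x \<in> punctured_dom \<beta>" and k: "k \<in> Basis"
  defines "r \<equiv> norm (fst x)" and "c \<equiv> Re (snd x)" and "d \<equiv> Im (snd x)"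
  shows "structure_coeff x (1, 0) (\<i>, 0) k = (if k = (\<i>, 0) then - F1 r / F r else 0)"
    "structure_coeff x (1, 0) (0, 1) k = (if k = (0, 1) then - H1 r / H r else 0)"
    "structure_coeff x (1, 0) (0, \<i>) k = (if k = (0, \<i>) then - H1 r / H r else 0)"
    "structure_coeff x (\<i>, 0) (0, 1) k = 0"
    "structure_coeff x (\<i>, 0) (0, \<i>) k = 0"
    "structure_coeff x (0, 1) (0, \<i>) k = (if k = (0, 1) then - 2 * d / H r
      else if k = (0, \<i>) then 2 * c / H r else if k = (\<i>, 0) then - 2 * F r / (H r)\<^sup>2 else 0)"
proof -
  have B: "(1, 0) \<in> (Basis :: complex2 set)" "(\<i>, 0) \<in> (Basis :: complex2 set)"
    "(0, 1) \<in> (Basis :: complex2 set)" "(0, \<i>) \<in> (Basis :: complex2 set)"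
    by (simp_all add: Basis_complex2)
  note on = orthonormal[OF x B(2) k] orthonormal[OF x B(3) k] orthonormal[OF x B(4) k]
  note brackets = frame_brackets[OF x, folded r_def c_def d_def]
  show "structure_coeff x (1, 0) (\<i>, 0) k = (if k = (\<i>, 0) then - F1 r / F r else 0)"
    "structure_coeff x (1, 0) (0, 1) k = (if k = (0, 1) then - H1 r / H r else 0)"
    "structure_coeff x (1, 0) (0, \<i>) k = (if k = (0, \<i>) then - H1 r / H r else 0)"
    unfolding structure_coeff_def brackets
    by (simp_all add: g_simps linear_neg[OF g_linear_left] x on)
  show "structure_coeff x (\<i>, 0) (0, 1) k = 0" "structure_coeff x (\<i>, 0) (0, \<i>) k = 0"
    unfolding structure_coeff_def brackets by (simp_all add: linear_0[OF g_linear_left[OF x]])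
  show "structure_coeff x (0, 1) (0, \<i>) k = (if k = (0, 1) then - 2 * d / H r
      else if k = (0, \<i>) then 2 * c / H r else if k = (\<i>, 0) then - 2 * F r / (H r)\<^sup>2 else 0)"
    unfolding structure_coeff_def brackets
    using basis_distinct basis_distinct[symmetric] by (auto simp: g_simps x on)
qed

lemma frame_structure_coeffs_antisym:
  assumes x: "x \<in> punctured_dom \<beta>"
  shows "structure_coeff x i i k = 0"
    "structure_coeff x (\<i>, 0) (1, 0) k = - structure_coeff x (1, 0) (\<i>, 0) k"
    "structure_coeff x (0, 1) (1, 0) k = - structure_coeff x (1, 0) (0, 1) k"
    "structure_coeff x (0, \<i>) (1, 0) k = - structure_coeff x (1, 0) (0, \<i>) k"
    "structure_coeff x (0, 1) (\<i>, 0) k = - structure_coeff x (\<i>, 0) (0, 1) k"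
    "structure_coeff x (0, \<i>) (\<i>, 0) k = - structure_coeff x (\<i>, 0) (0, \<i>) k"
    "structure_coeff x (0, \<i>) (0, 1) k = - structure_coeff x (0, 1) (0, \<i>) k"
proof -
  show "structure_coeff x i i k = 0"
    using structure_coeff_antisym[OF x, of i i k] by simp
qed (rule structure_coeff_antisym[OF x])+

lemma frame_structure_trace:
  assumes x: "x \<in> punctured_dom \<beta>"
  defines "r \<equiv> norm (fst x)"
  shows "structure_trace x (1, 0) = - F1 r / F r - 2 * H1 r / H r"
    "structure_trace x (\<i>, 0) = 0"
    "structure_trace x (0, 1) = 2 * Re (snd x) / H r"
    "structure_trace x (0, \<i>) = 2 * Im (snd x) / H r"
  unfolding structure_trace_def sum_Basis_complex2 r_def
  using basis_distinct basis_distinct[symmetric]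
  by (simp_all add: frame_structure_coeffs[OF x] frame_structure_coeffs_antisym[OF x] Basis_complex2)

text \<open>
  The terms that depend on the base point \<open>w\<close> cancel, as they must, since the metric is homogeneous
  along each orbit.
\<close>

theorem scalar_curvature_bundle_metric:
  assumes x: "x \<in> punctured_dom \<beta>"
  defines "r \<equiv> norm (fst x)"
  shows "scalar_curvature g x = - 2 * F2 r / F r - 4 * H2 r / H r - 2 * (H1 r)\<^sup>2 / (H r)\<^sup>2
    - 4 * F1 r * H1 r / (F r * H r) + 8 / (H r)\<^sup>2 - 2 * (F r)\<^sup>2 / (H r) ^ 4"
proof -
  let ?c = "Re (snd x)" and ?d = "Im (snd x)"
  have r: "r \<in> {0<..<\<beta>}" and nz: "fst x \<noteq> 0"
    using x by (auto simp: r_def punctured_dom_def)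
  then have pos: "r > 0" "F r > 0" "H r > 0"
    using F_pos[OF r] H_pos[OF r] by auto
  have rad: "radial_part x (p *\<^sub>R a) = p * radial_part x a" for p a
    by (simp add: radial_part_def)
  have D0: "dd (\<lambda>y. structure_trace y (1, 0)) x (frame (1, 0) x) =
      - (F2 r * F r - (F1 r)\<^sup>2) / (F r)\<^sup>2 - 2 * (H2 r * H r - (H1 r)\<^sup>2) / (H r)\<^sup>2"
  proof -
    have "((\<lambda>r. - F1 r / F r - 2 * H1 r / H r) has_real_derivative
        - (F2 r * F r - (F1 r)\<^sup>2) / (F r)\<^sup>2 - 2 * (H2 r * H r - (H1 r)\<^sup>2) / (H r)\<^sup>2) (at r)"
      using pos by (auto intro!: derivative_eq_intros F1[OF r] F2[OF r] H1[OF r] H2[OF r]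
          simp: power2_eq_square field_simps)
    from radial_function_has_derivative[OF nz this[unfolded r_def], folded r_def]
    have "((\<lambda>y. structure_trace y (1, 0)) has_derivative (\<lambda>a. radial_part x a *
        (- (F2 r * F r - (F1 r)\<^sup>2) / (F r)\<^sup>2 - 2 * (H2 r * H r - (H1 r)\<^sup>2) / (H r)\<^sup>2))) (at x)"
      by (rule has_derivative_transform_within_open[OF _ open_U x]) (simp add: frame_structure_trace)
    from dd_eq[OF this, of "frame (1, 0) x"] show ?thesis
      using pos(1) by (simp add: frame_def rad frame_parts[OF x] flip: r_def)
  qed
  have D1: "dd (\<lambda>y. structure_trace y (\<i>, 0)) x a = 0" for a
    by (rule dd_eq[OF has_derivative_transform_within_open[OF has_derivative_const open_U x]])
      (simp add: frame_structure_trace)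
  have iH: "((\<lambda>r. inverse (H r)) has_real_derivative - H1 r * inverse ((H r)\<^sup>2)) (at r)"
    using pos by (auto intro!: derivative_eq_intros H1[OF r] simp: power2_eq_square)
  note iH' = radial_function_has_derivative[OF nz iH[unfolded r_def], folded r_def]
  have D23: "dd (\<lambda>y. structure_trace y (0, 1)) x (frame (0, 1) x) = 2 * (1 + (norm (snd x))\<^sup>2) / (H r)\<^sup>2"
    "dd (\<lambda>y. structure_trace y (0, \<i>)) x (frame (0, \<i>) x) = 2 * (1 + (norm (snd x))\<^sup>2) / (H r)\<^sup>2"
  proof -
    have "((\<lambda>y. 2 * Re (snd y) * inverse (H (norm (fst y)))) has_derivative
        (\<lambda>a. 2 * ?c * (radial_part x a * (- H1 r * inverse ((H r)\<^sup>2)))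
          + 2 * Re (snd a) * inverse (H r))) (at x)"
      unfolding r_def by (rule has_derivative_mult[OF _ iH'[unfolded r_def]])
        (auto intro!: derivative_eq_intros)
    then have "((\<lambda>y. structure_trace y (0, 1)) has_derivative
        (\<lambda>a. 2 * ?c * (radial_part x a * (- H1 r * inverse ((H r)\<^sup>2)))
          + 2 * Re (snd a) * inverse (H r))) (at x)"
      by (rule has_derivative_transform_within_open[OF _ open_U x])
        (simp add: frame_structure_trace divide_inverse)
    from dd_eq[OF this, of "frame (0, 1) x"]
    show "dd (\<lambda>y. structure_trace y (0, 1)) x (frame (0, 1) x) = 2 * (1 + (norm (snd x))\<^sup>2) / (H r)\<^sup>2"
      by (simp add: frame_def rad frame_parts[OF x], simp add: unscaled_frame_simps r_def
          power2_eq_square divide_inverse)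
    have "((\<lambda>y. 2 * Im (snd y) * inverse (H (norm (fst y)))) has_derivative
        (\<lambda>a. 2 * ?d * (radial_part x a * (- H1 r * inverse ((H r)\<^sup>2)))
          + 2 * Im (snd a) * inverse (H r))) (at x)"
      unfolding r_def by (rule has_derivative_mult[OF _ iH'[unfolded r_def]])
        (auto intro!: derivative_eq_intros)
    then have "((\<lambda>y. structure_trace y (0, \<i>)) has_derivative
        (\<lambda>a. 2 * ?d * (radial_part x a * (- H1 r * inverse ((H r)\<^sup>2)))
          + 2 * Im (snd a) * inverse (H r))) (at x)"
      by (rule has_derivative_transform_within_open[OF _ open_U x])
        (simp add: frame_structure_trace divide_inverse)
    from dd_eq[OF this, of "frame (0, \<i>) x"]
    show "dd (\<lambda>y. structure_trace y (0, \<i>)) x (frame (0, \<i>) x) = 2 * (1 + (norm (snd x))\<^sup>2) / (H r)\<^sup>2"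
      by (simp add: frame_def rad frame_parts[OF x], simp add: unscaled_frame_simps r_def
          power2_eq_square divide_inverse)
  qed
  have n: "(norm (snd x))\<^sup>2 = ?c\<^sup>2 + ?d\<^sup>2"
    by (rule cmod_power2)
  define f where "f = F1 r / F r"
  define h where "h = H1 r / H r"
  have squares: "(\<Sum>i\<in>Basis. \<Sum>j\<in>Basis. \<Sum>k\<in>Basis. (structure_coeff x i j k)\<^sup>2) =
      2 * f\<^sup>2 + 4 * h\<^sup>2 + 8 * (?c\<^sup>2 + ?d\<^sup>2) / (H r)\<^sup>2 + 8 * (F r)\<^sup>2 / (H r) ^ 4"
    unfolding sum_Basis_complex2
    using basis_distinct basis_distinct[symmetric] pos
    by (simp add: frame_structure_coeffs[OF x, folded r_def] frame_structure_coeffs_antisym[OF x]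
        Basis_complex2 f_def h_def power_divide power_mult_distrib add_divide_distrib flip: power_mult)
  have products: "(\<Sum>i\<in>Basis. \<Sum>j\<in>Basis. \<Sum>k\<in>Basis. structure_coeff x i j k * structure_coeff x i k j) =
      f\<^sup>2 + 2 * h\<^sup>2 + 4 * (?c\<^sup>2 + ?d\<^sup>2) / (H r)\<^sup>2"
    unfolding sum_Basis_complex2
    using basis_distinct basis_distinct[symmetric] pos
    by (simp add: frame_structure_coeffs[OF x, folded r_def] frame_structure_coeffs_antisym[OF x]
        Basis_complex2 f_def h_def power_divide add_divide_distrib power2_eq_square)
  have traces: "(\<Sum>i\<in>Basis. (structure_trace x i)\<^sup>2) =
      (f + 2 * h)\<^sup>2 + 4 * (?c\<^sup>2 + ?d\<^sup>2) / (H r)\<^sup>2"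
    unfolding sum_Basis_complex2 frame_structure_trace[OF x, folded r_def]
    by (simp add: f_def h_def power_divide add_divide_distrib power2_eq_square algebra_simps)
  have derivatives: "(\<Sum>i\<in>Basis. dd (\<lambda>y. structure_trace y i) x (frame i x)) =
      - F2 r / F r + f\<^sup>2 - 2 * H2 r / H r + 2 * h\<^sup>2 + 4 * (1 + (?c\<^sup>2 + ?d\<^sup>2)) / (H r)\<^sup>2"
    unfolding sum_Basis_complex2 D0 D1 D23 n
    using pos by (simp add: f_def h_def power2_eq_square field_simps)
  have fh: "4 * F1 r * H1 r / (F r * H r) = 4 * f * h" "2 * (H1 r)\<^sup>2 / (H r)\<^sup>2 = 2 * h\<^sup>2"
    by (simp_all add: f_def h_def power_divide)
  show ?thesis
    unfolding scalar_curvature_frame[OF x] squares products traces derivatives fh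
    by (simp add: power2_eq_square algebra_simps add_divide_distrib)
qed

end

section \<open>The soliton profile\<close>

locale koiso_cao =
  fixes c \<beta> :: real and h :: "real \<Rightarrow> real"
  assumes profile: "koiso_cao_profile c \<beta> h"
begin

abbreviation h1 :: "real \<Rightarrow> real" where "h1 \<equiv> deriv h"

text \<open>
  The second derivative of \<open>h\<close> as the differential equation gives it, and the derivative of this
  expression.  Being closed formulas in \<open>h\<close> and \<open>h1\<close>, they are differentiable and continuous.
\<close>

definition h2 :: "real \<Rightarrow> real" where
  "h2 t = (4 - 4 * (h1 t)\<^sup>2 - (h t)\<^sup>2 * (1 + c * (h1 t)\<^sup>2)) / (2 * h t)"

definition h3 :: "real \<Rightarrow> real" where
  "h3 t = - (5 * h1 t * h2 t + h t * h1 t * (1 + c * (h1 t)\<^sup>2) + c * (h t)\<^sup>2 * h1 t * h2 t) / h t"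

lemma \<beta>_pos: "0 < \<beta>"
  and boundary: "h 0 = sqrt 6" "h1 0 = 0" "h \<beta> = sqrt 2" "h1 \<beta> = 0"
  and h_pos: "t \<in> {0..\<beta>} \<Longrightarrow> 0 < h t"
  and h1_neg: "t \<in> {0<..<\<beta>} \<Longrightarrow> h1 t < 0"
  using profile by (auto simp: koiso_cao_profile_def)

lemma h1_nonpos: "t \<in> {0..\<beta>} \<Longrightarrow> h1 t \<le> 0"
  using h1_neg[of t] boundary(2,4) by (cases "t = 0 \<or> t = \<beta>") auto

lemma h_derivatives:
  assumes "t \<in> {0..\<beta>}"
  shows "(h has_real_derivative h1 t) (at t)" "(h1 has_real_derivative h2 t) (at t)"
proof -
  obtain a b where "a < 0" "\<beta> < b" "koiso_cao_ode c h {a<..<b}"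
    using profile by (auto simp: koiso_cao_profile_def)
  then have ode: "h differentiable (at t)" "h1 differentiable (at t)"
    "2 * h t * deriv h1 t + 4 * (h1 t)\<^sup>2 - 4 + (h t)\<^sup>2 * (1 + c * (h1 t)\<^sup>2) = 0"
    using assms by (auto simp: koiso_cao_ode_def)
  show "(h has_real_derivative h1 t) (at t)"
    using ode(1) by (simp add: DERIV_deriv_iff_real_differentiable)
  have "deriv h1 t = h2 t"
    using ode(3) h_pos[OF assms] by (simp add: h2_def field_simps)
  then show "(h1 has_real_derivative h2 t) (at t)"
    using ode(2) by (metis DERIV_deriv_iff_real_differentiable)
qed

lemma ode: "t \<in> {0..\<beta>} \<Longrightarrow> 2 * h t * h2 t = 4 - 4 * (h1 t)\<^sup>2 - (h t)\<^sup>2 * (1 + c * (h1 t)\<^sup>2)"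
  using h_pos[of t] by (simp add: h2_def)

lemma h2_derivative:
  assumes "t \<in> {0..\<beta>}"
  shows "(h2 has_real_derivative h3 t) (at t)"
  unfolding h2_def[abs_def]
proof (rule DERIV_cong)
  note d = h_derivatives[OF assms]
  show "((\<lambda>t. (4 - 4 * (h1 t)\<^sup>2 - (h t)\<^sup>2 * (1 + c * (h1 t)\<^sup>2)) / (2 * h t)) has_real_derivative
      ((- 8 * h1 t * h2 t - (2 * h t * h1 t * (1 + c * (h1 t)\<^sup>2) + 2 * c * (h t)\<^sup>2 * h1 t * h2 t)) * (2 * h t)
        - (2 * h t * h2 t) * (2 * h1 t)) / (2 * h t)\<^sup>2) (at t)"
    unfolding ode[OF assms]
    using h_pos[OF assms]
    by (auto intro!: derivative_eq_intros d simp: power2_eq_square algebra_simps)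
  show "((- 8 * h1 t * h2 t - (2 * h t * h1 t * (1 + c * (h1 t)\<^sup>2) + 2 * c * (h t)\<^sup>2 * h1 t * h2 t)) * (2 * h t)
        - (2 * h t * h2 t) * (2 * h1 t)) / (2 * h t)\<^sup>2 = h3 t"
    using h_pos[OF assms] by (simp add: h3_def power2_eq_square field_simps)
qed

lemma continuous_derivatives:
  "continuous_on {0..\<beta>} h" "continuous_on {0..\<beta>} h1" "continuous_on {0..\<beta>} h2"
  by (intro continuous_at_imp_continuous_on ballI;
      rule DERIV_isCont[OF h_derivatives(1)] DERIV_isCont[OF h_derivatives(2)]
        DERIV_isCont[OF h2_derivative]; assumption)+

lemma square_derivative:
  "t \<in> {0..\<beta>} \<Longrightarrow> ((\<lambda>t. (h t)\<^sup>2) has_real_derivative 2 * h t * h1 t) (at t)"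
  by (auto intro!: derivative_eq_intros h_derivatives)

text \<open>
  With \<open>x = h\<^sup>2\<close> and \<open>p = h'\<^sup>2\<close> this is \<open>d/dx (x\<^sup>2 e\<^bsup>cx/2\<^esup> p) = e\<^bsup>cx/2\<^esup> x (4 - x) / 2\<close>, multiplied by \<open>dx/dt\<close>.
\<close>

lemma first_integral_derivative:
  assumes t: "t \<in> {0..\<beta>}"
  shows "((\<lambda>t. (h t) ^ 4 * (h1 t)\<^sup>2 * exp (c * (h t)\<^sup>2 / 2)) has_real_derivative
    2 * h t * h1 t * ((h t)\<^sup>2 * (4 - (h t)\<^sup>2) / 2) * exp (c * (h t)\<^sup>2 / 2)) (at t)"
proof (rule DERIV_cong)
  note d = h_derivatives[OF t]
  let ?e = "exp (c * (h t)\<^sup>2 / 2)"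
  show "((\<lambda>t. (h t) ^ 4 * (h1 t)\<^sup>2 * exp (c * (h t)\<^sup>2 / 2)) has_real_derivative
     h1 t * (4 * (h t) ^ 3 * (h1 t)\<^sup>2 + (h t) ^ 3 * (2 * h t * h2 t) + (h t) ^ 4 * (h1 t)\<^sup>2 * (c * h t)) * ?e) (at t)"
    by (auto intro!: derivative_eq_intros d simp: power2_eq_square power3_eq_cube power4_eq_xxxx algebra_simps)
  show "h1 t * (4 * (h t) ^ 3 * (h1 t)\<^sup>2 + (h t) ^ 3 * (2 * h t * h2 t) + (h t) ^ 4 * (h1 t)\<^sup>2 * (c * h t)) * ?e =
      2 * h t * h1 t * ((h t)\<^sup>2 * (4 - (h t)\<^sup>2) / 2) * ?e"
    unfolding ode[OF t]
    by (simp add: power2_eq_square power3_eq_cube power4_eq_xxxx algebra_simps)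
qed

lemma h_square_boundary: "(h 0)\<^sup>2 = 6" "(h \<beta>)\<^sup>2 = 2"
  by (simp_all add: boundary)

text \<open>
  The function \<open>x (4 - x) / 2\<close> changes sign at \<open>x = 4\<close> and has negative integral over \<open>[2,6]\<close>.  If \<open>c\<close>
  were nonnegative, the weight \<open>e\<^bsup>cx/2\<^esup>\<close> would favour the negative part, and the integral with the
  weight, which is 0, would be negative as well.  The proof runs in the variable \<open>t\<close>, comparing with the
  constant weight \<open>e\<^bsup>2c\<^esup>\<close> that agrees at \<open>x = 4\<close>.
\<close>

lemma c_neg: "c < 0"
proof (rule ccontr)
  assume "\<not> c < 0"
  then have c: "c \<ge> 0"
    by simp
  define \<Psi> where "\<Psi> = (\<lambda>t. (h t) ^ 4 * (h1 t)\<^sup>2 * exp (c * (h t)\<^sup>2 / 2)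
    - exp (2 * c) * (((h t)\<^sup>2)\<^sup>2 - ((h t)\<^sup>2) ^ 3 / 6))"
  have mono: "\<exists>y. (\<Psi> has_real_derivative y) (at t) \<and> 0 \<le> y" if t: "0 \<le> t" "t \<le> \<beta>" for t
  proof (intro exI conjI)
    have t': "t \<in> {0..\<beta>}"
      using t by simp
    let ?x = "(h t)\<^sup>2"
    have "((\<lambda>x. exp (2 * c) * (x\<^sup>2 - x ^ 3 / 6)) has_real_derivative
        exp (2 * c) * (?x * (4 - ?x) / 2)) (at ?x)"
      by (auto intro!: derivative_eq_intros simp: power2_eq_square algebra_simps)
    from DERIV_chain2[OF this square_derivative[OF t']]
    have "((\<lambda>t. exp (2 * c) * (((h t)\<^sup>2)\<^sup>2 - ((h t)\<^sup>2) ^ 3 / 6)) has_real_derivative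
        2 * h t * h1 t * (?x * (4 - ?x) / 2) * exp (2 * c)) (at t)"
      by (rule DERIV_cong) simp
    from DERIV_diff[OF first_integral_derivative[OF t'] this]
    show "(\<Psi> has_real_derivative 2 * h t * h1 t * (?x * (4 - ?x) / 2) * (exp (c * ?x / 2) - exp (2 * c))) (at t)"
      by (simp add: \<Psi>_def right_diff_distrib)
    have "(4 - ?x) * (exp (c * ?x / 2) - exp (2 * c)) \<le> 0"
    proof (cases "?x \<le> 4")
      case True
      then have "c * ?x / 2 \<le> 2 * c"
        using mult_left_mono[OF True c] by simp
      then show ?thesis
        using True by (intro mult_nonneg_nonpos) auto
    next
      case False
      then have "2 * c \<le> c * ?x / 2"
        using mult_left_mono[OF _ c, of 4 ?x] by simp
      then show ?thesis
        using False by (intro mult_nonpos_nonneg) auto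
    qed
    moreover have "h t * h1 t * ?x \<le> 0"
      using h_pos[OF t'] h1_nonpos[OF t'] by (intro mult_nonpos_nonneg mult_nonneg_nonpos) auto
    ultimately have "0 \<le> (h t * h1 t * ?x) * ((4 - ?x) * (exp (c * ?x / 2) - exp (2 * c)))"
      by (simp only: mult_nonpos_nonpos)
    also have "\<dots> = 2 * h t * h1 t * (?x * (4 - ?x) / 2) * (exp (c * ?x / 2) - exp (2 * c))"
      by simp
    finally show "0 \<le> 2 * h t * h1 t * (?x * (4 - ?x) / 2) * (exp (c * ?x / 2) - exp (2 * c))" .
  qed
  have "\<Psi> 0 \<le> \<Psi> \<beta>"
    by (rule DERIV_nonneg_imp_nondecreasing[OF less_imp_le[OF \<beta>_pos] mono])
  then show False
    unfolding \<Psi>_def h_square_boundary boundary(2,4) by simp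
qed

text \<open>
  For \<open>c = -1\<close> the integrand has the primitive \<open>x\<^sup>2 e\<^bsup>-x/2\<^esup>\<close>, which increases by \<open>36 e\<^bsup>-3\<^esup> - 4 e\<^bsup>-1\<^esup> > 0\<close> from
  2 to 6.  A smaller \<open>c\<close> favours the positive part of \<open>x (4 - x) / 2\<close> still more, while the integral
  must be 0.  The factor \<open>e\<^bsup>2(c+1)\<^esup>\<close> makes the two weights agree at \<open>x = 4\<close>.
\<close>

lemma c_gt: "-1 < c"
proof (rule ccontr)
  assume "\<not> -1 < c"
  then have c: "c + 1 \<le> 0"
    by simp
  define \<Psi> where "\<Psi> = (\<lambda>t. (h t) ^ 4 * (h1 t)\<^sup>2 * exp (c * (h t)\<^sup>2 / 2)
    - exp (2 * (c + 1)) * (((h t)\<^sup>2)\<^sup>2 * exp (- (h t)\<^sup>2 / 2)))"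
  have mono: "\<exists>y. (\<Psi> has_real_derivative y) (at t) \<and> y \<le> 0" if t: "0 \<le> t" "t \<le> \<beta>" for t
  proof (intro exI conjI)
    have t': "t \<in> {0..\<beta>}"
      using t by simp
    let ?x = "(h t)\<^sup>2"
    let ?d = "exp (c * ?x / 2) - exp (2 * (c + 1)) * exp (- ?x / 2)"
    have "((\<lambda>x. exp (2 * (c + 1)) * (x\<^sup>2 * exp (- x / 2))) has_real_derivative
        exp (2 * (c + 1)) * (?x * (4 - ?x) / 2 * exp (- ?x / 2))) (at ?x)"
      by (auto intro!: derivative_eq_intros simp: power2_eq_square algebra_simps)
    from DERIV_chain2[OF this square_derivative[OF t']]
    have "((\<lambda>t. exp (2 * (c + 1)) * (((h t)\<^sup>2)\<^sup>2 * exp (- (h t)\<^sup>2 / 2))) has_real_derivative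
        2 * h t * h1 t * (?x * (4 - ?x) / 2) * (exp (2 * (c + 1)) * exp (- ?x / 2))) (at t)"
      by (rule DERIV_cong) simp
    from DERIV_diff[OF first_integral_derivative[OF t'] this]
    show "(\<Psi> has_real_derivative 2 * h t * h1 t * (?x * (4 - ?x) / 2) * ?d) (at t)"
      by (simp add: \<Psi>_def right_diff_distrib)
    have d: "?d = exp (c * ?x / 2) - exp (2 * (c + 1) - ?x / 2)"
      by (simp flip: exp_add)
    have diff: "c * ?x / 2 - (2 * (c + 1) - ?x / 2) = (c + 1) * (?x - 4) / 2"
      by (simp add: field_simps)
    have "0 \<le> (4 - ?x) * ?d"
    proof (cases "?x \<le> 4")
      case True
      then have "0 \<le> (c + 1) * (?x - 4)"
        using c by (intro mult_nonpos_nonpos) auto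
      then have "2 * (c + 1) - ?x / 2 \<le> c * ?x / 2"
        using diff by linarith
      then show ?thesis
        using True unfolding d by (intro mult_nonneg_nonneg) auto
    next
      case False
      then have "(c + 1) * (?x - 4) \<le> 0"
        using c by (intro mult_nonpos_nonneg) auto
      then have "c * ?x / 2 \<le> 2 * (c + 1) - ?x / 2"
        using diff by linarith
      then show ?thesis
        using False unfolding d by (intro mult_nonpos_nonpos) auto
    qed
    moreover have "h t * h1 t * ?x \<le> 0"
      using h_pos[OF t'] h1_nonpos[OF t'] by (intro mult_nonpos_nonneg mult_nonneg_nonpos) auto
    ultimately have "(h t * h1 t * ?x) * ((4 - ?x) * ?d) \<le> 0"
      by (simp only: mult_nonpos_nonneg)
    moreover have "(h t * h1 t * ?x) * ((4 - ?x) * ?d) = 2 * h t * h1 t * (?x * (4 - ?x) / 2) * ?d"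
      by simp
    ultimately show "2 * h t * h1 t * (?x * (4 - ?x) / 2) * ?d \<le> 0"
      by (simp only:)
  qed
  have "\<Psi> \<beta> \<le> \<Psi> 0"
    by (rule DERIV_nonpos_imp_nonincreasing[OF less_imp_le[OF \<beta>_pos] mono])
  then have "36 * exp (-3) \<le> 4 * exp (- 1 :: real)"
    unfolding \<Psi>_def h_square_boundary boundary(2,4) by simp
  moreover have "exp (-3) = exp (-1) * exp (-2 :: real)"
    by (simp flip: exp_add)
  ultimately have "exp (-2) \<le> (1 / 9 :: real)"
    by simp
  \<comment> \<open>\<open>1 + s \<le> e\<^sup>s\<close> at \<open>s = -1/6\<close> is just sharp enough for \<open>e\<^sup>2 < 9\<close>.\<close>
  moreover have "(5 / 6) ^ 12 \<le> exp (- 1 / 6 :: real) ^ 12"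
    using exp_ge_add_one_self[of "- 1 / 6"] by (intro power_mono) auto
  then have "(5 / 6) ^ 12 \<le> exp (- 2 :: real)"
    by (simp flip: exp_of_nat_mult)
  ultimately show False
    by (simp add: power_divide)
qed

definition scalar_profile :: "real \<Rightarrow> real" where
  "scalar_profile t = 4 + 4 * c - c * (h t)\<^sup>2 * (1 + c * (h1 t)\<^sup>2)"

text \<open>
  The derivative of \<open>x (1 + c p)\<close> with respect to \<open>x\<close>, where \<open>x = h\<^sup>2\<close> and \<open>p = h'\<^sup>2\<close>.
\<close>

definition slope_factor :: "real \<Rightarrow> real" where
  "slope_factor t = 1 + c * (h1 t)\<^sup>2 + c * h t * h2 t"

lemma scalar_profile_derivative:
  assumes t: "t \<in> {0..\<beta>}"
  shows "(scalar_profile has_real_derivative - 2 * c * h t * h1 t * slope_factor t) (at t)"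
  unfolding scalar_profile_def[abs_def] slope_factor_def
  by (auto intro!: derivative_eq_intros h_derivatives[OF t] simp: power2_eq_square algebra_simps)

lemma slope_factor_eq:
  assumes t: "t \<in> {0..\<beta>}"
  shows "slope_factor t = 1 + 2 * c - c * (h1 t)\<^sup>2 - c * (h t)\<^sup>2 * (1 + c * (h1 t)\<^sup>2) / 2"
  using ode[OF t] unfolding slope_factor_def by algebra

lemma slope_factor_derivative:
  assumes t: "t \<in> {0..\<beta>}" and zero: "slope_factor t = 0"
  shows "(slope_factor has_real_derivative 2 * h1 t * (1 + c * (h1 t)\<^sup>2) / h t) (at t)"
proof -
  note d = h_derivatives[OF t] h2_derivative[OF t]
  have "(slope_factor has_real_derivative
      2 * c * h1 t * h2 t + c * (h1 t * h2 t + h t * h3 t)) (at t)"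
    unfolding slope_factor_def[abs_def]
    by (auto intro!: derivative_eq_intros d simp: algebra_simps)
  moreover have "2 * c * h1 t * h2 t + c * (h1 t * h2 t + h t * h3 t) = 2 * h1 t * (1 + c * (h1 t)\<^sup>2) / h t"
  proof -
    have hh2: "c * h t * h2 t = - (1 + c * (h1 t)\<^sup>2)"
      using zero by (simp add: slope_factor_def)
    have hh3: "h t * h3 t = - (5 * h1 t * h2 t + h t * h1 t * (1 + c * (h1 t)\<^sup>2) + c * (h t)\<^sup>2 * h1 t * h2 t)"
      using h_pos[OF t] by (simp add: h3_def)
    have "h t * (2 * c * h1 t * h2 t + c * (h1 t * h2 t + h t * h3 t)) = 2 * h1 t * (1 + c * (h1 t)\<^sup>2)"
      using hh2 unfolding hh3 by algebra
    then show ?thesis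
      using h_pos[OF t] by (simp add: field_simps)
  qed
  ultimately show ?thesis
    by simp
qed

text \<open>
  The factor is positive at both ends.  At the last \<open>t\<close> where it is not, it vanishes, and it is
  positive from there to \<open>\<beta>\<close>; so \<open>h\<^sup>2 (1 + c h'\<^sup>2)\<close> decreases to its final value 2 and is positive at
  that \<open>t\<close>.  By \<open>slope_factor_derivative\<close> the factor then decreases through 0, a contradiction.
\<close>

lemma slope_factor_pos:
  assumes "t \<in> {0..\<beta>}"
  shows "0 < slope_factor t"
proof (rule ccontr)
  assume neg: "\<not> 0 < slope_factor t"
  define Z where "Z = {s \<in> {0..\<beta>}. slope_factor s \<le> 0}"
  have cont: "continuous_on {0..\<beta>} slope_factor"
    unfolding slope_factor_def[abs_def] by (intro continuous_intros continuous_derivatives)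
  have ends: "0 < slope_factor 0" "0 < slope_factor \<beta>"
    using slope_factor_eq[of 0] slope_factor_eq[of \<beta>] \<beta>_pos c_neg c_gt
    by (simp_all add: boundary(2,4) h_square_boundary)
  have compact: "compact Z"
  proof -
    have "closed Z"
      unfolding Z_def using continuous_closed_preimage[OF cont, of "{..0}"]
      by (simp add: vimage_def Int_def)
    moreover have "Z = {0..\<beta>} \<inter> Z"
      by (auto simp: Z_def)
    ultimately show ?thesis
      by (metis compact_Icc compact_Int_closed)
  qed
  have "Z \<noteq> {}"
    using assms neg by (force simp: Z_def)
  from compact_attains_sup[OF compact this] obtain t1 where t1: "t1 \<in> Z" "\<forall>s\<in>Z. s \<le> t1"
    by (elim bexE)
  have t1': "t1 \<in> {0<..<\<beta>}" "t1 \<in> {0..\<beta>}" "slope_factor t1 \<le> 0"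
    using t1(1) ends by (auto simp: Z_def less_le)
  have after: "0 < slope_factor s" if "t1 < s" "s \<le> \<beta>" for s
    using bspec[OF t1(2), of s] that t1'(2) by (force simp: Z_def)
  have zero: "slope_factor t1 = 0"
  proof (rule ccontr)
    assume "slope_factor t1 \<noteq> 0"
    moreover have "continuous_on {t1..\<beta>} slope_factor"
      using cont by (rule continuous_on_subset) (use t1' in auto)
    ultimately obtain s where "t1 \<le> s" "s \<le> \<beta>" "slope_factor s = 0"
      using IVT'[of slope_factor t1 0 \<beta>] t1' ends by auto
    then show False
      using after[of s] \<open>slope_factor t1 \<noteq> 0\<close> by (cases "s = t1") auto
  qed
  have "scalar_profile \<beta> \<le> scalar_profile t1"
  proof (rule DERIV_nonpos_imp_nonincreasing[where f = scalar_profile])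
    fix s assume s: "t1 \<le> s" "s \<le> \<beta>"
    then have s': "s \<in> {0..\<beta>}"
      using t1' by auto
    have "0 \<le> slope_factor s"
      using after[of s] zero s by (cases "s = t1") auto
    moreover have "0 \<le> - 2 * c * h s"
      using h_pos[OF s'] c_neg by (simp add: mult_nonpos_nonneg)
    ultimately have "- 2 * c * h s * h1 s * slope_factor s \<le> 0"
      using h1_nonpos[OF s'] by (metis mult_nonneg_nonpos mult_nonpos_nonneg)
    then show "\<exists>y. (scalar_profile has_real_derivative y) (at s) \<and> y \<le> 0"
      using scalar_profile_derivative[OF s'] by blast
  qed (use t1' in auto)
  then have "- c * 2 \<le> - c * ((h t1)\<^sup>2 * (1 + c * (h1 t1)\<^sup>2))"
    by (simp add: scalar_profile_def boundary(4) h_square_boundary)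
  then have "2 \<le> (h t1)\<^sup>2 * (1 + c * (h1 t1)\<^sup>2)"
    by (rule mult_left_le_imp_le) (use c_neg in simp)
  then have "0 < 1 + c * (h1 t1)\<^sup>2"
    using h_pos[OF t1'(2)] by (smt (verit) mult_nonneg_nonpos zero_le_power2)
  then have "2 * h1 t1 * (1 + c * (h1 t1)\<^sup>2) / h t1 < 0"
    using h1_neg[OF t1'(1)] h_pos[OF t1'(2)] by (simp add: divide_neg_pos mult_neg_pos)
  from DERIV_neg_dec_right[OF slope_factor_derivative[OF t1'(2) zero] this]
  obtain d where d: "d > 0" "\<And>e. \<lbrakk>0 < e; e < d\<rbrakk> \<Longrightarrow> slope_factor (t1 + e) < slope_factor t1"
    by blast
  define e where "e = min (d / 2) (\<beta> - t1)"
  have "0 < e" "e < d" "t1 + e \<le> \<beta>"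
    using d(1) t1'(1) by (auto simp: e_def min_def)
  then show False
    using d(2)[of e] after[of "t1 + e"] zero by simp
qed

lemma scalar_profile_strict_antimono: "strict_antimono_on {0..\<beta>} scalar_profile"
proof (rule monotone_onI)
  fix s t assume st: "s \<in> {0..\<beta>}" "t \<in> {0..\<beta>}" "s < t"
  have "scalar_profile s > scalar_profile t"
  proof (rule DERIV_neg_imp_decreasing_open[OF st(3)])
    fix r assume "s < r" "r < t"
    then have r: "r \<in> {0..\<beta>}" "r \<in> {0<..<\<beta>}"
      using st by auto
    have "0 < - 2 * c * h r"
      using h_pos[OF r(1)] c_neg by (simp add: mult_neg_pos)
    from mult_neg_pos[OF mult_pos_neg[OF this h1_neg[OF r(2)]] slope_factor_pos[OF r(1)]]
    have "- 2 * c * h r * h1 r * slope_factor r < 0" .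
    then show "\<exists>y. (scalar_profile has_real_derivative y) (at r) \<and> y < 0"
      using scalar_profile_derivative[OF r(1)] by blast
  next
    show "continuous_on {s..t} scalar_profile"
      by (intro continuous_at_imp_continuous_on ballI DERIV_isCont[OF scalar_profile_derivative])
        (use st in auto)
  qed
  then show "scalar_profile t < scalar_profile s" .
qed

text \<open>
  The derivatives \<open>h2\<close> and \<open>h3\<close> enter the curvature only through \<open>h h2\<close> once \<open>F2\<close> is divided by \<open>F\<close>,
  and the differential equation turns \<open>h h2\<close> into a polynomial in \<open>h\<close> and \<open>h1\<close>.
\<close>

lemma scalar_profile_geometric:
  assumes t: "t \<in> {0<..<\<beta>}"
  defines "F \<equiv> - h t * h1 t" and "F1 \<equiv> - (h1 t)\<^sup>2 - h t * h2 t"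
    and "F2 \<equiv> - 3 * h1 t * h2 t - h t * h3 t"
  shows "- 2 * F2 / F - 4 * h2 t / h t - 2 * (h1 t)\<^sup>2 / (h t)\<^sup>2
    - 4 * F1 * h1 t / (F * h t) + 8 / (h t)\<^sup>2 - 2 * F\<^sup>2 / (h t) ^ 4 = scalar_profile t"
proof -
  let ?p = "(h1 t)\<^sup>2"
  have t': "t \<in> {0..\<beta>}"
    using t by auto
  have nz: "h t \<noteq> 0" "h1 t \<noteq> 0"
    using h_pos[OF t'] h1_neg[OF t] by auto
  have hh3: "h t * h3 t = - (5 * h1 t * h2 t + h t * h1 t * (1 + c * ?p) + c * (h t)\<^sup>2 * h1 t * h2 t)"
    using nz by (simp add: h3_def)
  have "F2 = h1 t * (2 * h2 t + h t * (1 + c * ?p) + c * (h t)\<^sup>2 * h2 t)"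
    unfolding F2_def hh3 by algebra
  then have F2: "F2 / F = - (2 * (h2 t / h t) + (1 + c * ?p) + c * h t * h2 t)"
    using nz by (simp add: F_def field_simps power2_eq_square)
  have F1: "F1 * h1 t / (F * h t) = (?p + h t * h2 t) / (h t)\<^sup>2"
    using nz by (simp add: F_def F1_def field_simps power2_eq_square)
  have F: "F\<^sup>2 / (h t) ^ 4 = ?p / (h t)\<^sup>2"
    using nz by (simp add: F_def field_simps power2_eq_square power4_eq_xxxx)
  have h2: "h2 t / h t = (h t * h2 t) / (h t)\<^sup>2"
    using nz by (simp add: power2_eq_square)
  have "- 2 * F2 / F - 4 * h2 t / h t - 2 * ?p / (h t)\<^sup>2
      - 4 * F1 * h1 t / (F * h t) + 8 / (h t)\<^sup>2 - 2 * F\<^sup>2 / (h t) ^ 4 =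
      - 2 * (F2 / F) - 4 * (h2 t / h t) - 2 * (?p / (h t)\<^sup>2)
      - 4 * (F1 * h1 t / (F * h t)) + 8 / (h t)\<^sup>2 - 2 * (F\<^sup>2 / (h t) ^ 4)"
    by simp
  also have "\<dots> = 2 * (1 + c * ?p) + 2 * (c * h t * h2 t) + (8 - 8 * ?p - 2 * (2 * h t * h2 t)) / (h t)\<^sup>2"
    unfolding F2 F1 F h2 by (simp add: add_divide_distrib diff_divide_distrib algebra_simps)
  also have "\<dots> = 4 * (1 + c * ?p) + c * (2 * h t * h2 t)"
  proof -
    have "(8 - 8 * ?p - 2 * (2 * h t * h2 t)) / (h t)\<^sup>2 = 2 * (1 + c * ?p)"
      unfolding ode[OF t'] using nz by (simp add: field_simps)
    then show ?thesis
      by simp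
  qed
  also have "\<dots> = scalar_profile t"
    unfolding ode[OF t'] scalar_profile_def by (simp add: algebra_simps)
  finally show ?thesis .
qed

end

section \<open>The soliton in the charts\<close>

text \<open>
  The derivative of the logarithm of \<open>section_factor\<close> (see \<open>section_factor_has_derivative\<close>): its real
  part comes from the modulus, its imaginary part from the phase.
\<close>

definition log_derivative :: "complex2 \<Rightarrow> complex2 \<Rightarrow> complex" where
  "log_derivative x a = Complex (- (snd x \<bullet> snd a) / (1 + (norm (snd x))\<^sup>2))
     (Im (cnj (fst x) * fst a) / (norm (fst x))\<^sup>2)"

text \<open>
  The coordinate of the lifted point that the base chart assumes to be nonzero, as a function of the
  chart coordinates; the other coordinate is this one times \<open>w\<close>.
\<close>

definition section_factor :: "complex2 \<Rightarrow> complex" where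
  "section_factor x = sgn (fst x) /\<^sub>R sqrt (1 + (norm (snd x))\<^sup>2)"

lemma section_factor_norm:
  assumes "fst x \<noteq> 0"
  shows "(norm (section_factor x))\<^sup>2 = 1 / (1 + (norm (snd x))\<^sup>2)"
  using assms by (simp add: section_factor_def norm_sgn power_divide divide_inverse power_inverse)

lemma section_factor_has_derivative:
  assumes nz: "fst x \<noteq> 0"
  shows "(section_factor has_derivative (\<lambda>a. log_derivative x a * section_factor x)) (at x)"
proof -
  let ?v = "fst x" and ?s = "1 + (norm (snd x))\<^sup>2"
  have s: "?s > 0"
    using zero_le_power2[of "norm (snd x)"] by linarith
  have "(inverse has_real_derivative - inverse ((norm ?v)\<^sup>2)) (at (norm ?v))"
    using nz by (auto intro!: derivative_eq_intros simp: power2_eq_square)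
  from has_derivative_scaleR[OF radial_function_has_derivative[OF nz this]
      bounded_linear_imp_has_derivative[OF bounded_linear_fst]]
  have "((\<lambda>y. sgn (fst y)) has_derivative (\<lambda>a. inverse (norm ?v) *\<^sub>R fst a
      + (radial_part x a * - inverse ((norm ?v)\<^sup>2)) *\<^sub>R ?v)) (at x)"
    by (simp add: sgn_div_norm)
  moreover have "inverse (norm ?v) *\<^sub>R fst a + (radial_part x a * - inverse ((norm ?v)\<^sup>2)) *\<^sub>R ?v =
      \<i> * of_real (Im (cnj ?v * fst a) / (norm ?v)\<^sup>2) * sgn ?v" for a
  proof -
    have n: "norm ?v * norm ?v = Re ?v * Re ?v + Im ?v * Im ?v"
      using cmod_power2[of ?v] by (simp add: power2_eq_square)
    have "(norm ?v * norm ?v) *\<^sub>R fst a - (?v \<bullet> fst a) *\<^sub>R ?v = \<i> * of_real (Im (cnj ?v * fst a)) * ?v"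
      by (simp add: n complex_eq_iff inner_complex_def algebra_simps)
    then have "inverse (norm ?v ^ 3) *\<^sub>R ((norm ?v * norm ?v) *\<^sub>R fst a - (?v \<bullet> fst a) *\<^sub>R ?v) =
        inverse (norm ?v ^ 3) *\<^sub>R (\<i> * of_real (Im (cnj ?v * fst a)) * ?v)"
      by simp
    then show ?thesis
      using nz by (simp add: radial_part_def sgn_div_norm scaleR_diff_right power2_eq_square
          power3_eq_cube scaleR_conv_of_real field_simps)
  qed
  ultimately have phase: "((\<lambda>y. sgn (fst y)) has_derivative
      (\<lambda>a. \<i> * of_real (Im (cnj ?v * fst a) / (norm ?v)\<^sup>2) * sgn ?v)) (at x)"
    by simp
  have "((\<lambda>y::complex2. 1 + (norm (snd y))\<^sup>2) has_derivative (\<lambda>a. 2 * (snd x \<bullet> snd a))) (at x)"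
    unfolding power2_norm_eq_inner
    by (auto intro!: derivative_eq_intros simp: inner_commute)
  moreover have "((\<lambda>s. inverse (sqrt s)) has_real_derivative - inverse (2 * ?s * sqrt ?s)) (at ?s)"
    using s by (auto intro!: derivative_eq_intros simp: power2_eq_square field_simps)
  ultimately have "((\<lambda>y. inverse (sqrt (1 + (norm (snd y))\<^sup>2))) has_derivative
      (\<lambda>a. - inverse (2 * ?s * sqrt ?s) * (2 * (snd x \<bullet> snd a)))) (at x)"
    unfolding has_field_derivative_def by (rule has_derivative_compose)
  from has_derivative_scaleR[OF this phase]
  have "(section_factor has_derivative (\<lambda>a. inverse (sqrt ?s) *\<^sub>R
        (\<i> * of_real (Im (cnj ?v * fst a) / (norm ?v)\<^sup>2) * sgn ?v)
      + (- inverse (2 * ?s * sqrt ?s) * (2 * (snd x \<bullet> snd a))) *\<^sub>R sgn ?v)) (at x)"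
    by (simp add: section_factor_def[abs_def])
  moreover have "inverse (sqrt ?s) *\<^sub>R (\<i> * of_real (Im (cnj ?v * fst a) / (norm ?v)\<^sup>2) * sgn ?v)
      + (- inverse (2 * ?s * sqrt ?s) * (2 * (snd x \<bullet> snd a))) *\<^sub>R sgn ?v =
      log_derivative x a * section_factor x" for a
  proof -
    have log: "log_derivative x a = of_real (- (snd x \<bullet> snd a) / ?s)
        + \<i> * of_real (Im (cnj ?v * fst a) / (norm ?v)\<^sup>2)"
      by (simp add: log_derivative_def complex_eq_iff)
    have "- inverse (2 * s * q) * (2 * t) = - t / s * inverse q" for s q t :: real
      by (cases "s = 0"; cases "q = 0") (simp_all add: field_simps)
    then have real: "- inverse (2 * ?s * sqrt ?s) * (2 * (snd x \<bullet> snd a)) =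
        - (snd x \<bullet> snd a) / ?s * inverse (sqrt ?s)" .
    have product: "I *\<^sub>R (\<i> * of_real B * z) + (A * I) *\<^sub>R z = (of_real A + \<i> * of_real B) * (I *\<^sub>R z)"
      for A B I :: real and z :: complex
      by (simp add: scaleR_conv_of_real ring_distribs)
    show ?thesis
      unfolding log real section_factor_def by (rule product)
  qed
  ultimately show ?thesis
    by simp
qed

fun orbit_radius :: "real \<Rightarrow> chart_end \<Rightarrow> real \<Rightarrow> real" where
  "orbit_radius \<beta> Lower_End r = r"
| "orbit_radius \<beta> Upper_End r = \<beta> - r"

fun end_sign :: "chart_end \<Rightarrow> real" where
  "end_sign Lower_End = 1"
| "end_sign Upper_End = -1"

lemma orbit_param_eq: "orbit_param \<beta> e v = orbit_radius \<beta> e (norm v)"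
  by (cases e) auto

fun section_point :: "base_chart \<Rightarrow> complex \<Rightarrow> complex \<Rightarrow> complex2" where
  "section_point First_Nonzero \<sigma> z = (\<sigma>, z)"
| "section_point Second_Nonzero \<sigma> z = (z, \<sigma>)"

lemma chart_lift_section:
  assumes "fst x \<noteq> 0"
  shows "chart_lift \<beta> (e, k) x = (section_point k (section_factor x) (section_factor x * snd x),
    orbit_radius \<beta> e (norm (fst x)))"
  using assms by (cases x; cases k)
    (simp_all add: cscale_def section_factor_def orbit_param_eq scaleR_conv_of_real)

lemma chart_lift_derivative:
  assumes nz: "fst x \<noteq> 0"
  shows "dd (chart_lift \<beta> (e, k)) x a =
    (section_point k (log_derivative x a * section_factor x)
       (log_derivative x a * section_factor x * snd x + section_factor x * snd a),
     end_sign e * radial_part x a)"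
proof (rule dd_eq)
  have op: "open {x::complex2. fst x \<noteq> 0}"
  proof -
    have "open (fst -` (- {0::complex}) :: complex2 set)"
      by (intro continuous_open_vimage continuous_intros open_Compl closed_singleton)
    then show ?thesis
      by (simp add: vimage_def)
  qed
  have "((\<lambda>y. section_factor y * snd y) has_derivative
      (\<lambda>a. log_derivative x a * section_factor x * snd x + section_factor x * snd a)) (at x)"
    using has_derivative_mult[OF section_factor_has_derivative[OF nz]
        bounded_linear_imp_has_derivative[OF bounded_linear_snd]]
    by (simp add: add.commute)
  with section_factor_has_derivative[OF nz]
  have "((\<lambda>y. section_point k (section_factor y) (section_factor y * snd y)) has_derivative
      (\<lambda>a. section_point k (log_derivative x a * section_factor x)
       (log_derivative x a * section_factor x * snd x + section_factor x * snd a))) (at x)"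
    by (cases k) (simp_all add: has_derivative_Pair)
  moreover have "(orbit_radius \<beta> e has_real_derivative end_sign e) (at r)" for r
    by (cases e) (auto intro!: derivative_eq_intros simp: orbit_radius.simps[abs_def])
  from radial_function_has_derivative[OF nz this]
  have "((\<lambda>y. orbit_radius \<beta> e (norm (fst y))) has_derivative (\<lambda>a. end_sign e * radial_part x a)) (at x)"
    by (simp add: mult.commute)
  ultimately have "((\<lambda>y. (section_point k (section_factor y) (section_factor y * snd y),
      orbit_radius \<beta> e (norm (fst y)))) has_derivative
      (\<lambda>a. (section_point k (log_derivative x a * section_factor x)
       (log_derivative x a * section_factor x * snd x + section_factor x * snd a),
      end_sign e * radial_part x a))) (at x)"
    by (rule has_derivative_Pair)
  then show "(chart_lift \<beta> (e, k) has_derivative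
      (\<lambda>a. (section_point k (log_derivative x a * section_factor x)
       (log_derivative x a * section_factor x * snd x + section_factor x * snd a),
      end_sign e * radial_part x a))) (at x)"
    by (rule has_derivative_transform_within_open[OF _ op]) (use nz in \<open>simp_all add: chart_lift_section\<close>)
qed

text \<open>
  The components of a tangent vector of the lifted chart along \<open>X\<close>, \<open>Y\<close>, \<open>Z\<close>.  The last two are real and
  imaginary part of \<open>\<sigma>\<^sup>2 z\<close> up to signs: the pairing \<open>q\<^sub>1 dq\<^sub>2 - q\<^sub>2 dq\<^sub>1\<close> annihilates the part of the
  vector that is proportional to the point.
\<close>

lemma section_X_part:
  "section_point k (\<mu> * \<sigma>) (\<mu> * \<sigma> * w + \<sigma> * z) \<bullet> X_field (section_point k \<sigma> (\<sigma> * w)) =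
    (norm \<sigma>)\<^sup>2 * (Im \<mu> * (1 + (norm w)\<^sup>2) + Im (cnj w * z))"
  unfolding cmod_power2
  by (cases k) (simp_all add: X_field_def inner_prod_def inner_complex_def
      power2_eq_square algebra_simps)

lemma section_Y_part:
  "section_point k (\<mu> * \<sigma>) (\<mu> * \<sigma> * w + \<sigma> * z) \<bullet> Y_field (section_point k \<sigma> (\<sigma> * w)) =
    (case k of First_Nonzero \<Rightarrow> 1 | Second_Nonzero \<Rightarrow> -1) * Re (\<sigma>\<^sup>2 * z)"
  by (cases k) (simp_all add: Y_field_def inner_prod_def inner_complex_def power2_eq_square algebra_simps)

lemma section_Z_part:
  "section_point k (\<mu> * \<sigma>) (\<mu> * \<sigma> * w + \<sigma> * z) \<bullet> Z_field (section_point k \<sigma> (\<sigma> * w)) =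
    - (case k of First_Nonzero \<Rightarrow> 1 | Second_Nonzero \<Rightarrow> -1) * Im (\<sigma>\<^sup>2 * z)"
  by (cases k) (simp_all add: Z_field_def inner_prod_def inner_complex_def power2_eq_square algebra_simps)

text \<open>
  The signs in which the base charts and the ends differ occur in squares, so all four charts carry the
  same kind of metric.
\<close>

lemma invariant_metric_chart:
  assumes nz: "fst x \<noteq> 0"
  shows "invariant_metric f h (chart_lift \<beta> (e, k) x) (dd (chart_lift \<beta> (e, k)) x a)
      (dd (chart_lift \<beta> (e, k)) x b) =
    bundle_metric (\<lambda>r. f (orbit_radius \<beta> e r)) (\<lambda>r. h (orbit_radius \<beta> e r)) x a b"
proof -
  let ?\<sigma> = "section_factor x" and ?s = "1 + (norm (snd x))\<^sup>2"
  have s: "?s \<noteq> 0"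
    using zero_le_power2[of "norm (snd x)"] by linarith
  note \<sigma> = section_factor_norm[OF nz]
  have X: "(norm ?\<sigma>)\<^sup>2 * (Im (log_derivative x a) * ?s + Im (cnj (snd x) * snd a)) = connection_form x a" for a
    unfolding \<sigma> using s by (simp add: connection_form_def log_derivative_def field_simps)
  have sign: "end_sign e * end_sign e = 1"
    by (cases e) auto
  have YZ: "Re (?\<sigma>\<^sup>2 * snd a) * Re (?\<sigma>\<^sup>2 * snd b) + Im (?\<sigma>\<^sup>2 * snd a) * Im (?\<sigma>\<^sup>2 * snd b) =
      (snd a \<bullet> snd b) / ?s\<^sup>2"
  proof -
    have "Re (z * p) * Re (z * q) + Im (z * p) * Im (z * q) = (norm z)\<^sup>2 * (p \<bullet> q)" for z p q :: complex
      unfolding cmod_power2 by (simp add: inner_complex_def power2_eq_square algebra_simps)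
    then have "Re (?\<sigma>\<^sup>2 * snd a) * Re (?\<sigma>\<^sup>2 * snd b) + Im (?\<sigma>\<^sup>2 * snd a) * Im (?\<sigma>\<^sup>2 * snd b) =
        (norm (?\<sigma>\<^sup>2))\<^sup>2 * (snd a \<bullet> snd b)" .
    also have "(norm (?\<sigma>\<^sup>2))\<^sup>2 = 1 / ?s\<^sup>2"
      unfolding norm_power \<sigma> by (simp add: power_divide)
    finally show ?thesis
      by simp
  qed
  have YZ': "t * Re (?\<sigma>\<^sup>2 * snd a) * (t * Re (?\<sigma>\<^sup>2 * snd b))
      + - t * Im (?\<sigma>\<^sup>2 * snd a) * (- t * Im (?\<sigma>\<^sup>2 * snd b)) = (snd a \<bullet> snd b) / ?s\<^sup>2"
    if "t * t = 1" for t :: real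
  proof -
    have "t * Re (?\<sigma>\<^sup>2 * snd a) * (t * Re (?\<sigma>\<^sup>2 * snd b))
      + - t * Im (?\<sigma>\<^sup>2 * snd a) * (- t * Im (?\<sigma>\<^sup>2 * snd b)) = (t * t) * (Re (?\<sigma>\<^sup>2 * snd a) * Re (?\<sigma>\<^sup>2 * snd b) + Im (?\<sigma>\<^sup>2 * snd a) * Im (?\<sigma>\<^sup>2 * snd b))"
      by (simp only: algebra_simps)
    then show ?thesis
      by (simp only: that YZ mult_1)
  qed
  have t: "(case k of First_Nonzero \<Rightarrow> 1 | Second_Nonzero \<Rightarrow> -1) * (case k of First_Nonzero \<Rightarrow> 1 | Second_Nonzero \<Rightarrow> -1) = (1::real)"
    by (cases k) auto
  have r: "end_sign e * radial_part x a * (end_sign e * radial_part x b) = radial_part x a * radial_part x b"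
    using sign by (simp add: mult.assoc mult.left_commute flip: mult.assoc)
  show ?thesis
    unfolding chart_lift_derivative[OF nz] chart_lift_section[OF nz] invariant_metric_def bundle_metric_def
      prod.case section_X_part section_Y_part section_Z_part X YZ'[OF t] r
    by simp
qed

lemma open_chart_dom: "open (chart_dom \<beta>)"
proof -
  have "open (fst -` {v::complex. norm v < \<beta>} :: complex2 set)"
    by (intro continuous_open_vimage continuous_intros open_Collect_less)
  moreover have "chart_dom \<beta> = fst -` {v::complex. norm v < \<beta>}"
    by (auto simp: chart_dom_def)
  ultimately show ?thesis
    by simp
qed

context koiso_cao
begin

lemma orbit_radius_inner: "r \<in> {0<..<\<beta>} \<Longrightarrow> orbit_radius \<beta> e r \<in> {0<..<\<beta>}"
  by (cases e) auto

lemma orbit_radius_closed: "r \<in> {0..\<beta>} \<Longrightarrow> orbit_radius \<beta> e r \<in> {0..\<beta>}"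
  by (cases e) auto

text \<open>
  At the upper end the profiles are reflected, so that odd derivatives change sign; \<open>end_sign\<close> is the
  derivative of the reflection.
\<close>

lemma soliton_profile:
  assumes metric: "riemannian_metric_on (punctured_dom \<beta>) g"
    and g_eq: "\<And>x a b. x \<in> punctured_dom \<beta> \<Longrightarrow> g x a b =
      bundle_metric (\<lambda>r. - h (orbit_radius \<beta> e r) * h1 (orbit_radius \<beta> e r)) (\<lambda>r. h (orbit_radius \<beta> e r)) x a b"
  defines "\<tau> \<equiv> orbit_radius \<beta> e"
  shows "bundle_metric_profile \<beta> (\<lambda>r. - h (\<tau> r) * h1 (\<tau> r))
    (\<lambda>r. end_sign e * (- (h1 (\<tau> r))\<^sup>2 - h (\<tau> r) * h2 (\<tau> r)))
    (\<lambda>r. - 3 * h1 (\<tau> r) * h2 (\<tau> r) - h (\<tau> r) * h3 (\<tau> r))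
    (\<lambda>r. h (\<tau> r)) (\<lambda>r. end_sign e * h1 (\<tau> r)) (\<lambda>r. h2 (\<tau> r)) g"
proof
  fix r assume r: "r \<in> {0<..<\<beta>}"
  then have t: "\<tau> r \<in> {0<..<\<beta>}" "\<tau> r \<in> {0..\<beta>}"
    unfolding \<tau>_def using orbit_radius_inner orbit_radius_closed by auto
  have \<tau>': "(\<tau> has_real_derivative end_sign e) (at r)"
    unfolding \<tau>_def by (cases e) (auto intro!: derivative_eq_intros simp: orbit_radius.simps[abs_def])
  have sign: "end_sign e * end_sign e = 1"
    by (cases e) auto
  note d = DERIV_chain2[OF h_derivatives(1)[OF t(2)] \<tau>'] DERIV_chain2[OF h_derivatives(2)[OF t(2)] \<tau>']
    DERIV_chain2[OF h2_derivative[OF t(2)] \<tau>']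
  show "0 < - h (\<tau> r) * h1 (\<tau> r)" "0 < h (\<tau> r)"
    using h_pos[OF t(2)] h1_neg[OF t(1)] by (auto simp: mult_pos_neg)
  show "((\<lambda>r. - h (\<tau> r) * h1 (\<tau> r)) has_real_derivative
      end_sign e * (- (h1 (\<tau> r))\<^sup>2 - h (\<tau> r) * h2 (\<tau> r))) (at r)"
    by (auto intro!: derivative_eq_intros d simp: power2_eq_square algebra_simps)
  show "((\<lambda>r. h (\<tau> r)) has_real_derivative end_sign e * h1 (\<tau> r)) (at r)"
    using d(1) by (simp add: mult.commute)
  show "((\<lambda>r. end_sign e * h1 (\<tau> r)) has_real_derivative h2 (\<tau> r)) (at r)"
    by (rule DERIV_cong[OF DERIV_cmult[OF d(2)]]) (use sign in algebra)
  have "((\<lambda>r. - (h1 (\<tau> r))\<^sup>2 - h (\<tau> r) * h2 (\<tau> r)) has_real_derivative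
      end_sign e * (- 3 * h1 (\<tau> r) * h2 (\<tau> r) - h (\<tau> r) * h3 (\<tau> r))) (at r)"
    by (auto intro!: derivative_eq_intros d simp: algebra_simps)
  from DERIV_cmult[OF this, of "end_sign e"]
  show "((\<lambda>r. end_sign e * (- (h1 (\<tau> r))\<^sup>2 - h (\<tau> r) * h2 (\<tau> r))) has_real_derivative
      - 3 * h1 (\<tau> r) * h2 (\<tau> r) - h (\<tau> r) * h3 (\<tau> r)) (at r)"
    using sign by (simp flip: mult.assoc)
next
  have cont_\<tau>: "continuous_on {0<..<\<beta>} \<tau>"
    unfolding \<tau>_def by (cases e) (auto intro!: continuous_intros simp: orbit_radius.simps[abs_def])
  have sub: "\<tau> ` {0<..<\<beta>} \<subseteq> {0..\<beta>}"
    unfolding \<tau>_def by (cases e) auto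
  have cont: "continuous_on {0<..<\<beta>} (\<lambda>r. \<phi> (\<tau> r))" if "continuous_on {0..\<beta>} \<phi>" for \<phi> :: "real \<Rightarrow> real"
    using continuous_on_compose2[OF that cont_\<tau> sub] .
  have "continuous_on {0..\<beta>} h3"
    unfolding h3_def[abs_def] using h_pos
    by (intro continuous_intros continuous_derivatives) (auto simp: less_imp_neq[symmetric])
  note C = continuous_derivatives[THEN cont] this[THEN cont]
  show "continuous_on {0<..<\<beta>} (\<lambda>r. - 3 * h1 (\<tau> r) * h2 (\<tau> r) - h (\<tau> r) * h3 (\<tau> r))"
    by (intro continuous_intros C)
  show "continuous_on {0<..<\<beta>} (\<lambda>r. h2 (\<tau> r))"
    by (rule C)
  show "riemannian_metric_on (punctured_dom \<beta>) g"
    by (rule metric)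
  show "g x a b = bundle_metric (\<lambda>r. - h (\<tau> r) * h1 (\<tau> r)) (\<lambda>r. h (\<tau> r)) x a b"
    if "x \<in> punctured_dom \<beta>" for x a b
    using g_eq[OF that] by (simp add: \<tau>_def)
qed

lemma scalar_curvature_regular:
  assumes "riemannian_metric_on (punctured_dom \<beta>) g"
    and "\<And>x a b. x \<in> punctured_dom \<beta> \<Longrightarrow> g x a b =
      bundle_metric (\<lambda>r. - h (orbit_radius \<beta> e r) * h1 (orbit_radius \<beta> e r)) (\<lambda>r. h (orbit_radius \<beta> e r)) x a b"
    and x: "x \<in> punctured_dom \<beta>"
  shows "scalar_curvature g x = scalar_profile (orbit_param \<beta> e (fst x))"
proof -
  let ?t = "orbit_radius \<beta> e (norm (fst x))"
  have t: "?t \<in> {0<..<\<beta>}"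
    using x by (intro orbit_radius_inner) (auto simp: punctured_dom_def)
  have sign: "(end_sign e)\<^sup>2 = 1" "end_sign e * end_sign e = 1"
    by (cases e; simp)+
  have "end_sign e * p * (end_sign e * q) = p * q" for p q
    using sign(2) by (simp add: mult.assoc mult.left_commute flip: mult.assoc)
  then have cross: "4 * (end_sign e * p) * (end_sign e * q) = 4 * p * q" for p q
    by (simp add: mult.assoc)
  show ?thesis
    using bundle_metric_profile.scalar_curvature_bundle_metric[OF soliton_profile[OF assms(1,2)] x]
    unfolding orbit_param_eq scalar_profile_geometric[OF t, symmetric] cross power_mult_distrib sign(1) mult_1
    by simp
qed

end

lemma riemannian_metric_on_subset:
  "riemannian_metric_on U g \<Longrightarrow> V \<subseteq> U \<Longrightarrow> riemannian_metric_on V g"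
  unfolding riemannian_metric_on_def smooth_on_def
  by (meson subsetD times_cont_diff_on_subset)

text \<open>
  Equivalent points of \<open>S\<^sup>3 \<times> [0,\<beta>]\<close> have the same \<open>t\<close>, so the chart that the definition of the
  scalar curvature on \<open>M\<close> selects cannot influence its value.
\<close>

lemma M_point_orbit_param:
  assumes "q \<in> S3" "t \<in> {0..\<beta>}" "inv_chart \<beta> (e, k) x = M_point \<beta> q t"
  shows "orbit_param \<beta> e (fst x) = t"
proof -
  obtain p s where ps: "chart_lift \<beta> (e, k) x = (p, s)"
    by fastforce
  have s: "s = orbit_param \<beta> e (fst x)"
    using ps by (cases x) simp
  have "(q, t) \<in> M_point \<beta> q t"
    using assms(1,2) by (simp add: M_point_def hopf_collapse_def)
  then have "(q, t) \<in> M_point \<beta> p s"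
    using assms(3) ps by (simp add: inv_chart_def)
  then show ?thesis
    using s by (auto simp: M_point_def hopf_collapse_def)
qed

locale soliton = koiso_cao c \<beta> h for c \<beta> :: real and h +
  fixes G :: "chart_index \<Rightarrow> complex2 \<Rightarrow> complex2 \<Rightarrow> complex2 \<Rightarrow> real"
  assumes soliton: "koiso_cao_soliton c \<beta> h G"
begin

lemma chart_metric: "riemannian_metric_on (chart_dom \<beta>) (G \<kappa>)"
  using soliton unfolding koiso_cao_soliton_def by blast

lemma scalar_curvature_punctured:
  assumes x: "x \<in> punctured_dom \<beta>"
  shows "scalar_curvature (G (e, k)) x = scalar_profile (orbit_param \<beta> e (fst x))"
proof (rule scalar_curvature_regular[OF _ _ x])
  have sub: "punctured_dom \<beta> \<subseteq> chart_dom \<beta>"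
    by (auto simp: punctured_dom_def chart_dom_def)
  show "riemannian_metric_on (punctured_dom \<beta>) (G (e, k))"
    by (rule riemannian_metric_on_subset[OF chart_metric sub])
  fix x a b assume x: "x \<in> punctured_dom \<beta>"
  then have nz: "fst x \<noteq> 0" and "x \<in> chart_dom \<beta>"
    using sub by (auto simp: punctured_dom_def)
  then have "G (e, k) x a b = invariant_metric (\<lambda>t. - h t * h1 t) h (chart_lift \<beta> (e, k) x)
      (dd (chart_lift \<beta> (e, k)) x a) (dd (chart_lift \<beta> (e, k)) x b)"
    using soliton unfolding koiso_cao_soliton_def by blast
  then show "G (e, k) x a b = bundle_metric (\<lambda>r. - h (orbit_radius \<beta> e r) * h1 (orbit_radius \<beta> e r))
      (\<lambda>r. h (orbit_radius \<beta> e r)) x a b"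
    by (simp add: invariant_metric_chart[OF nz])
qed

lemma scalar_curvature_chart:
  assumes x: "x \<in> chart_dom \<beta>"
  shows "scalar_curvature (G (e, k)) x = scalar_profile (orbit_param \<beta> e (fst x))"
proof (cases "fst x = 0")
  case False
  then show ?thesis
    using x by (intro scalar_curvature_punctured) (auto simp: punctured_dom_def chart_dom_def)
next
  case True
  \<comment> \<open>On a singular orbit both sides are limits along regular points; \<open>n + 2\<close> keeps these in the chart.\<close>
  define y where "y = (\<lambda>n::nat. (complex_of_real (\<beta> / real (n + 2)), snd x))"
  interpret riemannian_metric "chart_dom \<beta>" "G (e, k)"
    by unfold_locales (rule open_chart_dom chart_metric)+
  have y: "y n \<in> punctured_dom \<beta>" for n
  proof -
    have "0 < \<beta> / real (n + 2)" "\<beta> / real (n + 2) < \<beta>"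
      using \<beta>_pos by (simp_all add: field_simps add_pos_nonneg)
    then show ?thesis
      unfolding y_def punctured_dom_def mem_Collect_eq fst_conv of_real_eq_0_iff norm_of_real by linarith
  qed
  have "(\<lambda>n. complex_of_real (\<beta> / real (n + 2))) \<longlonglongrightarrow> complex_of_real 0"
    by (intro tendsto_of_real LIMSEQ_ignore_initial_segment[OF lim_const_over_n])
  then have lim: "y \<longlonglongrightarrow> x"
    using True tendsto_Pair[OF _ tendsto_const] unfolding y_def by (cases x) force
  have profile_cont: "continuous_on {0..\<beta>} scalar_profile"
    by (intro continuous_at_imp_continuous_on ballI DERIV_isCont[OF scalar_profile_derivative])
  have "continuous_on (chart_dom \<beta>) (\<lambda>x. orbit_param \<beta> e (fst x))"
    by (cases e) (auto intro!: continuous_intros)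
  moreover have "orbit_param \<beta> e (fst x) \<in> {0..\<beta>}" if "x \<in> chart_dom \<beta>" for x
    using that by (cases e) (auto simp: chart_dom_def)
  ultimately have "continuous_on (chart_dom \<beta>) (\<lambda>x. scalar_profile (orbit_param \<beta> e (fst x)))"
    by (intro continuous_on_compose2[OF profile_cont]) auto
  moreover have dom: "\<forall>\<^sub>F n in sequentially. y n \<in> chart_dom \<beta>"
    by (intro always_eventually allI)
      (use y in \<open>auto simp: punctured_dom_def chart_dom_def split_beta\<close>)
  ultimately have "(\<lambda>n. scalar_profile (orbit_param \<beta> e (fst (y n)))) \<longlonglongrightarrow> scalar_profile (orbit_param \<beta> e (fst x))"
    using continuous_on_tendsto_compose[OF _ lim x] by blast
  moreover have "(\<lambda>n. scalar_curvature (G (e, k)) (y n)) \<longlonglongrightarrow> scalar_curvature (G (e, k)) x"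
    by (rule continuous_on_tendsto_compose[OF scalar_curvature_continuous lim x dom])
  ultimately show ?thesis
    unfolding scalar_curvature_punctured[OF y] by (rule LIMSEQ_unique[rotated])
qed

lemma M_scalar_curvature:
  assumes q: "q \<in> S3" and t: "t \<in> {0..\<beta>}"
  shows "M_scalar_curvature \<beta> G (M_point \<beta> q t) = scalar_profile t"
proof -
  let ?P = "\<lambda>(\<kappa>, x). x \<in> chart_dom \<beta> \<and> inv_chart \<beta> \<kappa> x = M_point \<beta> q t"
  obtain e k x where choice: "(SOME z. ?P z) = ((e, k), x)"
    by (rule prod_cases3[of "case SOME z. ?P z of ((e, k), x) \<Rightarrow> (e, k, x)"]) (auto split: prod.splits)
  have "\<exists>z. ?P z"
    using inv_chart_cover[OF \<beta>_pos q t] by auto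
  then have "?P (SOME z. ?P z)"
    by (rule someI_ex)
  then have "x \<in> chart_dom \<beta>" "inv_chart \<beta> (e, k) x = M_point \<beta> q t"
    unfolding choice by auto
  then show ?thesis
    unfolding M_scalar_curvature_def choice
    by (simp add: scalar_curvature_chart M_point_orbit_param[OF q t])
qed

end

theorem proposition3p2:
  fixes c \<beta> :: real and h :: "real \<Rightarrow> real"
    and G :: "chart_index \<Rightarrow> complex2 \<Rightarrow> complex2 \<Rightarrow> complex2 \<Rightarrow> real"
  assumes "koiso_cao_soliton c \<beta> h G"
  shows "\<exists>S :: real \<Rightarrow> real.
    (\<forall>q\<in>S3. \<forall>t\<in>{0..\<beta>}. M_scalar_curvature \<beta> G (M_point \<beta> q t) = S t) \<and>
    strict_antimono_on {0..\<beta>} S"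
proof -
  interpret soliton c \<beta> h G
    using assms by unfold_locales (simp_all add: koiso_cao_soliton_def)
  show ?thesis
    using M_scalar_curvature scalar_profile_strict_antimono by blast
qed

end
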